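(* Let $\emptyset$ be the empty 2-category and let $\mathsf{Bi}^{\mathsf{fbr}}_{\mathsf r}$ be the 2-category of flat small braided bimonoidal categories, robust braided bimonoidal functors, and bimonoidal natural transformations. The variant $\Sigma'$ of the finite ordinal category is a lax bicolimit of the unique 2-functor $\emptyset\to\mathsf{Bi}^{\mathsf{fbr}}_{\mathsf r}$. That is, $\Sigma'$ is an object of $\mathsf{Bi}^{\mathsf{fbr}}_{\mathsf r}$ and, for every flat small braided bimonoidal category $C$, the unique functor $\mathsf{Bi}^{\mathsf{fbr}}_{\mathsf r}(\Sigma',C)\to\mathbf 1$ to the terminal category is an equivalence of categories.
   Context: Write $AB$ for $A\otimes B$; $\otimes$ binds tighter than $\oplus$. A bimonoidal category is a category $C$ with a symmetric monoidal structure $(\oplus,0,\alpha^\oplus,\lambda^\oplus,\rho^\oplus,\zeta^\oplus)$, a monoidal structure $(\otimes,1,\alpha^\otimes,\lambda^\otimes,\rho^\otimes)$ (with $\alpha_{A,B,C}:(AB)C\to A(BC)$, $\lambda_A$, $\rho_A$ the left/right unit isomorphisms), natural isomorphisms $\lambda^\bullet_A:0A\to0$, $\rho^\bullet_A:A0\to 0$, and natural monomorphisms $\delta^l_{A,B,C}:A(B\oplus C)\to AB\oplus AC$, $\delta^r_{A,B,C}:(A\oplus B)C\to AC\oplus BC$, such that for all objects: $\delta^l_{A,C,B}(1\otimes\zeta^\oplus_{B,C})=\zeta^\oplus_{AB,AC}\delta^l_{A,B,C}$; $\delta^r_{B,A,C}(\zeta^\oplus_{A,B}\otimes1)=\zeta^\oplus_{AC,BC}\delta^r_{A,B,C}$;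 $\alpha^\oplus(\delta^r_{A,B,D}\oplus1)\delta^r_{A\oplus B,C,D}=(1\oplus\delta^r_{B,C,D})\delta^r_{A,B\oplus C,D}(\alpha^\oplus_{A,B,C}\otimes1)$; $\alpha^\oplus(\delta^l_{A,B,C}\oplus1)\delta^l_{A,B\oplus C,D}=(1\oplus\delta^l_{A,C,D})\delta^l_{A,B,C\oplus D}(1\otimes\alpha^\oplus_{B,C,D})$; $\delta^l_{A,BC,BD}(1\otimes\delta^l_{B,C,D})\alpha^\otimes_{A,B,C\oplus D}=(\alpha^\otimes_{A,B,C}\oplus\alpha^\otimes_{A,B,D})\delta^l_{AB,C,D}$; $(\alpha^\otimes_{A,C,D}\oplus\alpha^\otimes_{B,C,D})\delta^r_{AC,BC,D}(\delta^r_{A,B,C}\otimes1)=\delta^r_{A,B,CD}\alpha^\otimes_{A\oplus B,C,D}$; $(\alpha^\otimes_{A,B,D}\oplus\alpha^\otimes_{A,C,D})\delta^r_{AB,AC,D}(\delta^l_{A,B,C}\otimes1)=\delta^l_{A,BD,CD}(1\otimes\delta^r_{B,C,D})\alpha^\otimes_{A,B\oplus C,D}$; $\mu(\delta^l_{A,C,D}\oplus\delta^l_{B,C,D})\delta^r_{A,B,C\oplus D}=(\delta^r_{A,B,C}\oplus\delta^r_{A,B,D})\delta^l_{A\oplus B,C,D}$, where $\mu:(AC\oplus AD)\oplus(BC\oplus BD)\to(AC\oplus BC)\oplus(AD\oplus BD)$ is the coherence isomorphism exchanging the two middle summands; $\lambda^\bullet_0=\rho^\bullet_0$; $\lambda^\oplus_0(\lambda^\bullet_A\oplus\lambda^\bullet_B)\delta^l_{0,A,B}=\lambda^\bullet_{A\oplus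 B}$; $\lambda^\oplus_0(\rho^\bullet_A\oplus\rho^\bullet_B)\delta^r_{A,B,0}=\rho^\bullet_{A\oplus B}$; $\rho^\otimes_0=\lambda^\bullet_1$; $\lambda^\otimes_0=\rho^\bullet_1$; $\lambda^\bullet_{AB}\alpha^\otimes_{0,A,B}=\lambda^\bullet_B(\lambda^\bullet_A\otimes1)$; $\rho^\bullet_A(1\otimes\lambda^\bullet_B)\alpha^\otimes_{A,0,B}=\lambda^\bullet_B(\rho^\bullet_A\otimes1)$; $\rho^\bullet_A(1\otimes\rho^\bullet_B)\alpha^\otimes_{A,B,0}=\rho^\bullet_{AB}$; $\lambda^\oplus_{AB}(\rho^\bullet_A\oplus1)\delta^l_{A,0,B}=1\otimes\lambda^\oplus_B$; $\lambda^\oplus_{BA}(\lambda^\bullet_A\oplus1)\delta^r_{0,B,A}=\lambda^\oplus_B\otimes1$; $\rho^\oplus_{AB}(1\oplus\rho^\bullet_A)\delta^l_{A,B,0}=1\otimes\rho^\oplus_B$; $\rho^\oplus_{AB}(1\oplus\lambda^\bullet_B)\delta^r_{A,0,B}=\rho^\oplus_A\otimes1$; $(\lambda^\otimes_A\oplus\lambda^\otimes_B)\delta^l_{1,A,B}=\lambda^\otimes_{A\oplus B}$; $(\rho^\otimes_A\oplus\rho^\otimes_B)\delta^r_{A,B,1}=\rho^\otimes_{A\oplus B}$. A braided bimonoidal category is a bimonoidal category with a braiding $\zeta^\otimes$ making $\otimes$ braided monoidal, such that $\delta^l_{C,A,B}\zeta^\otimes_{A\oplus B,C}=(\zeta^\otimes_{A,C}\oplus\zeta^\otimes_{B,C})\delta^r_{A,B,C}$,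 $\delta^r_{B,C,A}\zeta^\otimes_{A,B\oplus C}=(\zeta^\otimes_{A,B}\oplus\zeta^\otimes_{A,C})\delta^l_{A,B,C}$, $\lambda^\bullet_A\zeta^\otimes_{A,0}=\rho^\bullet_A$, and $\rho^\bullet_A\zeta^\otimes_{0,A}=\lambda^\bullet_A$. It is flat if every morphism in the following class is a monomorphism: the smallest class containing all components of $\delta^l,\delta^r$ and closed under $f\mapsto f\oplus1_A,\ 1_A\oplus f,\ f\otimes1_A,\ 1_A\otimes f$ for all objects $A$. A braided bimonoidal functor $F:C\to D$ is a functor with a symmetric monoidal structure $(F^2_\oplus,F^0_\oplus)$ with respect to $\oplus$ and a braided monoidal structure $(F^2_\otimes,F^0_\otimes)$ with respect to $\otimes$ (lax direction: $FA\otimes FB\to F(A\otimes B)$, $1\to F1$, etc.) such that $F(\lambda^\bullet_A)F^2_\otimes(F^0_\oplus\otimes1_{FA})=F^0_\oplus\lambda^\bullet_{FA}$ and $F(\delta^l_{A,B,C})F^2_\otimes(1\otimes F^2_\oplus)=F^2_\oplus(F^2_\otimes\oplus F^2_\otimes)\delta^l_{FA,FB,FC}$. It is robust if $F^2_\oplus,F^0_\oplus,F^0_\otimes$ are isomorphisms. A bimonoidal natural transformation is a natural transformation that is monoidal with respect to both the $\oplus$ and the $\otimes$ structures. The category $\Sigma'$ has objects the integers $n\ge0$; $\Sigma'(n,n)$ is the symmetric group $\Sigma_n$ and there are no other morphisms. Sum: $m\oplus n=m+n$, block sum of permutations; $\zeta^\oplus_{m,n}$ swaps the two blocks. Product: $m\otimes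 n=mn$, where $(i,j)$ with $1\le i\le m$, $1\le j\le n$ is identified with $(i-1)n+j$, and $(\sigma\otimes\tau)(i,j)=(\sigma i,\tau j)$; $\zeta^\otimes_{m,n}(i,j)=(j,i)$. All associativity and unit isomorphisms, $\lambda^\bullet$, $\rho^\bullet$ and $\delta^r$ are identities; $\delta^l_{m,n,p}:m(n+p)\to mn+mp$ is the permutation sending $(i,j)$ with $j\le n$ to $(i-1)n+j$ and $(i,n+j)$ with $1\le j\le p$ to $mn+(i-1)p+j$. *)

theory Defs
  imports "HOL-Library.FuncSet" "HOL-Combinatorics.Permutations"
begin

section \<open>Categories, functors, natural transformations, equivalences\<close>

text \<open>Objects and arrows form sets (of elements of HOL types), so all categories here are small.
  Composition \<open>g \<cdot> f\<close> is in the usual order: first \<open>f\<close>, then \<open>g\<close>.\<close>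

record ('o, 'm) cat =
  Obj :: "'o set"
  Arr :: "'m set"
  Dom :: "'m \<Rightarrow> 'o"
  Cod :: "'m \<Rightarrow> 'o"
  Ident :: "'o \<Rightarrow> 'm"  ("\<i>\<index>")
  Compose :: "'m \<Rightarrow> 'm \<Rightarrow> 'm"  (infixl "\<cdot>\<index>" 55)

definition hom :: "('o, 'm, 'x) cat_scheme \<Rightarrow> 'o \<Rightarrow> 'o \<Rightarrow> 'm set" where
  "hom \<C> A B = {f \<in> Arr \<C>. Dom \<C> f = A \<and> Cod \<C> f = B}"

locale category =
  fixes \<C> :: "('o, 'm, 'x) cat_scheme" (structure)
  assumes dom_in_Obj: "f \<in> Arr \<C> \<Longrightarrow> Dom \<C> f \<in> Obj \<C>"
    and cod_in_Obj: "f \<in> Arr \<C> \<Longrightarrow> Cod \<C> f \<in> Obj \<C>"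
    and ident_in_hom: "A \<in> Obj \<C> \<Longrightarrow> \<i> A \<in> hom \<C> A A"
    and comp_in_hom: "f \<in> hom \<C> A B \<Longrightarrow> g \<in> hom \<C> B C \<Longrightarrow> g \<cdot> f \<in> hom \<C> A C"
    and ident_left: "f \<in> hom \<C> A B \<Longrightarrow> \<i> B \<cdot> f = f"
    and ident_right: "f \<in> hom \<C> A B \<Longrightarrow> f \<cdot> \<i> A = f"
    and comp_assoc: "f \<in> hom \<C> A B \<Longrightarrow> g \<in> hom \<C> B C \<Longrightarrow> h \<in> hom \<C> C D
      \<Longrightarrow> (h \<cdot> g) \<cdot> f = h \<cdot> (g \<cdot> f)"

definition inverse_arrows :: "('o, 'm, 'x) cat_scheme \<Rightarrow> 'm \<Rightarrow> 'm \<Rightarrow> bool" where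
  "inverse_arrows \<C> f g \<longleftrightarrow>
     f \<in> Arr \<C> \<and> g \<in> hom \<C> (Cod \<C> f) (Dom \<C> f) \<and>
     g \<cdot>\<^bsub>\<C>\<^esub> f = \<i>\<^bsub>\<C>\<^esub> (Dom \<C> f) \<and> f \<cdot>\<^bsub>\<C>\<^esub> g = \<i>\<^bsub>\<C>\<^esub> (Cod \<C> f)"

definition is_iso :: "('o, 'm, 'x) cat_scheme \<Rightarrow> 'm \<Rightarrow> bool" where
  "is_iso \<C> f \<longleftrightarrow> (\<exists>g. inverse_arrows \<C> f g)"

definition inv_arr :: "('o, 'm, 'x) cat_scheme \<Rightarrow> 'm \<Rightarrow> 'm" where
  "inv_arr \<C> f = (THE g. inverse_arrows \<C> f g)"

definition is_mono :: "('o, 'm, 'x) cat_scheme \<Rightarrow> 'm \<Rightarrow> bool" where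
  "is_mono \<C> f \<longleftrightarrow> f \<in> Arr \<C> \<and>
     (\<forall>X. \<forall>g \<in> hom \<C> X (Dom \<C> f). \<forall>h \<in> hom \<C> X (Dom \<C> f).
        f \<cdot>\<^bsub>\<C>\<^esub> g = f \<cdot>\<^bsub>\<C>\<^esub> h \<longrightarrow> g = h)"

record ('o, 'm, 'p, 'n) ftor =
  FObj :: "'o \<Rightarrow> 'p"
  FArr :: "'m \<Rightarrow> 'n"

locale cat_functor = dom: category \<C> + cod: category \<D>
  for \<C> :: "('o, 'm, 'x) cat_scheme"
    and \<D> :: "('p, 'n, 'y) cat_scheme" (structure)
    and F :: "('o, 'm, 'p, 'n, 'z) ftor_scheme" +
  assumes FObj_in_Obj: "A \<in> Obj \<C> \<Longrightarrow> FObj F A \<in> Obj \<D>"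
    and FArr_in_hom: "f \<in> hom \<C> A B \<Longrightarrow> FArr F f \<in> hom \<D> (FObj F A) (FObj F B)"
    and FArr_ident: "A \<in> Obj \<C> \<Longrightarrow> FArr F (\<i>\<^bsub>\<C>\<^esub> A) = \<i> (FObj F A)"
    and FArr_comp: "f \<in> hom \<C> A B \<Longrightarrow> g \<in> hom \<C> B C
      \<Longrightarrow> FArr F (g \<cdot>\<^bsub>\<C>\<^esub> f) = FArr F g \<cdot> FArr F f"

definition id_ftor :: "('o, 'm, 'o, 'm) ftor" where
  "id_ftor = \<lparr>FObj = (\<lambda>A. A), FArr = (\<lambda>f. f)\<rparr>"

definition comp_ftor ::
    "('p, 'n, 'q, 'l) ftor \<Rightarrow> ('o, 'm, 'p, 'n) ftor \<Rightarrow> ('o, 'm, 'q, 'l) ftor" where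
  "comp_ftor G F = \<lparr>FObj = FObj G \<circ> FObj F, FArr = FArr G \<circ> FArr F\<rparr>"

locale nat_trans = F: cat_functor \<C> \<D> F + G: cat_functor \<C> \<D> G
  for \<C> :: "('o, 'm, 'x) cat_scheme"
    and \<D> :: "('p, 'n, 'y) cat_scheme" (structure)
    and F G :: "('o, 'm, 'p, 'n, 'z) ftor_scheme"
    and \<tau> :: "'o \<Rightarrow> 'n" +
  assumes component_in_hom: "A \<in> Obj \<C> \<Longrightarrow> \<tau> A \<in> hom \<D> (FObj F A) (FObj G A)"
    and naturality: "f \<in> hom \<C> A B \<Longrightarrow> \<tau> B \<cdot> FArr F f = FArr G f \<cdot> \<tau> A"

locale nat_iso = nat_trans +
  assumes component_iso: "A \<in> Obj \<C> \<Longrightarrow> is_iso \<D> (\<tau> A)"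

definition cat_equivalence ::
    "('o, 'm, 'x) cat_scheme \<Rightarrow> ('p, 'n, 'y) cat_scheme \<Rightarrow> ('o, 'm, 'p, 'n) ftor \<Rightarrow> bool" where
  "cat_equivalence \<C> \<D> F \<longleftrightarrow> cat_functor \<C> \<D> F \<and>
     (\<exists>G \<eta> \<epsilon>. cat_functor \<D> \<C> G \<and>
        nat_iso \<C> \<C> id_ftor (comp_ftor G F) \<eta> \<and> nat_iso \<D> \<D> (comp_ftor F G) id_ftor \<epsilon>)"

definition terminal_cat :: "(unit, unit) cat" where
  "terminal_cat = \<lparr>Obj = UNIV, Arr = UNIV, Dom = (\<lambda>_. ()), Cod = (\<lambda>_. ()),
     Ident = (\<lambda>_. ()), Compose = (\<lambda>_ _. ())\<rparr>"


section \<open>Monoidal categories and monoidal functors\<close>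

record ('o, 'm) monoidal_struct =
  tensor_obj :: "'o \<Rightarrow> 'o \<Rightarrow> 'o"  (infixl "\<odot>\<index>" 70)
  tensor_arr :: "'m \<Rightarrow> 'm \<Rightarrow> 'm"  (infixl "\<star>\<index>" 70)
  tensor_unit :: "'o"  ("\<e>\<index>")
  assoc :: "'o \<Rightarrow> 'o \<Rightarrow> 'o \<Rightarrow> 'm"
  lunit :: "'o \<Rightarrow> 'm"
  runit :: "'o \<Rightarrow> 'm"

locale monoidal_category = category \<C>
  for \<C> :: "('o, 'm, 'x) cat_scheme" (structure) +
  fixes M :: "('o, 'm) monoidal_struct"
  assumes tensor_in_Obj: "A \<in> Obj \<C> \<Longrightarrow> B \<in> Obj \<C> \<Longrightarrow> A \<odot>\<^bsub>M\<^esub> B \<in> Obj \<C>"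
    and tensor_in_hom: "f \<in> hom \<C> A A' \<Longrightarrow> g \<in> hom \<C> B B'
      \<Longrightarrow> f \<star>\<^bsub>M\<^esub> g \<in> hom \<C> (A \<odot>\<^bsub>M\<^esub> B) (A' \<odot>\<^bsub>M\<^esub> B')"
    and tensor_ident: "A \<in> Obj \<C> \<Longrightarrow> B \<in> Obj \<C> \<Longrightarrow> \<i> A \<star>\<^bsub>M\<^esub> \<i> B = \<i> (A \<odot>\<^bsub>M\<^esub> B)"
    and tensor_comp: "f \<in> hom \<C> A A' \<Longrightarrow> f' \<in> hom \<C> A' A'' \<Longrightarrow> g \<in> hom \<C> B B' \<Longrightarrow> g' \<in> hom \<C> B' B''
      \<Longrightarrow> (f' \<cdot> f) \<star>\<^bsub>M\<^esub> (g' \<cdot> g) = (f' \<star>\<^bsub>M\<^esub> g') \<cdot> (f \<star>\<^bsub>M\<^esub> g)"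
    and unit_in_Obj: "\<e>\<^bsub>M\<^esub> \<in> Obj \<C>"
    and assoc_in_hom: "A \<in> Obj \<C> \<Longrightarrow> B \<in> Obj \<C> \<Longrightarrow> C \<in> Obj \<C>
      \<Longrightarrow> assoc M A B C \<in> hom \<C> ((A \<odot>\<^bsub>M\<^esub> B) \<odot>\<^bsub>M\<^esub> C) (A \<odot>\<^bsub>M\<^esub> (B \<odot>\<^bsub>M\<^esub> C))"
    and assoc_iso: "A \<in> Obj \<C> \<Longrightarrow> B \<in> Obj \<C> \<Longrightarrow> C \<in> Obj \<C> \<Longrightarrow> is_iso \<C> (assoc M A B C)"
    and assoc_natural: "f \<in> hom \<C> A A' \<Longrightarrow> g \<in> hom \<C> B B' \<Longrightarrow> h \<in> hom \<C> C C'
      \<Longrightarrow> assoc M A' B' C' \<cdot> ((f \<star>\<^bsub>M\<^esub> g) \<star>\<^bsub>M\<^esub> h) = (f \<star>\<^bsub>M\<^esub> (g \<star>\<^bsub>M\<^esub> h)) \<cdot> assoc M A B C"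
    and lunit_in_hom: "A \<in> Obj \<C> \<Longrightarrow> lunit M A \<in> hom \<C> (\<e>\<^bsub>M\<^esub> \<odot>\<^bsub>M\<^esub> A) A"
    and lunit_iso: "A \<in> Obj \<C> \<Longrightarrow> is_iso \<C> (lunit M A)"
    and lunit_natural: "f \<in> hom \<C> A A' \<Longrightarrow> lunit M A' \<cdot> (\<i> \<e>\<^bsub>M\<^esub> \<star>\<^bsub>M\<^esub> f) = f \<cdot> lunit M A"
    and runit_in_hom: "A \<in> Obj \<C> \<Longrightarrow> runit M A \<in> hom \<C> (A \<odot>\<^bsub>M\<^esub> \<e>\<^bsub>M\<^esub>) A"
    and runit_iso: "A \<in> Obj \<C> \<Longrightarrow> is_iso \<C> (runit M A)"
    and runit_natural: "f \<in> hom \<C> A A' \<Longrightarrow> runit M A' \<cdot> (f \<star>\<^bsub>M\<^esub> \<i> \<e>\<^bsub>M\<^esub>) = f \<cdot> runit M A"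
    and pentagon: "A \<in> Obj \<C> \<Longrightarrow> B \<in> Obj \<C> \<Longrightarrow> C \<in> Obj \<C> \<Longrightarrow> D \<in> Obj \<C>
      \<Longrightarrow> assoc M A B (C \<odot>\<^bsub>M\<^esub> D) \<cdot> assoc M (A \<odot>\<^bsub>M\<^esub> B) C D
        = (\<i> A \<star>\<^bsub>M\<^esub> assoc M B C D) \<cdot> assoc M A (B \<odot>\<^bsub>M\<^esub> C) D \<cdot> (assoc M A B C \<star>\<^bsub>M\<^esub> \<i> D)"
    and triangle: "A \<in> Obj \<C> \<Longrightarrow> B \<in> Obj \<C>
      \<Longrightarrow> (\<i> A \<star>\<^bsub>M\<^esub> lunit M B) \<cdot> assoc M A \<e>\<^bsub>M\<^esub> B = runit M A \<star>\<^bsub>M\<^esub> \<i> B"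

locale braided_monoidal_category = monoidal_category \<C> M
  for \<C> :: "('o, 'm, 'x) cat_scheme" (structure) and M +
  fixes \<zeta> :: "'o \<Rightarrow> 'o \<Rightarrow> 'm"
  assumes braid_in_hom: "A \<in> Obj \<C> \<Longrightarrow> B \<in> Obj \<C> \<Longrightarrow> \<zeta> A B \<in> hom \<C> (A \<odot>\<^bsub>M\<^esub> B) (B \<odot>\<^bsub>M\<^esub> A)"
    and braid_iso: "A \<in> Obj \<C> \<Longrightarrow> B \<in> Obj \<C> \<Longrightarrow> is_iso \<C> (\<zeta> A B)"
    and braid_natural: "f \<in> hom \<C> A A' \<Longrightarrow> g \<in> hom \<C> B B'
      \<Longrightarrow> \<zeta> A' B' \<cdot> (f \<star>\<^bsub>M\<^esub> g) = (g \<star>\<^bsub>M\<^esub> f) \<cdot> \<zeta> A B"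
    and hexagon: "A \<in> Obj \<C> \<Longrightarrow> B \<in> Obj \<C> \<Longrightarrow> C \<in> Obj \<C>
      \<Longrightarrow> assoc M B C A \<cdot> \<zeta> A (B \<odot>\<^bsub>M\<^esub> C) \<cdot> assoc M A B C
        = (\<i> B \<star>\<^bsub>M\<^esub> \<zeta> A C) \<cdot> assoc M B A C \<cdot> (\<zeta> A B \<star>\<^bsub>M\<^esub> \<i> C)"
    and hexagon_inv: "A \<in> Obj \<C> \<Longrightarrow> B \<in> Obj \<C> \<Longrightarrow> C \<in> Obj \<C>
      \<Longrightarrow> inv_arr \<C> (assoc M C A B) \<cdot> \<zeta> (A \<odot>\<^bsub>M\<^esub> B) C \<cdot> inv_arr \<C> (assoc M A B C)
        = (\<zeta> A C \<star>\<^bsub>M\<^esub> \<i> B) \<cdot> inv_arr \<C> (assoc M A C B) \<cdot> (\<i> A \<star>\<^bsub>M\<^esub> \<zeta> B C)"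

locale symmetric_monoidal_category = braided_monoidal_category +
  assumes symmetry: "A \<in> Obj \<C> \<Longrightarrow> B \<in> Obj \<C> \<Longrightarrow> \<zeta> B A \<cdot> \<zeta> A B = \<i> (A \<odot>\<^bsub>M\<^esub> B)"

locale monoidal_functor =
  cat_functor \<C> \<D> F + source: monoidal_category \<C> M + target: monoidal_category \<D> N
  for \<C> :: "('o, 'm, 'x) cat_scheme" and M
    and \<D> :: "('p, 'n, 'y) cat_scheme" (structure) and N
    and F :: "('o, 'm, 'p, 'n, 'z) ftor_scheme" +
  fixes F2 :: "'o \<Rightarrow> 'o \<Rightarrow> 'n" and F0 :: "'n"
  assumes F0_in_hom: "F0 \<in> hom \<D> \<e>\<^bsub>N\<^esub> (FObj F \<e>\<^bsub>M\<^esub>)"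
    and F2_in_hom: "A \<in> Obj \<C> \<Longrightarrow> B \<in> Obj \<C>
      \<Longrightarrow> F2 A B \<in> hom \<D> (FObj F A \<odot>\<^bsub>N\<^esub> FObj F B) (FObj F (A \<odot>\<^bsub>M\<^esub> B))"
    and F2_natural: "f \<in> hom \<C> A A' \<Longrightarrow> g \<in> hom \<C> B B'
      \<Longrightarrow> F2 A' B' \<cdot> (FArr F f \<star>\<^bsub>N\<^esub> FArr F g) = FArr F (f \<star>\<^bsub>M\<^esub> g) \<cdot> F2 A B"
    and F2_assoc: "A \<in> Obj \<C> \<Longrightarrow> B \<in> Obj \<C> \<Longrightarrow> C \<in> Obj \<C>
      \<Longrightarrow> FArr F (assoc M A B C) \<cdot> F2 (A \<odot>\<^bsub>M\<^esub> B) C \<cdot> (F2 A B \<star>\<^bsub>N\<^esub> \<i> (FObj F C))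
        = F2 A (B \<odot>\<^bsub>M\<^esub> C) \<cdot> (\<i> (FObj F A) \<star>\<^bsub>N\<^esub> F2 B C)
            \<cdot> assoc N (FObj F A) (FObj F B) (FObj F C)"
    and F2_lunit: "A \<in> Obj \<C>
      \<Longrightarrow> FArr F (lunit M A) \<cdot> F2 \<e>\<^bsub>M\<^esub> A \<cdot> (F0 \<star>\<^bsub>N\<^esub> \<i> (FObj F A)) = lunit N (FObj F A)"
    and F2_runit: "A \<in> Obj \<C>
      \<Longrightarrow> FArr F (runit M A) \<cdot> F2 A \<e>\<^bsub>M\<^esub> \<cdot> (\<i> (FObj F A) \<star>\<^bsub>N\<^esub> F0) = runit N (FObj F A)"

text \<open>A symmetric monoidal functor is a braided one between symmetric monoidal categories.\<close>

locale braided_monoidal_functor =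
  monoidal_functor \<C> M \<D> N F F2 F0
  + source: braided_monoidal_category \<C> M \<zeta> + target: braided_monoidal_category \<D> N \<xi>
  for \<C> :: "('o, 'm, 'x) cat_scheme" and M \<zeta>
    and \<D> :: "('p, 'n, 'y) cat_scheme" (structure) and N \<xi>
    and F :: "('o, 'm, 'p, 'n, 'z) ftor_scheme" and F2 F0 +
  assumes F2_braid: "A \<in> Obj \<C> \<Longrightarrow> B \<in> Obj \<C>
      \<Longrightarrow> FArr F (\<zeta> A B) \<cdot> F2 A B = F2 B A \<cdot> \<xi> (FObj F A) (FObj F B)"

locale monoidal_nat_trans =
  nat_trans \<C> \<D> F G \<tau>
  + F: monoidal_functor \<C> M \<D> N F F2 F0 + G: monoidal_functor \<C> M \<D> N G G2 G0
  for \<C> :: "('o, 'm, 'x) cat_scheme" and M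
    and \<D> :: "('p, 'n, 'y) cat_scheme" (structure) and N
    and F :: "('o, 'm, 'p, 'n, 'z) ftor_scheme" and F2 F0
    and G :: "('o, 'm, 'p, 'n, 'z) ftor_scheme" and G2 G0
    and \<tau> :: "'o \<Rightarrow> 'n" +
  assumes component_unit: "\<tau> \<e>\<^bsub>M\<^esub> \<cdot> F0 = G0"
    and component_tensor: "A \<in> Obj \<C> \<Longrightarrow> B \<in> Obj \<C>
      \<Longrightarrow> \<tau> (A \<odot>\<^bsub>M\<^esub> B) \<cdot> F2 A B = G2 A B \<cdot> (\<tau> A \<star>\<^bsub>N\<^esub> \<tau> B)"


section \<open>Bimonoidal categories\<close>

record ('o, 'm) bimon = "('o, 'm) cat" +
  AddM :: "('o, 'm) monoidal_struct"
  AddBraid :: "'o \<Rightarrow> 'o \<Rightarrow> 'm"  ("\<zeta>\<^sup>\<oplus>\<index>")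
  MulM :: "('o, 'm) monoidal_struct"
  LNull :: "'o \<Rightarrow> 'm"  ("\<lambda>\<^sup>\<bullet>\<index>")
  RNull :: "'o \<Rightarrow> 'm"  ("\<rho>\<^sup>\<bullet>\<index>")
  DistL :: "'o \<Rightarrow> 'o \<Rightarrow> 'o \<Rightarrow> 'm"  ("\<delta>\<^sup>l\<index>")
  DistR :: "'o \<Rightarrow> 'o \<Rightarrow> 'o \<Rightarrow> 'm"  ("\<delta>\<^sup>r\<index>")

text \<open>\<open>\<oplus>\<close>, \<open>\<otimes>\<close> act on objects and \<open>\<boxplus>\<close>, \<open>\<boxtimes>\<close> are their actions on arrows.\<close>

abbreviation sum_obj :: "('o, 'm, 'x) bimon_scheme \<Rightarrow> 'o \<Rightarrow> 'o \<Rightarrow> 'o"  (infixl "\<oplus>\<index>" 65)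
  where "A \<oplus>\<^bsub>\<C>\<^esub> B \<equiv> tensor_obj (AddM \<C>) A B"

abbreviation sum_arr :: "('o, 'm, 'x) bimon_scheme \<Rightarrow> 'm \<Rightarrow> 'm \<Rightarrow> 'm"  (infixl "\<boxplus>\<index>" 65)
  where "f \<boxplus>\<^bsub>\<C>\<^esub> g \<equiv> tensor_arr (AddM \<C>) f g"

abbreviation zero_obj :: "('o, 'm, 'x) bimon_scheme \<Rightarrow> 'o"  ("\<zero>\<index>")
  where "\<zero>\<^bsub>\<C>\<^esub> \<equiv> tensor_unit (AddM \<C>)"

abbreviation sum_assoc :: "('o, 'm, 'x) bimon_scheme \<Rightarrow> 'o \<Rightarrow> 'o \<Rightarrow> 'o \<Rightarrow> 'm"  ("\<alpha>\<^sup>\<oplus>\<index>")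
  where "\<alpha>\<^sup>\<oplus>\<^bsub>\<C>\<^esub> \<equiv> assoc (AddM \<C>)"

abbreviation sum_lunit :: "('o, 'm, 'x) bimon_scheme \<Rightarrow> 'o \<Rightarrow> 'm"  ("\<lambda>\<^sup>\<oplus>\<index>")
  where "\<lambda>\<^sup>\<oplus>\<^bsub>\<C>\<^esub> \<equiv> lunit (AddM \<C>)"

abbreviation sum_runit :: "('o, 'm, 'x) bimon_scheme \<Rightarrow> 'o \<Rightarrow> 'm"  ("\<rho>\<^sup>\<oplus>\<index>")
  where "\<rho>\<^sup>\<oplus>\<^bsub>\<C>\<^esub> \<equiv> runit (AddM \<C>)"

abbreviation prod_obj :: "('o, 'm, 'x) bimon_scheme \<Rightarrow> 'o \<Rightarrow> 'o \<Rightarrow> 'o"  (infixl "\<otimes>\<index>" 70)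
  where "A \<otimes>\<^bsub>\<C>\<^esub> B \<equiv> tensor_obj (MulM \<C>) A B"

abbreviation prod_arr :: "('o, 'm, 'x) bimon_scheme \<Rightarrow> 'm \<Rightarrow> 'm \<Rightarrow> 'm"  (infixl "\<boxtimes>\<index>" 70)
  where "f \<boxtimes>\<^bsub>\<C>\<^esub> g \<equiv> tensor_arr (MulM \<C>) f g"

abbreviation one_obj :: "('o, 'm, 'x) bimon_scheme \<Rightarrow> 'o"  ("\<one>\<index>")
  where "\<one>\<^bsub>\<C>\<^esub> \<equiv> tensor_unit (MulM \<C>)"

abbreviation prod_assoc :: "('o, 'm, 'x) bimon_scheme \<Rightarrow> 'o \<Rightarrow> 'o \<Rightarrow> 'o \<Rightarrow> 'm"  ("\<alpha>\<^sup>\<otimes>\<index>")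
  where "\<alpha>\<^sup>\<otimes>\<^bsub>\<C>\<^esub> \<equiv> assoc (MulM \<C>)"

abbreviation prod_lunit :: "('o, 'm, 'x) bimon_scheme \<Rightarrow> 'o \<Rightarrow> 'm"  ("\<lambda>\<^sup>\<otimes>\<index>")
  where "\<lambda>\<^sup>\<otimes>\<^bsub>\<C>\<^esub> \<equiv> lunit (MulM \<C>)"

abbreviation prod_runit :: "('o, 'm, 'x) bimon_scheme \<Rightarrow> 'o \<Rightarrow> 'm"  ("\<rho>\<^sup>\<otimes>\<index>")
  where "\<rho>\<^sup>\<otimes>\<^bsub>\<C>\<^esub> \<equiv> runit (MulM \<C>)"

text \<open>The coherence isomorphism
  \<open>(W \<oplus> X) \<oplus> (Y \<oplus> Z) \<rightarrow> W \<oplus> (X \<oplus> (Y \<oplus> Z)) \<rightarrow> W \<oplus> ((X \<oplus> Y) \<oplus> Z) \<rightarrow> W \<oplus> ((Y \<oplus> X) \<oplus> Z)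
   \<rightarrow> W \<oplus> (Y \<oplus> (X \<oplus> Z)) \<rightarrow> (W \<oplus> Y) \<oplus> (X \<oplus> Z)\<close>.\<close>

definition mid_exchange ::
    "('o, 'm, 'x) bimon_scheme \<Rightarrow> 'o \<Rightarrow> 'o \<Rightarrow> 'o \<Rightarrow> 'o \<Rightarrow> 'm"  ("\<mu>\<index>") where
  "\<mu>\<^bsub>\<C>\<^esub> W X Y Z =
     inv_arr \<C> (\<alpha>\<^sup>\<oplus>\<^bsub>\<C>\<^esub> W Y (X \<oplus>\<^bsub>\<C>\<^esub> Z))
     \<cdot>\<^bsub>\<C>\<^esub> (\<i>\<^bsub>\<C>\<^esub> W \<boxplus>\<^bsub>\<C>\<^esub>
          (\<alpha>\<^sup>\<oplus>\<^bsub>\<C>\<^esub> Y X Z \<cdot>\<^bsub>\<C>\<^esub> (\<zeta>\<^sup>\<oplus>\<^bsub>\<C>\<^esub> X Y \<boxplus>\<^bsub>\<C>\<^esub> \<i>\<^bsub>\<C>\<^esub> Z) \<cdot>\<^bsub>\<C>\<^esub> inv_arr \<C> (\<alpha>\<^sup>\<oplus>\<^bsub>\<C>\<^esub> X Y Z)))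
     \<cdot>\<^bsub>\<C>\<^esub> \<alpha>\<^sup>\<oplus>\<^bsub>\<C>\<^esub> W X (Y \<oplus>\<^bsub>\<C>\<^esub> Z)"

locale bimonoidal_category =
  add: symmetric_monoidal_category \<C> "AddM \<C>" "AddBraid \<C>" + mul: monoidal_category \<C> "MulM \<C>"
  for \<C> :: "('o, 'm, 'x) bimon_scheme" (structure) +
  assumes
        LNull_in_hom: "A \<in> Obj \<C> \<Longrightarrow> \<lambda>\<^sup>\<bullet> A \<in> hom \<C> (\<zero> \<otimes> A) \<zero>"
    and LNull_iso: "A \<in> Obj \<C> \<Longrightarrow> is_iso \<C> (\<lambda>\<^sup>\<bullet> A)"
    and LNull_natural: "f \<in> hom \<C> A A' \<Longrightarrow> \<lambda>\<^sup>\<bullet> A' \<cdot> (\<i> \<zero> \<boxtimes> f) = \<lambda>\<^sup>\<bullet> A"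
    and RNull_in_hom: "A \<in> Obj \<C> \<Longrightarrow> \<rho>\<^sup>\<bullet> A \<in> hom \<C> (A \<otimes> \<zero>) \<zero>"
    and RNull_iso: "A \<in> Obj \<C> \<Longrightarrow> is_iso \<C> (\<rho>\<^sup>\<bullet> A)"
    and RNull_natural: "f \<in> hom \<C> A A' \<Longrightarrow> \<rho>\<^sup>\<bullet> A' \<cdot> (f \<boxtimes> \<i> \<zero>) = \<rho>\<^sup>\<bullet> A"
    and DistL_in_hom: "A \<in> Obj \<C> \<Longrightarrow> B \<in> Obj \<C> \<Longrightarrow> C \<in> Obj \<C>
      \<Longrightarrow> \<delta>\<^sup>l A B C \<in> hom \<C> (A \<otimes> (B \<oplus> C)) (A \<otimes> B \<oplus> A \<otimes> C)"
    and DistL_mono: "A \<in> Obj \<C> \<Longrightarrow> B \<in> Obj \<C> \<Longrightarrow> C \<in> Obj \<C> \<Longrightarrow> is_mono \<C> (\<delta>\<^sup>l A B C)"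
    and DistL_natural: "f \<in> hom \<C> A A' \<Longrightarrow> g \<in> hom \<C> B B' \<Longrightarrow> h \<in> hom \<C> C C'
      \<Longrightarrow> \<delta>\<^sup>l A' B' C' \<cdot> (f \<boxtimes> (g \<boxplus> h)) = (f \<boxtimes> g \<boxplus> f \<boxtimes> h) \<cdot> \<delta>\<^sup>l A B C"
    and DistR_in_hom: "A \<in> Obj \<C> \<Longrightarrow> B \<in> Obj \<C> \<Longrightarrow> C \<in> Obj \<C>
      \<Longrightarrow> \<delta>\<^sup>r A B C \<in> hom \<C> ((A \<oplus> B) \<otimes> C) (A \<otimes> C \<oplus> B \<otimes> C)"
    and DistR_mono: "A \<in> Obj \<C> \<Longrightarrow> B \<in> Obj \<C> \<Longrightarrow> C \<in> Obj \<C> \<Longrightarrow> is_mono \<C> (\<delta>\<^sup>r A B C)"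
    and DistR_natural: "f \<in> hom \<C> A A' \<Longrightarrow> g \<in> hom \<C> B B' \<Longrightarrow> h \<in> hom \<C> C C'
      \<Longrightarrow> \<delta>\<^sup>r A' B' C' \<cdot> ((f \<boxplus> g) \<boxtimes> h) = (f \<boxtimes> h \<boxplus> g \<boxtimes> h) \<cdot> \<delta>\<^sup>r A B C"
    and DistL_braid: "A \<in> Obj \<C> \<Longrightarrow> B \<in> Obj \<C> \<Longrightarrow> C \<in> Obj \<C>
      \<Longrightarrow> \<delta>\<^sup>l A C B \<cdot> (\<i> A \<boxtimes> \<zeta>\<^sup>\<oplus> B C) = \<zeta>\<^sup>\<oplus> (A \<otimes> B) (A \<otimes> C) \<cdot> \<delta>\<^sup>l A B C"
    and DistR_braid: "A \<in> Obj \<C> \<Longrightarrow> B \<in> Obj \<C> \<Longrightarrow> C \<in> Obj \<C>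
      \<Longrightarrow> \<delta>\<^sup>r B A C \<cdot> (\<zeta>\<^sup>\<oplus> A B \<boxtimes> \<i> C) = \<zeta>\<^sup>\<oplus> (A \<otimes> C) (B \<otimes> C) \<cdot> \<delta>\<^sup>r A B C"
    and DistR_sum_assoc: "A \<in> Obj \<C> \<Longrightarrow> B \<in> Obj \<C> \<Longrightarrow> C \<in> Obj \<C> \<Longrightarrow> D \<in> Obj \<C>
      \<Longrightarrow> \<alpha>\<^sup>\<oplus> (A \<otimes> D) (B \<otimes> D) (C \<otimes> D) \<cdot> (\<delta>\<^sup>r A B D \<boxplus> \<i> (C \<otimes> D)) \<cdot> \<delta>\<^sup>r (A \<oplus> B) C D
        = (\<i> (A \<otimes> D) \<boxplus> \<delta>\<^sup>r B C D) \<cdot> \<delta>\<^sup>r A (B \<oplus> C) D \<cdot> (\<alpha>\<^sup>\<oplus> A B C \<boxtimes> \<i> D)"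
    and DistL_sum_assoc: "A \<in> Obj \<C> \<Longrightarrow> B \<in> Obj \<C> \<Longrightarrow> C \<in> Obj \<C> \<Longrightarrow> D \<in> Obj \<C>
      \<Longrightarrow> \<alpha>\<^sup>\<oplus> (A \<otimes> B) (A \<otimes> C) (A \<otimes> D) \<cdot> (\<delta>\<^sup>l A B C \<boxplus> \<i> (A \<otimes> D)) \<cdot> \<delta>\<^sup>l A (B \<oplus> C) D
        = (\<i> (A \<otimes> B) \<boxplus> \<delta>\<^sup>l A C D) \<cdot> \<delta>\<^sup>l A B (C \<oplus> D) \<cdot> (\<i> A \<boxtimes> \<alpha>\<^sup>\<oplus> B C D)"
    and DistL_prod_assoc: "A \<in> Obj \<C> \<Longrightarrow> B \<in> Obj \<C> \<Longrightarrow> C \<in> Obj \<C> \<Longrightarrow> D \<in> Obj \<C>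
      \<Longrightarrow> \<delta>\<^sup>l A (B \<otimes> C) (B \<otimes> D) \<cdot> (\<i> A \<boxtimes> \<delta>\<^sup>l B C D) \<cdot> \<alpha>\<^sup>\<otimes> A B (C \<oplus> D)
        = (\<alpha>\<^sup>\<otimes> A B C \<boxplus> \<alpha>\<^sup>\<otimes> A B D) \<cdot> \<delta>\<^sup>l (A \<otimes> B) C D"
    and DistR_prod_assoc: "A \<in> Obj \<C> \<Longrightarrow> B \<in> Obj \<C> \<Longrightarrow> C \<in> Obj \<C> \<Longrightarrow> D \<in> Obj \<C>
      \<Longrightarrow> (\<alpha>\<^sup>\<otimes> A C D \<boxplus> \<alpha>\<^sup>\<otimes> B C D) \<cdot> \<delta>\<^sup>r (A \<otimes> C) (B \<otimes> C) D \<cdot> (\<delta>\<^sup>r A B C \<boxtimes> \<i> D)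
        = \<delta>\<^sup>r A B (C \<otimes> D) \<cdot> \<alpha>\<^sup>\<otimes> (A \<oplus> B) C D"
    and DistLR_prod_assoc: "A \<in> Obj \<C> \<Longrightarrow> B \<in> Obj \<C> \<Longrightarrow> C \<in> Obj \<C> \<Longrightarrow> D \<in> Obj \<C>
      \<Longrightarrow> (\<alpha>\<^sup>\<otimes> A B D \<boxplus> \<alpha>\<^sup>\<otimes> A C D) \<cdot> \<delta>\<^sup>r (A \<otimes> B) (A \<otimes> C) D \<cdot> (\<delta>\<^sup>l A B C \<boxtimes> \<i> D)
        = \<delta>\<^sup>l A (B \<otimes> D) (C \<otimes> D) \<cdot> (\<i> A \<boxtimes> \<delta>\<^sup>r B C D) \<cdot> \<alpha>\<^sup>\<otimes> A (B \<oplus> C) D"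
    and DistLR_exchange: "A \<in> Obj \<C> \<Longrightarrow> B \<in> Obj \<C> \<Longrightarrow> C \<in> Obj \<C> \<Longrightarrow> D \<in> Obj \<C>
      \<Longrightarrow> \<mu> (A \<otimes> C) (A \<otimes> D) (B \<otimes> C) (B \<otimes> D) \<cdot> (\<delta>\<^sup>l A C D \<boxplus> \<delta>\<^sup>l B C D) \<cdot> \<delta>\<^sup>r A B (C \<oplus> D)
        = (\<delta>\<^sup>r A B C \<boxplus> \<delta>\<^sup>r A B D) \<cdot> \<delta>\<^sup>l (A \<oplus> B) C D"
    and Null_zero: "\<lambda>\<^sup>\<bullet> \<zero> = \<rho>\<^sup>\<bullet> \<zero>"
    and LNull_sum: "A \<in> Obj \<C> \<Longrightarrow> B \<in> Obj \<C>
      \<Longrightarrow> \<lambda>\<^sup>\<oplus> \<zero> \<cdot> (\<lambda>\<^sup>\<bullet> A \<boxplus> \<lambda>\<^sup>\<bullet> B) \<cdot> \<delta>\<^sup>l \<zero> A B = \<lambda>\<^sup>\<bullet> (A \<oplus> B)"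
    and RNull_sum: "A \<in> Obj \<C> \<Longrightarrow> B \<in> Obj \<C>
      \<Longrightarrow> \<lambda>\<^sup>\<oplus> \<zero> \<cdot> (\<rho>\<^sup>\<bullet> A \<boxplus> \<rho>\<^sup>\<bullet> B) \<cdot> \<delta>\<^sup>r A B \<zero> = \<rho>\<^sup>\<bullet> (A \<oplus> B)"
    and prod_runit_zero: "\<rho>\<^sup>\<otimes> \<zero> = \<lambda>\<^sup>\<bullet> \<one>"
    and prod_lunit_zero: "\<lambda>\<^sup>\<otimes> \<zero> = \<rho>\<^sup>\<bullet> \<one>"
    and LNull_assoc: "A \<in> Obj \<C> \<Longrightarrow> B \<in> Obj \<C>
      \<Longrightarrow> \<lambda>\<^sup>\<bullet> (A \<otimes> B) \<cdot> \<alpha>\<^sup>\<otimes> \<zero> A B = \<lambda>\<^sup>\<bullet> B \<cdot> (\<lambda>\<^sup>\<bullet> A \<boxtimes> \<i> B)"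
    and LRNull_assoc: "A \<in> Obj \<C> \<Longrightarrow> B \<in> Obj \<C>
      \<Longrightarrow> \<rho>\<^sup>\<bullet> A \<cdot> (\<i> A \<boxtimes> \<lambda>\<^sup>\<bullet> B) \<cdot> \<alpha>\<^sup>\<otimes> A \<zero> B = \<lambda>\<^sup>\<bullet> B \<cdot> (\<rho>\<^sup>\<bullet> A \<boxtimes> \<i> B)"
    and RNull_assoc: "A \<in> Obj \<C> \<Longrightarrow> B \<in> Obj \<C>
      \<Longrightarrow> \<rho>\<^sup>\<bullet> A \<cdot> (\<i> A \<boxtimes> \<rho>\<^sup>\<bullet> B) \<cdot> \<alpha>\<^sup>\<otimes> A B \<zero> = \<rho>\<^sup>\<bullet> (A \<otimes> B)"
    and DistL_zero_left: "A \<in> Obj \<C> \<Longrightarrow> B \<in> Obj \<C>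
      \<Longrightarrow> \<lambda>\<^sup>\<oplus> (A \<otimes> B) \<cdot> (\<rho>\<^sup>\<bullet> A \<boxplus> \<i> (A \<otimes> B)) \<cdot> \<delta>\<^sup>l A \<zero> B = \<i> A \<boxtimes> \<lambda>\<^sup>\<oplus> B"
    and DistR_zero_left: "A \<in> Obj \<C> \<Longrightarrow> B \<in> Obj \<C>
      \<Longrightarrow> \<lambda>\<^sup>\<oplus> (B \<otimes> A) \<cdot> (\<lambda>\<^sup>\<bullet> A \<boxplus> \<i> (B \<otimes> A)) \<cdot> \<delta>\<^sup>r \<zero> B A = \<lambda>\<^sup>\<oplus> B \<boxtimes> \<i> A"
    and DistL_zero_right: "A \<in> Obj \<C> \<Longrightarrow> B \<in> Obj \<C>
      \<Longrightarrow> \<rho>\<^sup>\<oplus> (A \<otimes> B) \<cdot> (\<i> (A \<otimes> B) \<boxplus> \<rho>\<^sup>\<bullet> A) \<cdot> \<delta>\<^sup>l A B \<zero> = \<i> A \<boxtimes> \<rho>\<^sup>\<oplus> B"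
    and DistR_zero_right: "A \<in> Obj \<C> \<Longrightarrow> B \<in> Obj \<C>
      \<Longrightarrow> \<rho>\<^sup>\<oplus> (A \<otimes> B) \<cdot> (\<i> (A \<otimes> B) \<boxplus> \<lambda>\<^sup>\<bullet> B) \<cdot> \<delta>\<^sup>r A \<zero> B = \<rho>\<^sup>\<oplus> A \<boxtimes> \<i> B"
    and DistL_one: "A \<in> Obj \<C> \<Longrightarrow> B \<in> Obj \<C>
      \<Longrightarrow> (\<lambda>\<^sup>\<otimes> A \<boxplus> \<lambda>\<^sup>\<otimes> B) \<cdot> \<delta>\<^sup>l \<one> A B = \<lambda>\<^sup>\<otimes> (A \<oplus> B)"
    and DistR_one: "A \<in> Obj \<C> \<Longrightarrow> B \<in> Obj \<C>
      \<Longrightarrow> (\<rho>\<^sup>\<otimes> A \<boxplus> \<rho>\<^sup>\<otimes> B) \<cdot> \<delta>\<^sup>r A B \<one> = \<rho>\<^sup>\<otimes> (A \<oplus> B)"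

record ('o, 'm) braided_bimon = "('o, 'm) bimon" +
  MulBraid :: "'o \<Rightarrow> 'o \<Rightarrow> 'm"  ("\<zeta>\<^sup>\<otimes>\<index>")

locale braided_bimonoidal_category =
  bimonoidal_category \<C> + mul: braided_monoidal_category \<C> "MulM \<C>" "MulBraid \<C>"
  for \<C> :: "('o, 'm, 'x) braided_bimon_scheme" (structure) +
  assumes DistL_MulBraid: "A \<in> Obj \<C> \<Longrightarrow> B \<in> Obj \<C> \<Longrightarrow> C \<in> Obj \<C>
      \<Longrightarrow> \<delta>\<^sup>l C A B \<cdot> \<zeta>\<^sup>\<otimes> (A \<oplus> B) C = (\<zeta>\<^sup>\<otimes> A C \<boxplus> \<zeta>\<^sup>\<otimes> B C) \<cdot> \<delta>\<^sup>r A B C"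
    and DistR_MulBraid: "A \<in> Obj \<C> \<Longrightarrow> B \<in> Obj \<C> \<Longrightarrow> C \<in> Obj \<C>
      \<Longrightarrow> \<delta>\<^sup>r B C A \<cdot> \<zeta>\<^sup>\<otimes> A (B \<oplus> C) = (\<zeta>\<^sup>\<otimes> A B \<boxplus> \<zeta>\<^sup>\<otimes> A C) \<cdot> \<delta>\<^sup>l A B C"
    and LNull_MulBraid: "A \<in> Obj \<C> \<Longrightarrow> \<lambda>\<^sup>\<bullet> A \<cdot> \<zeta>\<^sup>\<otimes> A \<zero> = \<rho>\<^sup>\<bullet> A"
    and RNull_MulBraid: "A \<in> Obj \<C> \<Longrightarrow> \<rho>\<^sup>\<bullet> A \<cdot> \<zeta>\<^sup>\<otimes> \<zero> A = \<lambda>\<^sup>\<bullet> A"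

inductive_set dist_closure :: "('o, 'm, 'x) bimon_scheme \<Rightarrow> 'm set"
  for \<C> :: "('o, 'm, 'x) bimon_scheme" (structure) where
  DistL: "A \<in> Obj \<C> \<Longrightarrow> B \<in> Obj \<C> \<Longrightarrow> C \<in> Obj \<C> \<Longrightarrow> \<delta>\<^sup>l A B C \<in> dist_closure \<C>"
| DistR: "A \<in> Obj \<C> \<Longrightarrow> B \<in> Obj \<C> \<Longrightarrow> C \<in> Obj \<C> \<Longrightarrow> \<delta>\<^sup>r A B C \<in> dist_closure \<C>"
| sum_right: "f \<in> dist_closure \<C> \<Longrightarrow> A \<in> Obj \<C> \<Longrightarrow> f \<boxplus> \<i> A \<in> dist_closure \<C>"
| sum_left: "f \<in> dist_closure \<C> \<Longrightarrow> A \<in> Obj \<C> \<Longrightarrow> \<i> A \<boxplus> f \<in> dist_closure \<C>"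
| prod_right: "f \<in> dist_closure \<C> \<Longrightarrow> A \<in> Obj \<C> \<Longrightarrow> f \<boxtimes> \<i> A \<in> dist_closure \<C>"
| prod_left: "f \<in> dist_closure \<C> \<Longrightarrow> A \<in> Obj \<C> \<Longrightarrow> \<i> A \<boxtimes> f \<in> dist_closure \<C>"

locale flat_braided_bimonoidal_category = braided_bimonoidal_category +
  assumes flat: "f \<in> dist_closure \<C> \<Longrightarrow> is_mono \<C> f"


section \<open>The hom-categories of the 2-category of flat braided bimonoidal categories\<close>

record ('o, 'm, 'p, 'n) bimon_ftor = "('o, 'm, 'p, 'n) ftor" +
  Add2 :: "'o \<Rightarrow> 'o \<Rightarrow> 'n"
  Add0 :: "'n"
  Mul2 :: "'o \<Rightarrow> 'o \<Rightarrow> 'n"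
  Mul0 :: "'n"

locale braided_bimonoidal_functor =
  source: braided_bimonoidal_category \<C> + target: braided_bimonoidal_category \<D>
  + add: braided_monoidal_functor \<C> "AddM \<C>" "AddBraid \<C>" \<D> "AddM \<D>" "AddBraid \<D>" F "Add2 F" "Add0 F"
  + mul: braided_monoidal_functor \<C> "MulM \<C>" "MulBraid \<C>" \<D> "MulM \<D>" "MulBraid \<D>" F "Mul2 F" "Mul0 F"
  for \<C> :: "('o, 'm) braided_bimon"
    and \<D> :: "('p, 'n) braided_bimon" (structure)
    and F :: "('o, 'm, 'p, 'n) bimon_ftor" +
  assumes F_LNull: "A \<in> Obj \<C>
      \<Longrightarrow> FArr F (\<lambda>\<^sup>\<bullet>\<^bsub>\<C>\<^esub> A) \<cdot> Mul2 F \<zero>\<^bsub>\<C>\<^esub> A \<cdot> (Add0 F \<boxtimes> \<i> (FObj F A)) = Add0 F \<cdot> \<lambda>\<^sup>\<bullet> (FObj F A)"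
    and F_DistL: "A \<in> Obj \<C> \<Longrightarrow> B \<in> Obj \<C> \<Longrightarrow> C \<in> Obj \<C>
      \<Longrightarrow> FArr F (\<delta>\<^sup>l\<^bsub>\<C>\<^esub> A B C) \<cdot> Mul2 F A (B \<oplus>\<^bsub>\<C>\<^esub> C) \<cdot> (\<i> (FObj F A) \<boxtimes> Add2 F B C)
        = Add2 F (A \<otimes>\<^bsub>\<C>\<^esub> B) (A \<otimes>\<^bsub>\<C>\<^esub> C) \<cdot> (Mul2 F A B \<boxplus> Mul2 F A C)
            \<cdot> \<delta>\<^sup>l (FObj F A) (FObj F B) (FObj F C)"

locale robust_braided_bimonoidal_functor = braided_bimonoidal_functor +
  assumes Add2_iso: "A \<in> Obj \<C> \<Longrightarrow> B \<in> Obj \<C> \<Longrightarrow> is_iso \<D> (Add2 F A B)"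
    and Add0_iso: "is_iso \<D> (Add0 F)"
    and Mul0_iso: "is_iso \<D> (Mul0 F)"

locale bimonoidal_nat_trans =
  F: braided_bimonoidal_functor \<C> \<D> F + G: braided_bimonoidal_functor \<C> \<D> G
  + add: monoidal_nat_trans \<C> "AddM \<C>" \<D> "AddM \<D>" F "Add2 F" "Add0 F" G "Add2 G" "Add0 G" \<tau>
  + mul: monoidal_nat_trans \<C> "MulM \<C>" \<D> "MulM \<D>" F "Mul2 F" "Mul0 F" G "Mul2 G" "Mul0 G" \<tau>
  for \<C> :: "('o, 'm) braided_bimon"
    and \<D> :: "('p, 'n) braided_bimon"
    and F G :: "('o, 'm, 'p, 'n) bimon_ftor"
    and \<tau> :: "'o \<Rightarrow> 'n"

text \<open>HOL functions are total. To make functors and transformations be determined by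
  their values on the source category, these are required to be \<open>undefined\<close> elsewhere.\<close>

definition bimon_ftor_extensional ::
    "('o, 'm) braided_bimon \<Rightarrow> ('o, 'm, 'p, 'n) bimon_ftor \<Rightarrow> bool" where
  "bimon_ftor_extensional \<C> F \<longleftrightarrow>
     FObj F \<in> extensional (Obj \<C>) \<and> FArr F \<in> extensional (Arr \<C>) \<and>
     (\<forall>A B. A \<notin> Obj \<C> \<or> B \<notin> Obj \<C> \<longrightarrow> Add2 F A B = undefined \<and> Mul2 F A B = undefined)"

record ('f, 'o, 'n) transf =
  Src :: "'f"
  Tgt :: "'f"
  At :: "'o \<Rightarrow> 'n"

definition robust_ftors ::
    "('o, 'm) braided_bimon \<Rightarrow> ('p, 'n) braided_bimon \<Rightarrow> ('o, 'm, 'p, 'n) bimon_ftor set" where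
  "robust_ftors \<C> \<D> = {F. robust_braided_bimonoidal_functor \<C> \<D> F \<and> bimon_ftor_extensional \<C> F}"

text \<open>The hom-category of robust braided bimonoidal functors and bimonoidal natural transformations
  with vertical composition. It depends on the type variables of both arguments, which is why the
  2-category is given through its objects and hom-categories instead of as a single HOL value.\<close>

definition Bi_fbr_r ::
    "('o, 'm) braided_bimon \<Rightarrow> ('p, 'n) braided_bimon
      \<Rightarrow> (('o, 'm, 'p, 'n) bimon_ftor, (('o, 'm, 'p, 'n) bimon_ftor, 'o, 'n) transf) cat" where
  "Bi_fbr_r \<C> \<D> =
    \<lparr>Obj = robust_ftors \<C> \<D>,
     Arr = {t. Src t \<in> robust_ftors \<C> \<D> \<and> Tgt t \<in> robust_ftors \<C> \<D> \<and>
               bimonoidal_nat_trans \<C> \<D> (Src t) (Tgt t) (At t) \<and> At t \<in> extensional (Obj \<C>)},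
     Dom = Src,
     Cod = Tgt,
     Ident = (\<lambda>F. \<lparr>Src = F, Tgt = F, At = (\<lambda>A\<in>Obj \<C>. \<i>\<^bsub>\<D>\<^esub> (FObj F A))\<rparr>),
     Compose = (\<lambda>s t. \<lparr>Src = Src t, Tgt = Tgt s, At = (\<lambda>A\<in>Obj \<C>. At s A \<cdot>\<^bsub>\<D>\<^esub> At t A)\<rparr>)\<rparr>"


section \<open>The category \<open>\<Sigma>'\<close>\<close>

text \<open>An arrow \<open>n \<rightarrow> n\<close> is a pair \<open>(n, \<sigma>)\<close> with \<open>\<sigma>\<close> a permutation of \<open>{1..n}\<close>, extended by the
  identity to all natural numbers.\<close>

type_synonym perm_arr = "nat \<times> (nat \<Rightarrow> nat)"

definition perm_id :: "nat \<Rightarrow> perm_arr" where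
  "perm_id n = (n, id)"

definition block_sum :: "perm_arr \<Rightarrow> perm_arr \<Rightarrow> perm_arr" where
  "block_sum f g = (let m = fst f; n = fst g in
     (m + n, \<lambda>i. if i \<in> {1..m} then snd f i
                 else if i \<in> {m + 1..m + n} then m + snd g (i - m) else i))"

definition block_swap :: "nat \<Rightarrow> nat \<Rightarrow> perm_arr" where
  "block_swap m n =
     (m + n, \<lambda>i. if i \<in> {1..m} then n + i else if i \<in> {m + 1..m + n} then i - m else i)"

definition lex_index :: "nat \<Rightarrow> nat \<Rightarrow> nat \<Rightarrow> nat" where
  "lex_index n i j = (i - 1) * n + j"

text \<open>The map sending \<open>lex_index n i j\<close>, where \<open>1 \<le> i \<le> m\<close> and \<open>1 \<le> j \<le> n\<close>, to \<open>h i j\<close>.\<close>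

definition on_pairs :: "nat \<Rightarrow> nat \<Rightarrow> (nat \<Rightarrow> nat \<Rightarrow> nat) \<Rightarrow> perm_arr" where
  "on_pairs m n h =
     (m * n, \<lambda>k. if k \<in> {1..m * n} then h ((k - 1) div n + 1) ((k - 1) mod n + 1) else k)"

definition Sigma_add :: "(nat, perm_arr) monoidal_struct" where
  "Sigma_add =
    \<lparr>tensor_obj = (+),
     tensor_arr = block_sum,
     tensor_unit = 0,
     assoc = (\<lambda>m n p. perm_id (m + n + p)),
     lunit = perm_id,
     runit = perm_id\<rparr>"

definition Sigma_mul :: "(nat, perm_arr) monoidal_struct" where
  "Sigma_mul =
    \<lparr>tensor_obj = (*),
     tensor_arr = (\<lambda>f g. on_pairs (fst f) (fst g) (\<lambda>i j. lex_index (fst g) (snd f i) (snd g j))),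
     tensor_unit = 1,
     assoc = (\<lambda>m n p. perm_id (m * n * p)),
     lunit = perm_id,
     runit = perm_id\<rparr>"

definition Sigma_prime :: "(nat, perm_arr) braided_bimon" where
  "Sigma_prime =
    \<lparr>Obj = UNIV,
     Arr = {f. snd f permutes {1..fst f}},
     Dom = fst,
     Cod = fst,
     Ident = perm_id,
     Compose = (\<lambda>g f. (fst f, snd g \<circ> snd f)),
     AddM = Sigma_add,
     AddBraid = block_swap,
     MulM = Sigma_mul,
     LNull = (\<lambda>n. perm_id 0),
     RNull = (\<lambda>n. perm_id 0),
     DistL = (\<lambda>m n p. on_pairs m (n + p)
       (\<lambda>i j. if j \<le> n then lex_index n i j else m * n + lex_index p i (j - n))),
     DistR = (\<lambda>m n p. perm_id ((m + n) * p)),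
     MulBraid = (\<lambda>m n. on_pairs m n (\<lambda>i j. lex_index m j i))\<rparr>"

end

theory Submission
  imports Defs
begin

text \<open>
  Let \<open>\<C>\<close> be a braided bimonoidal category. A robust functor \<open>F\<close> out of \<open>\<Sigma>'\<close> sends \<open>n = 1 + \<dots> + 1\<close> to a sum of
  \<open>n\<close> copies of \<open>F 1\<close>, which is isomorphic to \<open>\<one>\<close>. So there is essentially one candidate, the functor \<open>K\<close> with
  \<open>K n = (\<dots>(\<zero> \<oplus> \<one>) \<oplus> \<dots>) \<oplus> \<one>\<close>. The proof constructs \<open>K\<close> (\<open>power_ftor_robust\<close>) and shows that every robust
  \<open>F\<close> receives exactly one bimonoidal transformation from \<open>K\<close>, and that its components are invertible
  (\<open>cmp_transformation\<close>, \<open>cmp_unique\<close>, \<open>cmp_iso\<close>). Hence there is exactly one arrow between any two robust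
  functors, and the hom-category is equivalent to the terminal category (\<open>equivalence_terminal\<close>).

  The additive structure of \<open>K\<close> is the coherence theorem for symmetric monoidal categories, restricted to
  powers of one object \<open>U\<close>. A permutation of \<open>n + 1\<close> points is uniquely the insertion of the last point at some
  position after a permutation of \<open>n\<close> points, and its action on the power is defined by recursion on this normal form.
  Left multiplication by an adjacent transposition changes normal forms by the same rules on both sides,
  because exchanging the last two factors of \<open>(X \<otimes> U) \<otimes> U\<close> is natural in \<open>X\<close>, involutive and satisfies
  the Yang-Baxter equation; so the action is multiplicative (\<open>act_adj\<close>, \<open>act_comp\<close>). The isomorphisms
  \<open>K m \<oplus> K n \<rightarrow> K (m + n)\<close> are reassociations, compatible with everything else by the pentagon and the hexagon
  (\<open>powers_functor\<close>).

  The multiplicative structure \<open>K m \<otimes> K n \<rightarrow> K (m * n)\<close> is defined by recursion on \<open>m\<close> along \<open>\<delta>\<^sup>r\<close>,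
  which is an identity in \<open>\<Sigma>'\<close>. It is additive in \<open>m\<close> along \<open>\<delta>\<^sup>r\<close>, and additive in \<open>n\<close> along \<open>\<delta>\<^sup>l\<close> by the axiom
  relating the two distributivities (\<open>mlt_add_left\<close>, \<open>mlt_add_right\<close>). Compatibility with the braiding, with
  permutations and with associativity then follows by induction on one variable, each induction step
  being an axiom that holds both in \<open>\<C>\<close> and in \<open>\<Sigma>'\<close> (\<open>mlt_braid\<close>, \<open>mlt_nat\<close>, \<open>mlt_assoc\<close>).
  The axioms for \<open>\<Sigma>'\<close> are equations between explicit permutations, and \<open>\<Sigma>'\<close> is flat because it is a groupoid
  (\<open>Sigma_flat\<close>).
\<close>

section \<open>Calculating in categories\<close>

lemma hom_iff: "f \<in> hom \<C> A B \<longleftrightarrow> f \<in> Arr \<C> \<and> Dom \<C> f = A \<and> Cod \<C> f = B"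
  by (auto simp: hom_def)

context category
begin

lemma dom_Obj [simp]: "f \<in> Arr \<C> \<Longrightarrow> Dom \<C> f \<in> Obj \<C>"
  by (rule dom_in_Obj)

lemma cod_Obj [simp]: "f \<in> Arr \<C> \<Longrightarrow> Cod \<C> f \<in> Obj \<C>"
  by (rule cod_in_Obj)

lemma ident_simps [simp]:
  assumes "A \<in> Obj \<C>"
  shows "\<i> A \<in> Arr \<C>" "Dom \<C> (\<i> A) = A" "Cod \<C> (\<i> A) = A"
  using ident_in_hom[OF assms] by (auto simp: hom_iff)

lemma comp_simps [simp]:
  assumes "f \<in> Arr \<C>" "g \<in> Arr \<C>" "Dom \<C> g = Cod \<C> f"
  shows "g \<cdot> f \<in> Arr \<C>" "Dom \<C> (g \<cdot> f) = Dom \<C> f" "Cod \<C> (g \<cdot> f) = Cod \<C> g"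
  using comp_in_hom[of f "Dom \<C> f" "Cod \<C> f" g "Cod \<C> g"] assms by (auto simp: hom_iff)

lemma ident_comp [simp]:
  "f \<in> Arr \<C> \<Longrightarrow> Cod \<C> f = B \<Longrightarrow> \<i> B \<cdot> f = f"
  "f \<in> Arr \<C> \<Longrightarrow> Dom \<C> f = A \<Longrightarrow> f \<cdot> \<i> A = f"
  using ident_left[of f "Dom \<C> f" B] ident_right[of f A "Cod \<C> f"] by (auto simp: hom_iff)

lemma assoc_comp [simp]:
  assumes "f \<in> Arr \<C>" "g \<in> Arr \<C>" "h \<in> Arr \<C>" "Dom \<C> g = Cod \<C> f" "Dom \<C> h = Cod \<C> g"
  shows "(h \<cdot> g) \<cdot> f = h \<cdot> (g \<cdot> f)"
  using comp_assoc[of f "Dom \<C> f" "Cod \<C> f" g "Cod \<C> g" h "Cod \<C> h"] assms by (auto simp: hom_iff)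

text \<open>Composites are kept associated to the right. An equation \<open>g \<cdot> f = h\<close> rewrites the head of
  a longer composite only in the form given here.\<close>

lemma comp_reduce:
  assumes "g \<cdot> f = h" "f \<in> Arr \<C>" "g \<in> Arr \<C>" "Dom \<C> g = Cod \<C> f" "x \<in> Arr \<C>" "Dom \<C> f = Cod \<C> x"
  shows "g \<cdot> (f \<cdot> x) = h \<cdot> x"
  using assms assoc_comp[of x f g] by simp

lemma is_isoE:
  assumes "is_iso \<C> f"
  obtains g where "f \<in> Arr \<C>" "g \<in> Arr \<C>" "Dom \<C> g = Cod \<C> f" "Cod \<C> g = Dom \<C> f"
    "g \<cdot> f = \<i> (Dom \<C> f)" "f \<cdot> g = \<i> (Cod \<C> f)"
  using assms unfolding is_iso_def inverse_arrows_def hom_iff by auto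

lemma inverse_arrows_unique:
  assumes "inverse_arrows \<C> f g" "inverse_arrows \<C> f h"
  shows "g = h"
proof -
  have "g = g \<cdot> (f \<cdot> h)"
    using assms by (auto simp: inverse_arrows_def hom_iff)
  also have "\<dots> = (g \<cdot> f) \<cdot> h"
    using assms by (intro assoc_comp[symmetric]) (auto simp: inverse_arrows_def hom_iff)
  also have "\<dots> = h"
    using assms by (auto simp: inverse_arrows_def hom_iff)
  finally show ?thesis .
qed

lemma inv_arr_eq: "inverse_arrows \<C> f g \<Longrightarrow> inv_arr \<C> f = g"
  unfolding inv_arr_def using inverse_arrows_unique by blast

lemma inv_arr_simps:
  assumes "is_iso \<C> f"
  shows "f \<in> Arr \<C>" "inv_arr \<C> f \<in> Arr \<C>" "Dom \<C> (inv_arr \<C> f) = Cod \<C> f" "Cod \<C> (inv_arr \<C> f) = Dom \<C> f"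
    "inv_arr \<C> f \<cdot> f = \<i> (Dom \<C> f)" "f \<cdot> inv_arr \<C> f = \<i> (Cod \<C> f)"
proof -
  obtain g where "inverse_arrows \<C> f g"
    using assms by (auto simp: is_iso_def)
  moreover from this have "inv_arr \<C> f = g" by (rule inv_arr_eq)
  ultimately show "f \<in> Arr \<C>" "inv_arr \<C> f \<in> Arr \<C>" "Dom \<C> (inv_arr \<C> f) = Cod \<C> f"
      "Cod \<C> (inv_arr \<C> f) = Dom \<C> f"
      "inv_arr \<C> f \<cdot> f = \<i> (Dom \<C> f)" "f \<cdot> inv_arr \<C> f = \<i> (Cod \<C> f)"
    by (auto simp: inverse_arrows_def hom_iff)
qed

lemma inv_arr_cancel:
  assumes "is_iso \<C> f" "x \<in> Arr \<C>"
  shows "Cod \<C> x = Dom \<C> f \<Longrightarrow> inv_arr \<C> f \<cdot> (f \<cdot> x) = x"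
    "Cod \<C> x = Cod \<C> f \<Longrightarrow> f \<cdot> (inv_arr \<C> f \<cdot> x) = x"
  using inv_arr_simps[OF assms(1)] assms(2) by (auto simp: comp_reduce)

lemma is_isoI:
  assumes "f \<in> Arr \<C>" "g \<in> Arr \<C>" "Dom \<C> g = Cod \<C> f" "Cod \<C> g = Dom \<C> f"
    "g \<cdot> f = \<i> (Dom \<C> f)" "f \<cdot> g = \<i> (Cod \<C> f)"
  shows "is_iso \<C> f"
  using assms unfolding is_iso_def inverse_arrows_def hom_iff by auto

lemma is_iso_ident: "A \<in> Obj \<C> \<Longrightarrow> is_iso \<C> (\<i> A)"
  by (rule is_isoI[of _ "\<i> A"]) auto

lemma is_iso_comp:
  assumes "is_iso \<C> f" "is_iso \<C> g" "Dom \<C> g = Cod \<C> f"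
  shows "is_iso \<C> (g \<cdot> f)"
  by (rule is_isoI[of _ "inv_arr \<C> f \<cdot> inv_arr \<C> g"])
    (use assms in \<open>auto simp: inv_arr_simps inv_arr_cancel\<close>)

lemma is_iso_inv: "is_iso \<C> f \<Longrightarrow> is_iso \<C> (inv_arr \<C> f)"
  by (rule is_isoI[of _ f]) (auto simp: inv_arr_simps)

lemma iso_cancel_left:
  assumes "is_iso \<C> f" "x \<in> Arr \<C>" "y \<in> Arr \<C>" "Cod \<C> x = Dom \<C> f" "Cod \<C> y = Dom \<C> f"
    "f \<cdot> x = f \<cdot> y"
  shows "x = y"
  using inv_arr_cancel(1)[OF assms(1) assms(2,4)] inv_arr_cancel(1)[OF assms(1) assms(3,5)] assms(6)
  by metis

lemma iso_cancel_right:
  assumes "is_iso \<C> f" "x \<in> Arr \<C>" "y \<in> Arr \<C>" "Dom \<C> x = Cod \<C> f" "Dom \<C> y = Cod \<C> f"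
    "x \<cdot> f = y \<cdot> f"
  shows "x = y"
proof -
  have "z = (z \<cdot> f) \<cdot> inv_arr \<C> f" if "z \<in> Arr \<C>" "Dom \<C> z = Cod \<C> f" for z
    using assms(1) that by (simp add: inv_arr_simps)
  from this[of x] this[of y] show ?thesis
    using assms(2-6) by metis
qed

lemma iso_is_mono:
  assumes "is_iso \<C> f"
  shows "is_mono \<C> f"
  unfolding is_mono_def hom_iff by (auto simp: inv_arr_simps(1)[OF assms] hom_iff intro: iso_cancel_left[OF assms])

end


section \<open>Monoidal and braided monoidal categories\<close>

context monoidal_category
begin

abbreviation tobj (infixl "\<diamondop>" 70) where "A \<diamondop> B \<equiv> tensor_obj M A B"
abbreviation tarr (infixl "\<ast>" 70) where "f \<ast> g \<equiv> tensor_arr M f g"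
abbreviation unt ("\<u>") where "\<u> \<equiv> tensor_unit M"
abbreviation assoc_inv where "assoc_inv A B C \<equiv> inv_arr \<C> (assoc M A B C)"

lemma tensor_Obj [simp]: "A \<in> Obj \<C> \<Longrightarrow> B \<in> Obj \<C> \<Longrightarrow> A \<diamondop> B \<in> Obj \<C>"
  by (rule tensor_in_Obj)

lemma unit_Obj [simp]: "\<u> \<in> Obj \<C>"
  by (rule unit_in_Obj)

lemma tensor_simps [simp]:
  assumes "f \<in> Arr \<C>" "g \<in> Arr \<C>"
  shows "f \<ast> g \<in> Arr \<C>" "Dom \<C> (f \<ast> g) = Dom \<C> f \<diamondop> Dom \<C> g"
    "Cod \<C> (f \<ast> g) = Cod \<C> f \<diamondop> Cod \<C> g"
  using tensor_in_hom[of f "Dom \<C> f" "Cod \<C> f" g "Dom \<C> g" "Cod \<C> g"] assms by (auto simp: hom_iff)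

lemma tensor_ident_simp [simp]: "A \<in> Obj \<C> \<Longrightarrow> B \<in> Obj \<C> \<Longrightarrow> \<i> A \<ast> \<i> B = \<i> (A \<diamondop> B)"
  by (rule tensor_ident)

text \<open>Oriented towards a single tensor product, so that functoriality of the tensor product needs no
  explicit steps; splitting a tensor product into a composite is not unique.\<close>

lemma tensor_merge [simp]:
  assumes "f \<in> Arr \<C>" "f' \<in> Arr \<C>" "g \<in> Arr \<C>" "g' \<in> Arr \<C>" "Dom \<C> f' = Cod \<C> f" "Dom \<C> g' = Cod \<C> g"
  shows "(f' \<ast> g') \<cdot> (f \<ast> g) = (f' \<cdot> f) \<ast> (g' \<cdot> g)"
  using tensor_comp[of f "Dom \<C> f" "Cod \<C> f" f' "Cod \<C> f'" g "Dom \<C> g" "Cod \<C> g" g' "Cod \<C> g'"] assms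
  by (auto simp: hom_iff)

lemma tensor_merge_comp [simp]:
  assumes "f \<in> Arr \<C>" "f' \<in> Arr \<C>" "g \<in> Arr \<C>" "g' \<in> Arr \<C>" "Dom \<C> f' = Cod \<C> f" "Dom \<C> g' = Cod \<C> g"
    "x \<in> Arr \<C>" "Cod \<C> x = Dom \<C> f \<diamondop> Dom \<C> g"
  shows "(f' \<ast> g') \<cdot> ((f \<ast> g) \<cdot> x) = ((f' \<cdot> f) \<ast> (g' \<cdot> g)) \<cdot> x"
  using comp_reduce[OF tensor_merge[OF assms(1-6)], of x] assms by simp

lemma assoc_simps [simp]:
  assumes "A \<in> Obj \<C>" "B \<in> Obj \<C>" "D \<in> Obj \<C>"
  shows "assoc M A B D \<in> Arr \<C>" "Dom \<C> (assoc M A B D) = A \<diamondop> B \<diamondop> D"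
    "Cod \<C> (assoc M A B D) = A \<diamondop> (B \<diamondop> D)"
    "assoc_inv A B D \<in> Arr \<C>" "Cod \<C> (assoc_inv A B D) = A \<diamondop> B \<diamondop> D"
    "Dom \<C> (assoc_inv A B D) = A \<diamondop> (B \<diamondop> D)"
    "assoc M A B D \<cdot> assoc_inv A B D = \<i> (A \<diamondop> (B \<diamondop> D))"
    "assoc_inv A B D \<cdot> assoc M A B D = \<i> (A \<diamondop> B \<diamondop> D)"
  using assoc_in_hom[OF assms] inv_arr_simps[OF assoc_iso[OF assms]] by (auto simp: hom_iff)

lemma assoc_cancel [simp]:
  assumes "A \<in> Obj \<C>" "B \<in> Obj \<C>" "D \<in> Obj \<C>" "x \<in> Arr \<C>"
  shows "Cod \<C> x = A \<diamondop> (B \<diamondop> D) \<Longrightarrow> assoc M A B D \<cdot> (assoc_inv A B D \<cdot> x) = x"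
    "Cod \<C> x = A \<diamondop> B \<diamondop> D \<Longrightarrow> assoc_inv A B D \<cdot> (assoc M A B D \<cdot> x) = x"
  using inv_arr_cancel[OF assoc_iso[OF assms(1-3)] assms(4)] assms by auto

lemma unitor_simps [simp]:
  assumes "A \<in> Obj \<C>"
  shows "lunit M A \<in> Arr \<C>" "Dom \<C> (lunit M A) = \<u> \<diamondop> A" "Cod \<C> (lunit M A) = A"
    "runit M A \<in> Arr \<C>" "Dom \<C> (runit M A) = A \<diamondop> \<u>" "Cod \<C> (runit M A) = A"
  using lunit_in_hom[OF assms] runit_in_hom[OF assms] by (auto simp: hom_iff)

text \<open>Oriented naturality: structure isomorphisms move to the right, next to the source.\<close>

lemma assoc_nat:
  assumes "f \<in> Arr \<C>" "g \<in> Arr \<C>" "h \<in> Arr \<C>" "Cod \<C> f = A" "Cod \<C> g = B" "Cod \<C> h = D"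
  shows "assoc M A B D \<cdot> (f \<ast> g \<ast> h) = (f \<ast> (g \<ast> h)) \<cdot> assoc M (Dom \<C> f) (Dom \<C> g) (Dom \<C> h)"
  using assoc_natural[of f "Dom \<C> f" A g "Dom \<C> g" B h "Dom \<C> h" D] assms by (auto simp: hom_iff)

lemma assoc_inv_nat:
  assumes "f \<in> Arr \<C>" "g \<in> Arr \<C>" "h \<in> Arr \<C>" "Cod \<C> f = A" "Cod \<C> g = B" "Cod \<C> h = D"
  shows "assoc_inv A B D \<cdot> (f \<ast> (g \<ast> h)) = (f \<ast> g \<ast> h) \<cdot> assoc_inv (Dom \<C> f) (Dom \<C> g) (Dom \<C> h)"
proof -
  have "assoc M A B D \<cdot> (assoc_inv A B D \<cdot> (f \<ast> (g \<ast> h)))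
      = assoc M A B D \<cdot> ((f \<ast> g \<ast> h) \<cdot> assoc_inv (Dom \<C> f) (Dom \<C> g) (Dom \<C> h))"
    using assms by (auto simp: comp_reduce[OF assoc_nat])
  then show ?thesis
    using assms by - (rule iso_cancel_left[OF assoc_iso[of A B D]], auto)
qed

lemma lunit_nat:
  assumes "f \<in> Arr \<C>" "Cod \<C> f = A"
  shows "lunit M A \<cdot> (\<i> \<u> \<ast> f) = f \<cdot> lunit M (Dom \<C> f)"
  using lunit_natural[of f "Dom \<C> f" A] assms by (auto simp: hom_iff)

lemma runit_nat:
  assumes "f \<in> Arr \<C>" "Cod \<C> f = A"
  shows "runit M A \<cdot> (f \<ast> \<i> \<u>) = f \<cdot> runit M (Dom \<C> f)"
  using runit_natural[of f "Dom \<C> f" A] assms by (auto simp: hom_iff)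

lemmas nat_simps = assoc_nat assoc_nat[THEN comp_reduce] assoc_inv_nat assoc_inv_nat[THEN comp_reduce]
  lunit_nat lunit_nat[THEN comp_reduce] runit_nat runit_nat[THEN comp_reduce]

lemma is_iso_tensor:
  assumes "is_iso \<C> f" "is_iso \<C> g"
  shows "is_iso \<C> (f \<ast> g)"
  by (rule is_isoI[of _ "inv_arr \<C> f \<ast> inv_arr \<C> g"])
    (use assms in \<open>auto simp: inv_arr_simps\<close>)

end

context monoidal_category
begin

lemma lunit_cancel:
  assumes "f \<in> Arr \<C>" "g \<in> Arr \<C>" "Dom \<C> f = Dom \<C> g" "Cod \<C> f = Cod \<C> g"
    "\<i> \<u> \<ast> f = \<i> \<u> \<ast> g"
  shows "f = g"
proof (rule iso_cancel_right[OF lunit_iso[of "Dom \<C> g"]])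
  show "f \<cdot> lunit M (Dom \<C> g) = g \<cdot> lunit M (Dom \<C> g)"
    using lunit_nat[of f "Cod \<C> g"] lunit_nat[of g "Cod \<C> g"] assms by simp
qed (use assms in auto)

lemma runit_cancel:
  assumes "f \<in> Arr \<C>" "g \<in> Arr \<C>" "Dom \<C> f = Dom \<C> g" "Cod \<C> f = Cod \<C> g"
    "f \<ast> \<i> \<u> = g \<ast> \<i> \<u>"
  shows "f = g"
proof (rule iso_cancel_right[OF runit_iso[of "Dom \<C> g"]])
  show "f \<cdot> runit M (Dom \<C> g) = g \<cdot> runit M (Dom \<C> g)"
    using runit_nat[of f "Cod \<C> g"] runit_nat[of g "Cod \<C> g"] assms by simp
qed (use assms in auto)

text \<open>Kelly's redundant unit axioms, \<open>lunit_tensor\<close> and \<open>runit_tensor\<close>. Tensoring with the unit is faithful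
  (\<open>lunit_cancel\<close>, \<open>runit_cancel\<close>), and the tensored equations follow from the pentagon with two adjacent
  units and the triangle.\<close>

lemma lunit_tensor:
  assumes [simp]: "A \<in> Obj \<C>" "B \<in> Obj \<C>"
  shows "lunit M (A \<diamondop> B) \<cdot> assoc M \<u> A B = lunit M A \<ast> \<i> B" (is "?l = ?r")
proof (rule lunit_cancel)
  let ?t = "assoc M \<u> (\<u> \<diamondop> A) B \<cdot> (assoc M \<u> \<u> A \<ast> \<i> B)"
  have "(\<i> \<u> \<ast> ?l) \<cdot> ?t
      = (\<i> \<u> \<ast> lunit M (A \<diamondop> B)) \<cdot> ((\<i> \<u> \<ast> assoc M \<u> A B) \<cdot> ?t)"
    by simp
  also have "\<dots> = (\<i> \<u> \<ast> lunit M (A \<diamondop> B)) \<cdot> (assoc M \<u> \<u> (A \<diamondop> B) \<cdot> assoc M (\<u> \<diamondop> \<u>) A B)"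
    using pentagon[of \<u> \<u> A B] by simp
  also have "\<dots> = (runit M \<u> \<ast> \<i> (A \<diamondop> B)) \<cdot> assoc M (\<u> \<diamondop> \<u>) A B"
    by (simp add: comp_reduce[OF triangle])
  also have "\<dots> = assoc M \<u> A B \<cdot> (runit M \<u> \<ast> \<i> A \<ast> \<i> B)"
    by (simp add: nat_simps)
  also have "\<dots> = assoc M \<u> A B \<cdot> (((\<i> \<u> \<ast> lunit M A) \<cdot> assoc M \<u> \<u> A) \<ast> \<i> B)"
    by (simp add: triangle)
  also have "\<dots> = assoc M \<u> A B \<cdot> ((\<i> \<u> \<ast> lunit M A \<ast> \<i> B) \<cdot> (assoc M \<u> \<u> A \<ast> \<i> B))"
    by simp
  also have "\<dots> = (\<i> \<u> \<ast> (lunit M A \<ast> \<i> B)) \<cdot> ?t"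
    by (simp add: nat_simps del: tensor_merge)
  finally have *: "(\<i> \<u> \<ast> ?l) \<cdot> ?t = (\<i> \<u> \<ast> ?r) \<cdot> ?t" .
  have "is_iso \<C> ?t"
    by (intro is_iso_comp is_iso_tensor assoc_iso is_iso_ident) auto
  from iso_cancel_right[OF this _ _ _ _ *]
  show "\<i> \<u> \<ast> ?l = \<i> \<u> \<ast> ?r"
    by simp
qed auto

lemma runit_tensor:
  assumes [simp]: "A \<in> Obj \<C>" "B \<in> Obj \<C>"
  shows "(\<i> A \<ast> runit M B) \<cdot> assoc M A B \<u> = runit M (A \<diamondop> B)" (is "?l = ?r")
proof (rule runit_cancel)
  have "assoc M A B \<u> \<cdot> (runit M (A \<diamondop> B) \<ast> \<i> \<u>)
      = assoc M A B \<u> \<cdot> ((\<i> (A \<diamondop> B) \<ast> lunit M \<u>) \<cdot> assoc M (A \<diamondop> B) \<u> \<u>)"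
    by (simp add: triangle)
  also have "\<dots> = (\<i> A \<ast> (\<i> B \<ast> lunit M \<u>)) \<cdot> (assoc M A B (\<u> \<diamondop> \<u>) \<cdot> assoc M (A \<diamondop> B) \<u> \<u>)"
    by (simp add: nat_simps flip: tensor_ident_simp)
  also have "\<dots> = (\<i> A \<ast> ((\<i> B \<ast> lunit M \<u>) \<cdot> assoc M B \<u> \<u>)) \<cdot> (assoc M A (B \<diamondop> \<u>) \<u> \<cdot> (assoc M A B \<u> \<ast> \<i> \<u>))"
    by (simp add: pentagon)
  also have "\<dots> = (\<i> A \<ast> (runit M B \<ast> \<i> \<u>)) \<cdot> (assoc M A (B \<diamondop> \<u>) \<u> \<cdot> (assoc M A B \<u> \<ast> \<i> \<u>))"
    by (simp add: triangle)
  also have "\<dots> = assoc M A B \<u> \<cdot> (((\<i> A \<ast> runit M B) \<cdot> assoc M A B \<u>) \<ast> \<i> \<u>)"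
    by (simp add: comp_reduce[OF assoc_nat[symmetric, of "\<i> A" "runit M B" "\<i> \<u>", simplified]])
  finally have *: "assoc M A B \<u> \<cdot> (?r \<ast> \<i> \<u>) = assoc M A B \<u> \<cdot> (?l \<ast> \<i> \<u>)" .
  from iso_cancel_left[OF assoc_iso _ _ _ _ *]
  show "?l \<ast> \<i> \<u> = ?r \<ast> \<i> \<u>"
    by simp
qed auto

lemma lunit_unit: "lunit M \<u> = runit M \<u>"
proof (rule runit_cancel)
  have "lunit M \<u> \<cdot> lunit M (\<u> \<diamondop> \<u>) = lunit M \<u> \<cdot> (\<i> \<u> \<ast> lunit M \<u>)"
    by (simp add: nat_simps)
  then have "lunit M (\<u> \<diamondop> \<u>) = \<i> \<u> \<ast> lunit M \<u>"
    by - (rule iso_cancel_left[OF lunit_iso[of \<u>]], auto)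
  then show "lunit M \<u> \<ast> \<i> \<u> = runit M \<u> \<ast> \<i> \<u>"
    using lunit_tensor[of \<u> \<u>] triangle[of \<u> \<u>] by simp
qed auto

lemma runit_tensor_unit:
  assumes [simp]: "A \<in> Obj \<C>"
  shows "runit M (A \<diamondop> \<u>) = runit M A \<ast> \<i> \<u>"
proof (rule iso_cancel_left[OF runit_iso[of A]])
  show "runit M A \<cdot> runit M (A \<diamondop> \<u>) = runit M A \<cdot> (runit M A \<ast> \<i> \<u>)"
    by (simp add: nat_simps)
qed auto

end

context braided_monoidal_category
begin

lemma braid_simps [simp]:
  assumes "A \<in> Obj \<C>" "B \<in> Obj \<C>"
  shows "\<zeta> A B \<in> Arr \<C>" "Dom \<C> (\<zeta> A B) = A \<diamondop> B" "Cod \<C> (\<zeta> A B) = B \<diamondop> A"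
  using braid_in_hom[OF assms] by (auto simp: hom_iff)

lemma braid_nat:
  assumes "f \<in> Arr \<C>" "g \<in> Arr \<C>" "Cod \<C> f = A" "Cod \<C> g = B"
  shows "\<zeta> A B \<cdot> (f \<ast> g) = (g \<ast> f) \<cdot> \<zeta> (Dom \<C> f) (Dom \<C> g)"
  using braid_natural[of f "Dom \<C> f" A g "Dom \<C> g" B] assms by (auto simp: hom_iff)

text \<open>The hexagon for \<open>A\<close> and two units, composed with \<open>\<i> \<u> \<ast> lunit M A\<close>, contains the claim tensored with the unit.\<close>

lemma braid_runit:
  assumes [simp]: "A \<in> Obj \<C>"
  shows "lunit M A \<cdot> \<zeta> A \<u> = runit M A"
proof (rule lunit_cancel)
  let ?t = "assoc M \<u> A \<u> \<cdot> (\<zeta> A \<u> \<ast> \<i> \<u>)"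
  have "(\<i> \<u> \<ast> (lunit M A \<cdot> \<zeta> A \<u>)) \<cdot> ?t = (\<i> \<u> \<ast> lunit M A) \<cdot> ((\<i> \<u> \<ast> \<zeta> A \<u>) \<cdot> ?t)"
    by simp
  also have "\<dots> = (\<i> \<u> \<ast> lunit M A) \<cdot> (assoc M \<u> \<u> A \<cdot> (\<zeta> A (\<u> \<diamondop> \<u>) \<cdot> assoc M A \<u> \<u>))"
    using hexagon[of A \<u> \<u>] by simp
  also have "\<dots> = (lunit M \<u> \<ast> \<i> A) \<cdot> (\<zeta> A (\<u> \<diamondop> \<u>) \<cdot> assoc M A \<u> \<u>)"
    by (simp add: comp_reduce[OF triangle] lunit_unit)
  also have "\<dots> = \<zeta> A \<u> \<cdot> ((\<i> A \<ast> lunit M \<u>) \<cdot> assoc M A \<u> \<u>)"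
    by (simp add: comp_reduce[OF braid_nat])
  also have "\<dots> = \<zeta> A \<u> \<cdot> runit M (A \<diamondop> \<u>)"
    by (simp add: triangle runit_tensor_unit)
  also have "\<dots> = runit M (\<u> \<diamondop> A) \<cdot> (\<zeta> A \<u> \<ast> \<i> \<u>)"
    by (simp add: nat_simps)
  also have "\<dots> = (\<i> \<u> \<ast> runit M A) \<cdot> ?t"
    by (simp add: comp_reduce[OF runit_tensor])
  finally have *: "(\<i> \<u> \<ast> (lunit M A \<cdot> \<zeta> A \<u>)) \<cdot> ?t = (\<i> \<u> \<ast> runit M A) \<cdot> ?t" .
  have "is_iso \<C> ?t"
    by (intro is_iso_comp is_iso_tensor assoc_iso braid_iso is_iso_ident) auto
  from iso_cancel_right[OF this _ _ _ _ *]
  show "\<i> \<u> \<ast> (lunit M A \<cdot> \<zeta> A \<u>) = \<i> \<u> \<ast> runit M A"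
    by simp
qed auto

end

context symmetric_monoidal_category
begin

lemma symmetry_simps [simp]:
  assumes "A \<in> Obj \<C>" "B \<in> Obj \<C>"
  shows "\<zeta> B A \<cdot> \<zeta> A B = \<i> (A \<diamondop> B)"
    "x \<in> Arr \<C> \<Longrightarrow> Cod \<C> x = A \<diamondop> B \<Longrightarrow> \<zeta> B A \<cdot> (\<zeta> A B \<cdot> x) = x"
  using symmetry[OF assms] assms by (simp_all add: comp_reduce[OF symmetry])

end

section \<open>The twists of a tower of copies of one object\<close>

context symmetric_monoidal_category
begin

text \<open>The exchange of the last two factors \<open>U\<close> of \<open>(X \<diamondop> U) \<diamondop> U\<close>. Because the left factor \<open>X\<close> is
  arbitrary and the exchange is natural in it, this one family of arrows gives all adjacent
  transpositions of a left-nested power of \<open>U\<close>.\<close>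

definition twist :: "'a \<Rightarrow> 'a \<Rightarrow> 'b" where
  "twist U X = assoc_inv X U U \<cdot> ((\<i> X \<ast> \<zeta> U U) \<cdot> assoc M X U U)"

lemma twist_simps [simp]:
  assumes [simp]: "U \<in> Obj \<C>" "X \<in> Obj \<C>"
  shows "twist U X \<in> Arr \<C>" "Dom \<C> (twist U X) = X \<diamondop> U \<diamondop> U" "Cod \<C> (twist U X) = X \<diamondop> U \<diamondop> U"
    "twist U X \<cdot> twist U X = \<i> (X \<diamondop> U \<diamondop> U)"
  by (auto simp: twist_def)

lemma twist_nat:
  assumes [simp]: "U \<in> Obj \<C>" "f \<in> Arr \<C>" 
  shows "twist U (Cod \<C> f) \<cdot> (f \<ast> \<i> U \<ast> \<i> U) = (f \<ast> \<i> U \<ast> \<i> U) \<cdot> twist U (Dom \<C> f)"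
  using tensor_merge[of "\<i> (Dom \<C> f)" f "\<zeta> U U" "\<i> (U \<diamondop> U)"]
  by (simp add: twist_def nat_simps comp_reduce[OF assoc_inv_nat[of f "\<i> U" "\<i> U", symmetric, simplified]])

text \<open>Both sides are conjugate, along the reassociation \<open>c\<close>, to the Yang-Baxter equation for the
  braiding itself, which is naturality of \<open>\<zeta> U (U \<diamondop> U)\<close> combined with the hexagon.\<close>

lemma twist_Yang_Baxter:
  assumes [simp]: "U \<in> Obj \<C>" "X \<in> Obj \<C>"
  shows "twist U (X \<diamondop> U) \<cdot> ((twist U X \<ast> \<i> U) \<cdot> twist U (X \<diamondop> U))
    = (twist U X \<ast> \<i> U) \<cdot> (twist U (X \<diamondop> U) \<cdot> (twist U X \<ast> \<i> U))" (is "?l = ?r")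
proof -
  define c where "c = assoc M X (U \<diamondop> U) U \<cdot> (assoc M X U U \<ast> \<i> U)"
  define x where "x = \<zeta> U U \<ast> \<i> U"
  define y where "y = assoc_inv U U U \<cdot> ((\<i> U \<ast> \<zeta> U U) \<cdot> assoc M U U U)"
  have c_iso: "is_iso \<C> c"
    unfolding c_def by (intro is_iso_comp is_iso_tensor assoc_iso is_iso_ident) auto
  have c_arr [simp]: "c \<in> Arr \<C>" "Dom \<C> c = X \<diamondop> U \<diamondop> U \<diamondop> U" "Cod \<C> c = X \<diamondop> (U \<diamondop> U \<diamondop> U)"
    by (simp_all add: c_def)
  have x_arr [simp]: "x \<in> Arr \<C>" "Dom \<C> x = U \<diamondop> U \<diamondop> U" "Cod \<C> x = U \<diamondop> U \<diamondop> U"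
    by (simp_all add: x_def)
  have y_arr [simp]: "y \<in> Arr \<C>" "Dom \<C> y = U \<diamondop> U \<diamondop> U" "Cod \<C> y = U \<diamondop> U \<diamondop> U"
    by (simp_all add: y_def)
  have yx: "y \<cdot> x = \<zeta> U (U \<diamondop> U) \<cdot> assoc M U U U"
  proof -
    have "y \<cdot> x = assoc_inv U U U \<cdot> ((\<i> U \<ast> \<zeta> U U) \<cdot> (assoc M U U U \<cdot> (\<zeta> U U \<ast> \<i> U)))"
      by (simp add: y_def x_def)
    also have "\<dots> = assoc_inv U U U \<cdot> (assoc M U U U \<cdot> (\<zeta> U (U \<diamondop> U) \<cdot> assoc M U U U))"
      using hexagon[of U U U] by simp
    finally show ?thesis by simp
  qed
  have "y \<cdot> (x \<cdot> y) = \<zeta> U (U \<diamondop> U) \<cdot> ((\<i> U \<ast> \<zeta> U U) \<cdot> assoc M U U U)"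
    by (simp add: comp_reduce[OF yx]) (simp add: y_def)
  also have "\<dots> = x \<cdot> (\<zeta> U (U \<diamondop> U) \<cdot> assoc M U U U)"
    by (simp add: comp_reduce[OF braid_nat] x_def)
  also have "\<dots> = x \<cdot> (y \<cdot> x)"
    by (simp add: yx)
  finally have xyx: "y \<cdot> (x \<cdot> y) = x \<cdot> (y \<cdot> x)" .
  have low: "c \<cdot> (twist U X \<ast> \<i> U) = (\<i> X \<ast> x) \<cdot> c"
  proof -
    have "c \<cdot> (twist U X \<ast> \<i> U) = assoc M X (U \<diamondop> U) U \<cdot> ((\<i> X \<ast> \<zeta> U U \<ast> \<i> U) \<cdot> (assoc M X U U \<ast> \<i> U))"
      by (simp add: c_def twist_def)
    also have "\<dots> = (\<i> X \<ast> x) \<cdot> c"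
      by (simp add: nat_simps c_def x_def del: tensor_merge)
    finally show ?thesis .
  qed
  have pent: "assoc M X U (U \<diamondop> U) \<cdot> assoc M (X \<diamondop> U) U U = (\<i> X \<ast> assoc M U U U) \<cdot> c"
    unfolding c_def using pentagon[of X U U U] by simp
  have high: "c \<cdot> twist U (X \<diamondop> U) = (\<i> X \<ast> y) \<cdot> c"
  proof (rule iso_cancel_left)
    show "is_iso \<C> (\<i> X \<ast> assoc M U U U)"
      by (intro is_iso_tensor is_iso_ident assoc_iso) auto
    have "(\<i> X \<ast> assoc M U U U) \<cdot> (c \<cdot> twist U (X \<diamondop> U))
        = assoc M X U (U \<diamondop> U) \<cdot> ((\<i> X \<ast> \<i> U \<ast> \<zeta> U U) \<cdot> assoc M (X \<diamondop> U) U U)"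
      by (simp add: comp_reduce[OF pent[symmetric]] twist_def del: tensor_merge_comp)
    also have "\<dots> = (\<i> X \<ast> (\<i> U \<ast> \<zeta> U U)) \<cdot> ((\<i> X \<ast> assoc M U U U) \<cdot> c)"
      by (simp add: nat_simps pent[symmetric] del: tensor_ident_simp)
    also have "\<dots> = (\<i> X \<ast> assoc M U U U) \<cdot> ((\<i> X \<ast> y) \<cdot> c)"
      by (simp add: y_def)
    finally show "(\<i> X \<ast> assoc M U U U) \<cdot> (c \<cdot> twist U (X \<diamondop> U)) = (\<i> X \<ast> assoc M U U U) \<cdot> ((\<i> X \<ast> y) \<cdot> c)" .
  qed auto
  show ?thesis
  proof (rule iso_cancel_left[OF c_iso])
    show "c \<cdot> ?l = c \<cdot> ?r"
      by (simp add: comp_reduce[OF low] comp_reduce[OF high] low high xyx)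
  qed auto
qed

end

section \<open>Permutations as words in adjacent transpositions\<close>

abbreviation adj :: "nat \<Rightarrow> nat \<Rightarrow> nat" where
  "adj i \<equiv> transpose i (Suc i)"

text \<open>The cycle that moves the last point \<open>n + 1\<close> to position \<open>k\<close> and keeps the order of the others.
  Every permutation of \<open>{1..n + 1}\<close> is such a cycle after a permutation of \<open>{1..n}\<close>.\<close>

definition insertion :: "nat \<Rightarrow> nat \<Rightarrow> nat \<Rightarrow> nat" where
  "insertion n k x = (if x = Suc n then k else if k \<le> x \<and> x \<le> n then Suc x else x)"

lemma insertion_last: "insertion n (Suc n) = id"
  by (auto simp: insertion_def)

lemma insertion_step: "k \<le> n \<Longrightarrow> insertion n k = adj k \<circ> insertion n (Suc k)"
  by (auto simp: insertion_def transpose_def fun_eq_iff)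

lemma adj_insertion_above: "k < i \<Longrightarrow> i \<le> n \<Longrightarrow> adj i \<circ> insertion n k = insertion n k \<circ> adj (i - 1)"
  by (auto simp: insertion_def transpose_def fun_eq_iff)

lemma adj_insertion_below: "Suc i < k \<Longrightarrow> k \<le> Suc n \<Longrightarrow> adj i \<circ> insertion n k = insertion n k \<circ> adj i"
  by (auto simp: insertion_def transpose_def fun_eq_iff)

lemma adj_permutes: "1 \<le> i \<Longrightarrow> i < n \<Longrightarrow> adj i permutes {1..n}"
  by (rule permutes_swap_id) auto

lemma permutes_Suc: "\<sigma> permutes {1..n} \<Longrightarrow> \<sigma> permutes {1..Suc n}"
  by (rule permutes_subset) auto

lemma insertion_permutes: "1 \<le> k \<Longrightarrow> k \<le> Suc n \<Longrightarrow> insertion n k permutes {1..Suc n}"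
proof (induction "Suc n - k" arbitrary: k)
  case 0
  then have "k = Suc n" by simp
  then show "insertion n k permutes {1..Suc n}"
    by (simp add: insertion_last)
next
  case (Suc d)
  then have "insertion n (Suc k) permutes {1..Suc n}" "adj k permutes {1..Suc n}"
    by (simp_all add: permutes_swap_id)
  then have "adj k \<circ> insertion n (Suc k) permutes {1..Suc n}"
    by (rule permutes_compose)
  with Suc.hyps(2) show "insertion n k permutes {1..Suc n}"
    by (simp add: insertion_step)
qed

lemma permutes_insertion_cases:
  assumes "\<sigma> permutes {1..Suc n}"
  obtains k \<tau> where "1 \<le> k" "k \<le> Suc n" "\<tau> permutes {1..n}" "\<sigma> = insertion n k \<circ> \<tau>"
proof -
  let ?k = "\<sigma> (Suc n)"
  let ?c = "insertion n ?k"
  have k: "?k \<in> {1..Suc n}"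
    using permutes_in_image[OF assms, of "Suc n"] by simp
  then have c: "?c permutes {1..Suc n}"
    by (intro insertion_permutes) auto
  let ?t = "inv ?c \<circ> \<sigma>"
  have "?t permutes {1..Suc n}"
    using assms c by (intro permutes_compose permutes_inv)
  moreover have "inv ?c (\<sigma> (Suc n)) = Suc n"
    using c by (simp add: permutes_inv_eq) (simp add: insertion_def)
  ultimately have "?t permutes {1..n}"
    by - (erule permutes_superset, metis Diff_iff atLeastAtMost_iff comp_apply le_Suc_eq)
  moreover have "\<sigma> = ?c \<circ> ?t"
    using permutes_inv_o(1)[OF c] by (simp add: o_assoc)
  ultimately show ?thesis
    using k that by auto
qed

lemma permutes_adj_induct [consumes 1, case_names id adj]:
  assumes "\<sigma> permutes {1..n}" "P id"
    and step: "\<And>i \<tau>. 1 \<le> i \<Longrightarrow> i < n \<Longrightarrow> \<tau> permutes {1..n} \<Longrightarrow> P \<tau> \<Longrightarrow> P (adj i \<circ> \<tau>)"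
  shows "P \<sigma>"
  using assms
proof (induction n arbitrary: \<sigma>)
  case 0
  then show ?case by simp
next
  case (Suc n)
  from Suc.prems(1) obtain k \<tau> where k: "1 \<le> k" "k \<le> Suc n" and \<tau>: "\<tau> permutes {1..n}"
    and \<sigma>: "\<sigma> = insertion n k \<circ> \<tau>"
    by (rule permutes_insertion_cases)
  note step' = Suc.prems(3)
  have P\<tau>: "P \<tau>"
  proof (rule Suc.IH[OF \<tau> Suc.prems(2)])
    fix i \<rho>
    assume "1 \<le> i" "i < n" "\<rho> permutes {1..n}" "P \<rho>"
    then show "P (adj i \<circ> \<rho>)"
      by (intro Suc.prems(3) permutes_Suc) auto
  qed
  have "P (insertion n k \<circ> \<tau>)"
    using k
  proof (induction "Suc n - k" arbitrary: k)
    case 0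
    then have "k = Suc n" by simp
    then show ?case using P\<tau> by (simp add: insertion_last)
  next
    case (Suc d)
    have "insertion n (Suc k) \<circ> \<tau> permutes {1..Suc n}"
      using \<tau> Suc.prems Suc.hyps(2) by (intro permutes_compose insertion_permutes permutes_Suc) auto
    moreover have "P (insertion n (Suc k) \<circ> \<tau>)"
      using Suc.hyps Suc.prems by (intro Suc.hyps(1)) auto
    ultimately have "P (adj k \<circ> (insertion n (Suc k) \<circ> \<tau>))"
      using step'[of k "insertion n (Suc k) \<circ> \<tau>"] Suc.hyps(2) Suc.prems(1) by (simp add: comp_def)
    moreover have "insertion n k = adj k \<circ> insertion n (Suc k)"
      using Suc.hyps(2) by (intro insertion_step) simp
    ultimately show "P (insertion n k \<circ> \<tau>)"
      by (simp only: o_assoc)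
  qed
  then show "P \<sigma>" unfolding \<sigma> .
qed


section \<open>The action of permutations on the powers of an object\<close>

locale object_powers = symmetric_monoidal_category +
  fixes U :: 'a
  assumes U_Obj [simp]: "U \<in> Obj \<C>"
begin

primrec pw :: "nat \<Rightarrow> 'a" where
  "pw 0 = \<u>"
| "pw (Suc n) = pw n \<diamondop> U"

lemma pw_Obj [simp]: "pw n \<in> Obj \<C>"
  by (induction n) auto

abbreviation tw :: "nat \<Rightarrow> 'b" where
  "tw n \<equiv> twist U (pw n)"

text \<open>The images of the adjacent transpositions \<open>adj i\<close> of \<open>{1..n}\<close>; for \<open>i\<close> outside the range
  the value is an identity, so that typing needs no side condition.\<close>

fun gen :: "nat \<Rightarrow> nat \<Rightarrow> 'b" where
  "gen (Suc (Suc n)) i = (if i = Suc n then tw n else gen (Suc n) i \<ast> \<i> U)"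
| "gen n i = \<i> (pw n)"

lemma gen_simps [simp]: "gen n i \<in> Arr \<C>" "Dom \<C> (gen n i) = pw n" "Cod \<C> (gen n i) = pw n"
  by (induction n i rule: gen.induct) auto

lemma gen_below: "i < n \<Longrightarrow> gen (Suc n) i = gen n i \<ast> \<i> U"
  by (cases n) auto

lemma gen_involutive:
  "gen n i \<cdot> gen n i = \<i> (pw n)"
  "x \<in> Arr \<C> \<Longrightarrow> Cod \<C> x = pw n \<Longrightarrow> gen n i \<cdot> (gen n i \<cdot> x) = x"
proof -
  show *: "gen n i \<cdot> gen n i = \<i> (pw n)"
    by (induction n i rule: gen.induct) auto
  show "x \<in> Arr \<C> \<Longrightarrow> Cod \<C> x = pw n \<Longrightarrow> gen n i \<cdot> (gen n i \<cdot> x) = x"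
    by (simp add: comp_reduce[OF *])
qed

text \<open>The image of \<open>insertion n k\<close>, the product of the generators \<open>k, k + 1, \<dots>, n\<close> (\<open>ins_step\<close>).\<close>

primrec ins :: "nat \<Rightarrow> nat \<Rightarrow> 'b" where
  "ins 0 k = \<i> (pw 1)"
| "ins (Suc n) k = (if k = Suc (Suc n) then \<i> (pw (Suc (Suc n))) else (ins n k \<ast> \<i> U) \<cdot> tw n)"

lemma ins_simps [simp]: "ins n k \<in> Arr \<C>" "Dom \<C> (ins n k) = pw (Suc n)" "Cod \<C> (ins n k) = pw (Suc n)"
  by (induction n) auto

lemma ins_last: "ins n (Suc n) = \<i> (pw (Suc n))"
  by (cases n) auto

lemma tw_nat:
  assumes "f \<in> Arr \<C>" "Dom \<C> f = pw n" "Cod \<C> f = pw n"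
  shows "tw n \<cdot> (f \<ast> \<i> U \<ast> \<i> U) = (f \<ast> \<i> U \<ast> \<i> U) \<cdot> tw n"
  using twist_nat[of U f] assms by simp

lemma ins_step: "1 \<le> k \<Longrightarrow> k \<le> n \<Longrightarrow> ins n k = gen (Suc n) k \<cdot> ins n (Suc k)"
proof (induction n)
  case (Suc n)
  show ?case
  proof (cases "k = Suc n")
    case True
    then show ?thesis by (simp add: ins_last)
  next
    case False
    with Suc have "ins n k = gen (Suc n) k \<cdot> ins n (Suc k)" by simp
    with False Suc.prems show ?thesis
      using tensor_merge_comp[of "ins n (Suc k)" "gen (Suc n) k" "\<i> U" "\<i> U" "tw n"] by simp
  qed
qed simp

lemma gen_ins_below:
  "1 \<le> i \<Longrightarrow> Suc i < k \<Longrightarrow> k \<le> Suc n \<Longrightarrow> gen (Suc n) i \<cdot> ins n k = ins n k \<cdot> (gen n i \<ast> \<i> U)"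
proof (induction n)
  case (Suc n)
  show ?case
  proof (cases "k = Suc (Suc n)")
    case True
    then show ?thesis using Suc.prems by (simp add: gen_below)
  next
    case False
    with Suc have IH: "gen (Suc n) i \<cdot> ins n k = ins n k \<cdot> (gen n i \<ast> \<i> U)" by simp
    have "gen (Suc (Suc n)) i \<cdot> ins (Suc n) k = ((gen (Suc n) i \<cdot> ins n k) \<ast> \<i> U) \<cdot> tw n"
      using False Suc.prems by simp
    also have "\<dots> = (ins n k \<ast> \<i> U) \<cdot> ((gen n i \<ast> \<i> U \<ast> \<i> U) \<cdot> tw n)"
      by (simp add: IH)
    also have "\<dots> = (ins n k \<ast> \<i> U) \<cdot> (tw n \<cdot> (gen n i \<ast> \<i> U \<ast> \<i> U))"
      by (simp only: tw_nat gen_simps)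
    also have "\<dots> = ins (Suc n) k \<cdot> (gen (Suc n) i \<ast> \<i> U)"
      using False Suc.prems by (simp add: gen_below)
    finally show ?thesis .
  qed
qed simp

text \<open>Among the factors \<open>k, \<dots>, n\<close> of the insertion, the generator \<open>i\<close> meets the factors \<open>i - 1\<close> and \<open>i\<close>, where
  the Yang-Baxter equation applies; induction on \<open>n\<close> strips the factors to the right of these.\<close>

lemma gen_ins_above:
  "1 \<le> k \<Longrightarrow> k < i \<Longrightarrow> i \<le> n \<Longrightarrow> gen (Suc n) i \<cdot> ins n k = ins n k \<cdot> (gen n (i - 1) \<ast> \<i> U)"
proof (induction n)
  case (Suc n)
  show ?case
  proof (cases "i = Suc n")
    case True
    then obtain m where n: "n = Suc m"
      using Suc.prems by (cases n) auto
    have "gen (Suc (Suc n)) i \<cdot> ins (Suc n) k = tw n \<cdot> ((ins m k \<ast> \<i> U \<ast> \<i> U) \<cdot> ((tw m \<ast> \<i> U) \<cdot> tw n))"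
      using True Suc.prems n by simp
    also have "\<dots> = (ins m k \<ast> \<i> U \<ast> \<i> U) \<cdot> (tw n \<cdot> ((tw m \<ast> \<i> U) \<cdot> tw n))"
      using n twist_nat[of U "ins m k"]
      by (simp add: comp_reduce[where f = "ins m k \<ast> \<i> U \<ast> \<i> U" and g = "twist U (pw m \<diamondop> U)"]
        del: tensor_merge_comp)
    also have "\<dots> = (ins m k \<ast> \<i> U \<ast> \<i> U) \<cdot> ((tw m \<ast> \<i> U) \<cdot> (tw n \<cdot> (tw m \<ast> \<i> U)))"
      using twist_Yang_Baxter[of U "pw m"] n by simp
    also have "\<dots> = ins (Suc n) k \<cdot> (gen (Suc n) (i - 1) \<ast> \<i> U)"
      using True Suc.prems n by simp
    finally show ?thesis .
  next
    case False
    with Suc have IH: "gen (Suc n) i \<cdot> ins n k = ins n k \<cdot> (gen n (i - 1) \<ast> \<i> U)" by simp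
    have "gen (Suc (Suc n)) i \<cdot> ins (Suc n) k = ((gen (Suc n) i \<cdot> ins n k) \<ast> \<i> U) \<cdot> tw n"
      using False Suc.prems by simp
    also have "\<dots> = (ins n k \<ast> \<i> U) \<cdot> ((gen n (i - 1) \<ast> \<i> U \<ast> \<i> U) \<cdot> tw n)"
      by (simp add: IH)
    also have "\<dots> = (ins n k \<ast> \<i> U) \<cdot> (tw n \<cdot> (gen n (i - 1) \<ast> \<i> U \<ast> \<i> U))"
      by (simp only: tw_nat gen_simps)
    also have "\<dots> = ins (Suc n) k \<cdot> (gen (Suc n) (i - 1) \<ast> \<i> U)"
      using False Suc.prems by (simp add: gen_below)
    finally show ?thesis .
  qed
qed simp

text \<open>Recursion on the normal form of \<open>permutes_insertion_cases\<close>, where \<open>k\<close> is the value at the last point.\<close>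

primrec act :: "nat \<Rightarrow> (nat \<Rightarrow> nat) \<Rightarrow> 'b" where
  "act 0 \<sigma> = \<i> \<u>"
| "act (Suc n) \<sigma> = ins n (\<sigma> (Suc n)) \<cdot> (act n (inv (insertion n (\<sigma> (Suc n))) \<circ> \<sigma>) \<ast> \<i> U)"

lemma act_simps [simp]: "act n \<sigma> \<in> Arr \<C>" "Dom \<C> (act n \<sigma>) = pw n" "Cod \<C> (act n \<sigma>) = pw n"
  by (induction n arbitrary: \<sigma>) auto

lemma act_insertion:
  assumes "1 \<le> k" "k \<le> Suc n" "\<tau> permutes {1..n}"
  shows "act (Suc n) (insertion n k \<circ> \<tau>) = ins n k \<cdot> (act n \<tau> \<ast> \<i> U)"
proof -
  have "\<tau> (Suc n) = Suc n"
    using assms(3) by (rule permutes_not_in) simp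
  moreover have "inv (insertion n k) \<circ> (insertion n k \<circ> \<tau>) = \<tau>"
    using permutes_inv_o(2)[OF insertion_permutes[OF assms(1,2)]] by (simp add: o_assoc)
  ultimately show ?thesis
    by (simp add: insertion_def)
qed

lemma act_Suc: "\<sigma> permutes {1..n} \<Longrightarrow> act (Suc n) \<sigma> = act n \<sigma> \<ast> \<i> U"
  using act_insertion[of "Suc n" n \<sigma>] by (simp add: insertion_last ins_last del: act.simps)

lemma act_id [simp]: "act n id = \<i> (pw n)"
proof (induction n)
  case (Suc n)
  have "act (Suc n) id = act n id \<ast> \<i> U"
    by (rule act_Suc) simp
  also have "\<dots> = \<i> (pw (Suc n))"
    by (simp add: Suc.IH[folded id_def])
  finally show "act (Suc n) id = \<i> (pw (Suc n))" .
qed simp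

text \<open>Multiplying the normal form \<open>insertion n k \<circ> \<tau>\<close> by \<open>adj i\<close> either shifts \<open>k\<close> by one or commutes
  past the insertion and meets \<open>\<tau>\<close>. The arrows \<open>gen\<close> and \<open>ins\<close> satisfy the same relations.\<close>

lemma act_adj:
  "\<sigma> permutes {1..n} \<Longrightarrow> 1 \<le> i \<Longrightarrow> i < n \<Longrightarrow> act n (adj i \<circ> \<sigma>) = gen n i \<cdot> act n \<sigma>"
proof (induction n arbitrary: i \<sigma>)
  case (Suc n)
  from Suc.prems(1) obtain k \<tau> where k: "1 \<le> k" "k \<le> Suc n" and \<tau>: "\<tau> permutes {1..n}"
    and \<sigma>: "\<sigma> = insertion n k \<circ> \<tau>"
    by (rule permutes_insertion_cases)
  note a = act_insertion[OF _ _ \<tau>]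
  have IH: "act n (adj j \<circ> \<tau>) = gen n j \<cdot> act n \<tau>" if "1 \<le> j" "j < n" for j
    using Suc.IH[OF \<tau> that] by (simp add: comp_def)
  consider "k = i" | "k = Suc i" | "k < i" | "Suc i < k" by linarith
  then show "act (Suc n) (adj i \<circ> \<sigma>) = gen (Suc n) i \<cdot> act (Suc n) \<sigma>"
  proof cases
    case 1
    then have "adj i \<circ> \<sigma> = insertion n (Suc i) \<circ> \<tau>"
      using Suc.prems \<sigma> insertion_step[of i n] by (simp add: o_assoc)
    then show ?thesis
      using 1 k Suc.prems a[of i] a[of "Suc i"] by (simp add: \<sigma> ins_step gen_involutive del: act.simps)
  next
    case 2
    then have "adj i \<circ> \<sigma> = insertion n i \<circ> \<tau>"
      using Suc.prems \<sigma> insertion_step[of i n] by (simp add: o_assoc)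
    then show ?thesis
      using 2 k Suc.prems a[of i] a[of "Suc i"] by (simp add: \<sigma> ins_step[of i] del: act.simps)
  next
    case 3
    with Suc.prems k have i: "1 \<le> i - 1" "i - 1 < n" by auto
    have "adj i \<circ> \<sigma> = insertion n k \<circ> (adj (i - 1) \<circ> \<tau>)"
      using 3 Suc.prems \<sigma> adj_insertion_above[of k i n] by (simp add: o_assoc)
    then have "act (Suc n) (adj i \<circ> \<sigma>) = ins n k \<cdot> ((gen n (i - 1) \<cdot> act n \<tau>) \<ast> \<i> U)"
      using act_insertion[OF k permutes_compose[OF \<tau> adj_permutes[OF i]]] IH[OF i] by (simp del: act.simps)
    also have "\<dots> = (ins n k \<cdot> (gen n (i - 1) \<ast> \<i> U)) \<cdot> (act n \<tau> \<ast> \<i> U)"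
      by simp
    also have "\<dots> = gen (Suc n) i \<cdot> (ins n k \<cdot> (act n \<tau> \<ast> \<i> U))"
      using gen_ins_above[OF k(1) 3] Suc.prems by (intro comp_reduce[symmetric]) auto
    also have "\<dots> = gen (Suc n) i \<cdot> act (Suc n) \<sigma>"
      by (simp only: \<sigma> a[OF k])
    finally show ?thesis .
  next
    case 4
    with Suc.prems k have i: "1 \<le> i" "i < n" by auto
    have "adj i \<circ> \<sigma> = insertion n k \<circ> (adj i \<circ> \<tau>)"
      using 4 k \<sigma> adj_insertion_below[of i k n] by (simp add: o_assoc)
    then have "act (Suc n) (adj i \<circ> \<sigma>) = ins n k \<cdot> ((gen n i \<cdot> act n \<tau>) \<ast> \<i> U)"
      using act_insertion[OF k permutes_compose[OF \<tau> adj_permutes[OF i]]] IH[OF i] by (simp del: act.simps)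
    also have "\<dots> = (ins n k \<cdot> (gen n i \<ast> \<i> U)) \<cdot> (act n \<tau> \<ast> \<i> U)"
      by simp
    also have "\<dots> = gen (Suc n) i \<cdot> (ins n k \<cdot> (act n \<tau> \<ast> \<i> U))"
      using gen_ins_below[OF i(1) 4 k(2)] by (intro comp_reduce[symmetric]) auto
    also have "\<dots> = gen (Suc n) i \<cdot> act (Suc n) \<sigma>"
      by (simp only: \<sigma> a[OF k])
    finally show ?thesis .
  qed
qed simp

lemma act_gen: "1 \<le> i \<Longrightarrow> i < n \<Longrightarrow> act n (adj i) = gen n i"
  using act_adj[of id n i] by (simp add: permutes_id)

lemma act_comp:
  assumes "\<sigma> permutes {1..n}" "\<tau> permutes {1..n}"
  shows "act n (\<sigma> \<circ> \<tau>) = act n \<sigma> \<cdot> act n \<tau>"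
  using assms(1)
proof (induction rule: permutes_adj_induct)
  case (adj i \<rho>)
  have IH: "act n (\<rho> \<circ> \<tau>) = act n \<rho> \<cdot> act n \<tau>"
    using adj.IH by (simp add: comp_def)
  have "act n (adj i \<circ> \<rho> \<circ> \<tau>) = act n (adj i \<circ> (\<rho> \<circ> \<tau>))"
    by (simp only: o_assoc)
  also have "\<dots> = gen n i \<cdot> act n (\<rho> \<circ> \<tau>)"
    using adj.hyps assms(2) by (intro act_adj permutes_compose)
  also have "\<dots> = act n (adj i \<circ> \<rho>) \<cdot> act n \<tau>"
    using adj.hyps by (simp add: act_adj IH)
  finally show "act n ((adj i \<circ> \<rho>) \<circ> \<tau>) = act n (adj i \<circ> \<rho>) \<cdot> act n \<tau>" .
qed (simp add: id_def[symmetric])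

end

section \<open>The category \<open>\<Sigma>'\<close> is a flat braided bimonoidal category\<close>

abbreviation Sigma ("\<Sigma>") where "\<Sigma> \<equiv> Sigma_prime"
abbreviation Sigma_comp (infixl "\<cdot>\<^sub>\<Sigma>" 55) where "g \<cdot>\<^sub>\<Sigma> f \<equiv> g \<cdot>\<^bsub>\<Sigma>\<^esub> f"
abbreviation Sigma_prod (infixl "\<boxtimes>\<^sub>\<Sigma>" 70) where "f \<boxtimes>\<^sub>\<Sigma> g \<equiv> f \<boxtimes>\<^bsub>\<Sigma>\<^esub> g"
abbreviation Sigma_DistL ("\<delta>\<^sub>\<Sigma>") where "\<delta>\<^sub>\<Sigma> \<equiv> \<delta>\<^sup>l\<^bsub>\<Sigma>\<^esub>"
abbreviation Sigma_braid ("\<zeta>\<^sub>\<Sigma>") where "\<zeta>\<^sub>\<Sigma> \<equiv> \<zeta>\<^sup>\<otimes>\<^bsub>\<Sigma>\<^esub>"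

lemma Sigma_simps [simp]:
  "Obj \<Sigma> = UNIV" "Dom \<Sigma> = fst" "Cod \<Sigma> = fst" "Ident \<Sigma> = perm_id"
  "tensor_obj (AddM \<Sigma>) = (+)" "tensor_arr (AddM \<Sigma>) = block_sum"
  "tensor_unit (AddM \<Sigma>) = 0" "assoc (AddM \<Sigma>) m n p = perm_id (m + n + p)"
  "lunit (AddM \<Sigma>) = perm_id" "runit (AddM \<Sigma>) = perm_id" "AddBraid \<Sigma> = block_swap"
  "tensor_obj (MulM \<Sigma>) = (*)"
  "tensor_unit (MulM \<Sigma>) = 1" "assoc (MulM \<Sigma>) m n p = perm_id (m * n * p)"
  "lunit (MulM \<Sigma>) = perm_id" "runit (MulM \<Sigma>) = perm_id"
  "LNull \<Sigma> n = perm_id 0" "RNull \<Sigma> n = perm_id 0" "DistR \<Sigma> m n p = perm_id ((m + n) * p)"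
  by (simp_all add: Sigma_prime_def Sigma_add_def Sigma_mul_def)

lemma Sigma_unfold:
  "f \<boxtimes>\<^sub>\<Sigma> g = on_pairs (fst f) (fst g) (\<lambda>i j. lex_index (fst g) (snd f i) (snd g j))"
  "\<delta>\<^sub>\<Sigma> m n p = on_pairs m (n + p)
     (\<lambda>i j. if j \<le> n then lex_index n i j else m * n + lex_index p i (j - n))"
  "\<zeta>\<^sub>\<Sigma> m n = on_pairs m n (\<lambda>i j. lex_index m j i)"
  by (simp_all add: Sigma_prime_def Sigma_mul_def)

lemma Sigma_Arr_iff: "f \<in> Arr \<Sigma> \<longleftrightarrow> snd f permutes {1..fst f}"
  by (simp add: Sigma_prime_def)

lemma Sigma_comp_simps [simp]: "fst (g \<cdot>\<^sub>\<Sigma> f) = fst f" "snd (g \<cdot>\<^sub>\<Sigma> f) k = snd g (snd f k)"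
  by (simp_all add: Sigma_prime_def)

lemma perm_id_simps [simp]: "fst (perm_id n) = n" "snd (perm_id n) = id"
  by (simp_all add: perm_id_def)

lemma fst_perm_arr [simp]:
  "fst (block_sum f g) = fst f + fst g" "fst (block_swap m n) = m + n" "fst (on_pairs m n h) = m * n"
  by (simp_all add: block_sum_def block_swap_def on_pairs_def Let_def)

lemma permutes_range:
  fixes \<sigma> :: "nat \<Rightarrow> nat"
  assumes "\<sigma> permutes {1..n}" "1 \<le> k" "k \<le> n"
  shows "1 \<le> \<sigma> k" "\<sigma> k \<le> n"
proof -
  have "\<sigma> k \<in> {1..n}"
    using permutes_in_image[OF assms(1)] assms(2,3) by simp
  then show "1 \<le> \<sigma> k" "\<sigma> k \<le> n" by simp_all
qed

lemma snd_range [simp]: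
  assumes "f \<in> Arr \<Sigma>" "1 \<le> k" "k \<le> fst f"
  shows "Suc 0 \<le> snd f k" "snd f k \<le> fst f"
  using permutes_range[OF assms(1)[unfolded Sigma_Arr_iff] assms(2,3)] unfolding One_nat_def .

lemma permutes_finite_inj:
  assumes "finite S" "\<And>x. x \<in> S \<Longrightarrow> p x \<in> S" "\<And>x y. x \<in> S \<Longrightarrow> y \<in> S \<Longrightarrow> p x = p y \<Longrightarrow> x = y"
    "\<And>x. x \<notin> S \<Longrightarrow> p x = x"
  shows "p permutes S"
proof (rule bij_imp_permutes)
  have "inj_on p S" using assms(3) by (auto intro: inj_onI)
  moreover have "p ` S \<subseteq> S" using assms(2) by auto
  ultimately show "bij_betw p S S"
    using endo_inj_surj[OF assms(1)] by (simp add: bij_betw_def)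
qed (rule assms(4))

lemma Sigma_eqI:
  assumes "f \<in> Arr \<Sigma>" "g \<in> Arr \<Sigma>" "fst f = n" "fst g = n"
    "\<And>k. 1 \<le> k \<Longrightarrow> k \<le> n \<Longrightarrow> snd f k = snd g k"
  shows "f = g"
proof (rule prod_eqI)
  show "snd f = snd g"
  proof
    fix k show "snd f k = snd g k"
    proof (cases "k \<in> {1..n}")
      case False
      then have "snd f k = k" "snd g k = k"
        using permutes_not_in[of "snd f" "{1..n}" k] permutes_not_in[of "snd g" "{1..n}" k] assms(1-4)
        unfolding Sigma_Arr_iff by metis+
      then show ?thesis by simp
    qed (use assms(5) in simp)
  qed
qed (simp add: assms)

lemma block_cases:
  fixes k :: nat
  assumes "1 \<le> k" "k \<le> m + n"
  obtains "k \<le> m" | j where "1 \<le> j" "j \<le> n" "k = m + j"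
proof (cases "k \<le> m")
  case False
  with assms have "1 \<le> k - m" "k - m \<le> n" "k = m + (k - m)" by linarith+
  then show ?thesis by (rule that(2))
qed (rule that(1))

lemma block_sum_eval [simp]:
  "1 \<le> k \<Longrightarrow> k \<le> fst f \<Longrightarrow> snd (block_sum f g) k = snd f k"
  "fst f = m \<Longrightarrow> 1 \<le> k \<Longrightarrow> k \<le> fst g \<Longrightarrow> snd (block_sum f g) (m + k) = m + snd g k"
  by (auto simp: block_sum_def Let_def)

lemma block_swap_eval [simp]:
  "1 \<le> k \<Longrightarrow> k \<le> m \<Longrightarrow> snd (block_swap m n) k = n + k"
  "1 \<le> k \<Longrightarrow> k \<le> n \<Longrightarrow> snd (block_swap m n) (m + k) = k"
  by (auto simp: block_swap_def)

text \<open>\<open>\<tau>\<close> acting on the second of two blocks, the first of which has size \<open>m\<close>.\<close>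

definition shift :: "nat \<Rightarrow> (nat \<Rightarrow> nat) \<Rightarrow> nat \<Rightarrow> nat" where
  "shift m \<tau> i = (if m < i then m + \<tau> (i - m) else i)"

lemma shift_permutes:
  assumes \<tau>: "\<tau> permutes {1..n}"
  shows "shift m \<tau> permutes {1..m + n}"
  unfolding permutes_def
proof (intro conjI allI impI)
  fix i assume "i \<notin> {1..m + n}"
  then have "\<tau> (i - m) = i - m" if "m < i"
    using that by (intro permutes_not_in[OF \<tau>]) auto
  then show "shift m \<tau> i = i" by (simp add: shift_def)
next
  fix y
  show "\<exists>!x. shift m \<tau> x = y"
  proof (cases "m < y")
    case True
    then have "\<tau> (inv \<tau> (y - m)) = y - m" "0 < inv \<tau> (y - m)"
      using permutes_inverses(1)[OF \<tau>] permutes_not_in[OF \<tau>, of 0]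
      by (metis gr0I zero_less_diff atLeastAtMost_iff not_one_le_zero)+
    with True have "shift m \<tau> (m + inv \<tau> (y - m)) = y" by (simp add: shift_def)
    moreover have "x = m + inv \<tau> (y - m)" if "shift m \<tau> x = y" for x
      using that True permutes_inverses(2)[OF \<tau>, of "x - m"] by (auto simp: shift_def split: if_splits)
    ultimately show ?thesis by blast
  next
    case False
    have pos: "0 < \<tau> (x - m)" if "m < x" for x
      using that permutes_inj[OF \<tau>] permutes_not_in[OF \<tau>, of 0]
      by (metis gr0I injD zero_less_diff atLeastAtMost_iff not_one_le_zero less_irrefl)
    from False have "shift m \<tau> y = y" by (simp add: shift_def)
    moreover have "x = y" if "shift m \<tau> x = y" for x
      using that False pos[of x] by (auto simp: shift_def split: if_splits)
    ultimately show ?thesis by blast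
  qed
qed

lemma block_sum_shift:
  assumes f: "snd f permutes {1..fst f}" and g: "snd g permutes {1..fst g}"
  shows "snd (block_sum f g) = shift (fst f) (snd g) \<circ> snd f"
proof
  fix i
  have fg: "snd f k = k" if "fst f < k" for k
    using that by (intro permutes_not_in[OF f]) auto
  have gg: "snd g k = k" if "fst g < k" for k
    using that by (intro permutes_not_in[OF g]) auto
  have f0: "snd f 0 = 0"
    by (rule permutes_not_in[OF f]) auto
  consider "i = 0" | "1 \<le> i" "i \<le> fst f" | "fst f < i" "i \<le> fst f + fst g" | "fst f + fst g < i" by linarith
  then show "snd (block_sum f g) i = (shift (fst f) (snd g) \<circ> snd f) i"
  proof cases
    case 2
    then show ?thesis using permutes_range(2)[OF f 2] by (simp add: shift_def)
  qed (simp_all add: shift_def block_sum_def Let_def f0 fg gg)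
qed

lemma block_sum_permutes:
  assumes f: "snd f permutes {1..fst f}" and g: "snd g permutes {1..fst g}" and N: "N = fst f + fst g"
  shows "snd (block_sum f g) permutes {1..N}"
proof -
  have "snd f permutes {1..N}"
    using f by (rule permutes_subset) (simp add: N)
  then show ?thesis
    unfolding block_sum_shift[OF f g] using shift_permutes[OF g, of "fst f"] by (simp add: N permutes_compose)
qed

lemma block_swap_permutes: "N = m + n \<Longrightarrow> snd (block_swap m n) permutes {1..N}"
  by (rule permutes_finite_inj) (auto simp: block_swap_def split: if_splits)

lemma lex_index_le [simp]: "1 \<le> i \<Longrightarrow> i \<le> m \<Longrightarrow> j \<le> n \<Longrightarrow> lex_index n i j \<le> m * n"
proof -
  assume "1 \<le> i" "i \<le> m" "j \<le> n"
  then have "(i - 1) * n + j \<le> (i - 1) * n + n" "(i - 1) * n + n = i * n" "i * n \<le> m * n"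
    by (auto simp: algebra_simps diff_mult_distrib)
  then show ?thesis unfolding lex_index_def by linarith
qed

lemma lex_index_pos [simp]:
  "1 \<le> j \<Longrightarrow> 1 \<le> lex_index n i j" "1 \<le> j \<Longrightarrow> Suc 0 \<le> lex_index n i j" "1 \<le> j \<Longrightarrow> 0 < lex_index n i j"
  by (simp_all add: lex_index_def)

lemma lex_index_decode:
  assumes "1 \<le> i" "1 \<le> j" "j \<le> n"
  shows "(lex_index n i j - 1) div n + 1 = i" "(lex_index n i j - 1) mod n + 1 = j"
proof -
  from assms obtain a b where "i = Suc a" "j = Suc b"
    by (cases i; cases j) auto
  then show "(lex_index n i j - 1) div n + 1 = i" "(lex_index n i j - 1) mod n + 1 = j"
    using assms by (auto simp: lex_index_def)
qed

lemma pair_cases: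
  assumes "1 \<le> k" "k \<le> m * n"
  obtains i j where "1 \<le> i" "i \<le> m" "1 \<le> j" "j \<le> n" "k = lex_index n i j"
proof -
  have n: "0 < n" using assms by (cases n) auto
  have "(k - 1) div n < m"
    using assms n by (simp add: div_less_iff_less_mult)
  moreover have "(k - 1) mod n < n" using n by simp
  moreover have "k = lex_index n ((k - 1) div n + 1) ((k - 1) mod n + 1)"
    using assms by (simp add: lex_index_def)
  ultimately show ?thesis
    using that[of "(k - 1) div n + 1" "(k - 1) mod n + 1"] by simp
qed

lemma lex_index_inj:
  assumes "1 \<le> i" "1 \<le> j" "j \<le> n" "1 \<le> i'" "1 \<le> j'" "j' \<le> n"
  shows "lex_index n i j = lex_index n i' j' \<longleftrightarrow> i = i' \<and> j = j'"
  using lex_index_decode[OF assms(1-3)] lex_index_decode[OF assms(4-6)] by metis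

lemma lex_index_assoc:
  "1 \<le> j \<Longrightarrow> lex_index p (lex_index n i j) l = lex_index (n * p) i (lex_index p j l)"
  by (cases j) (auto simp: lex_index_def algebra_simps)

lemma lex_index_add: "1 \<le> i \<Longrightarrow> lex_index p (m + i) j = m * p + lex_index p i j"
  by (cases i) (auto simp: lex_index_def algebra_simps)

lemma lex_index_unit: "lex_index n (Suc 0) j = j" "1 \<le> i \<Longrightarrow> lex_index (Suc 0) i (Suc 0) = i"
  by (simp_all add: lex_index_def)

lemma on_pairs_eval [simp]:
  assumes "1 \<le> i" "i \<le> m" "1 \<le> j" "j \<le> n"
  shows "snd (on_pairs m n h) (lex_index n i j) = h i j"
  using lex_index_le[OF assms(1,2,4)] lex_index_pos(1)[OF assms(3)] lex_index_decode[OF assms(1,3,4)]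
  by (simp add: on_pairs_def)

lemma on_pairs_permutes:
  assumes "N = m * n"
    and range: "\<And>i j. 1 \<le> i \<Longrightarrow> i \<le> m \<Longrightarrow> 1 \<le> j \<Longrightarrow> j \<le> n \<Longrightarrow> 1 \<le> h i j \<and> h i j \<le> N"
    and inj: "\<And>i j i' j'. 1 \<le> i \<Longrightarrow> i \<le> m \<Longrightarrow> 1 \<le> j \<Longrightarrow> j \<le> n \<Longrightarrow> 1 \<le> i' \<Longrightarrow> i' \<le> m \<Longrightarrow> 1 \<le> j' \<Longrightarrow> j' \<le> n
      \<Longrightarrow> h i j = h i' j' \<Longrightarrow> i = i' \<and> j = j'"
  shows "snd (on_pairs m n h) permutes {1..N}"
proof (rule permutes_finite_inj)
  fix x y assume x: "x \<in> {1..N}" and y: "y \<in> {1..N}" and eq: "snd (on_pairs m n h) x = snd (on_pairs m n h) y"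
  from x assms(1) have "1 \<le> x" "x \<le> m * n" by auto
  then obtain i j where i: "1 \<le> i" "i \<le> m" "1 \<le> j" "j \<le> n" "x = lex_index n i j"
    by (rule pair_cases)
  from y assms(1) have "1 \<le> y" "y \<le> m * n" by auto
  then obtain i' j' where i': "1 \<le> i'" "i' \<le> m" "1 \<le> j'" "j' \<le> n" "y = lex_index n i' j'"
    by (rule pair_cases)
  from eq i i' inj[of i j i' j'] show "x = y" by simp
next
  fix x assume "x \<in> {1..N}"
  with assms(1) have "1 \<le> x" "x \<le> m * n" by auto
  then obtain i j where "1 \<le> i" "i \<le> m" "1 \<le> j" "j \<le> n" "x = lex_index n i j"
    by (rule pair_cases)
  with range[of i j] show "snd (on_pairs m n h) x \<in> {1..N}" by simp
qed (use assms(1) in \<open>auto simp: on_pairs_def\<close>)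

lemma prod_permutes:
  assumes "\<sigma> permutes {1..m}" "\<tau> permutes {1..n}" "N = m * n"
  shows "snd (on_pairs m n (\<lambda>i j. lex_index n (\<sigma> i) (\<tau> j))) permutes {1..N}"
proof (rule on_pairs_permutes[OF assms(3)])
  fix i j i' j'
  assume "1 \<le> i" "i \<le> m" "1 \<le> j" "j \<le> n" "1 \<le> i'" "i' \<le> m" "1 \<le> j'" "j' \<le> n"
    "lex_index n (\<sigma> i) (\<tau> j) = lex_index n (\<sigma> i') (\<tau> j')"
  then have "\<sigma> i = \<sigma> i'" "\<tau> j = \<tau> j'"
    using lex_index_inj[of "\<sigma> i" "\<tau> j" n "\<sigma> i'" "\<tau> j'"] permutes_range[OF assms(1)] permutes_range[OF assms(2)]
    by auto
  then show "i = i' \<and> j = j'"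
    using assms by (metis permutes_inj injD)
next
  fix i j assume "1 \<le> i" "i \<le> m" "1 \<le> j" "j \<le> n"
  then show "1 \<le> lex_index n (\<sigma> i) (\<tau> j) \<and> lex_index n (\<sigma> i) (\<tau> j) \<le> N"
    using assms(3) permutes_range[OF assms(1)] permutes_range[OF assms(2)] by simp
qed

lemma transpose_permutes: "N = m * n \<Longrightarrow> snd (on_pairs m n (\<lambda>i j. lex_index m j i)) permutes {1..N}"
  by (rule on_pairs_permutes) (auto simp: lex_index_inj mult.commute[of m n])

lemma DistL_permutes:
  assumes "N = m * (n + p)"
  shows "snd (on_pairs m (n + p) (\<lambda>i j. if j \<le> n then lex_index n i j else m * n + lex_index p i (j - n)))
    permutes {1..N}"
proof (rule on_pairs_permutes[OF assms])
  fix i j assume ij: "1 \<le> i" "i \<le> m" "1 \<le> j" "j \<le> n + p"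
  have "1 \<le> lex_index p i (j - n)" if "\<not> j \<le> n"
    using that by (intro lex_index_pos) simp
  with ij show "1 \<le> (if j \<le> n then lex_index n i j else m * n + lex_index p i (j - n)) \<and>
    (if j \<le> n then lex_index n i j else m * n + lex_index p i (j - n)) \<le> N"
    using lex_index_le[of i m j n] lex_index_le[of i m "j - n" p]
    by (auto simp: assms add_mult_distrib2 trans_le_add1 trans_le_add2)
next
  fix i j i' j'
  assume ij: "1 \<le> i" "i \<le> m" "1 \<le> j" "j \<le> n + p" "1 \<le> i'" "i' \<le> m" "1 \<le> j'" "j' \<le> n + p"
    and eq: "(if j \<le> n then lex_index n i j else m * n + lex_index p i (j - n)) =
       (if j' \<le> n then lex_index n i' j' else m * n + lex_index p i' (j' - n))"
  have neq: "lex_index n a b \<noteq> m * n + lex_index p c d"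
    if "1 \<le> a" "a \<le> m" "1 \<le> b" "b \<le> n" "1 \<le> d" for a b c d
    using lex_index_le[OF that(1,2,4)] lex_index_pos(1)[OF that(5), of p c] by linarith
  show "i = i' \<and> j = j'"
  proof (cases "j \<le> n"; cases "j' \<le> n")
    assume "j \<le> n" "j' \<le> n"
    then show ?thesis using eq ij by (simp add: lex_index_inj)
  next
    assume j: "j \<le> n" "\<not> j' \<le> n"
    then have "1 \<le> j' - n" by linarith
    with neq[OF ij(1-3) j(1)] eq j show ?thesis by simp
  next
    assume j: "\<not> j \<le> n" "j' \<le> n"
    then have "1 \<le> j - n" by linarith
    with neq[OF ij(5-7) j(2)] eq[symmetric] j show ?thesis by simp
  next
    assume j: "\<not> j \<le> n" "\<not> j' \<le> n"
    then have "1 \<le> j - n" "j - n \<le> p" "1 \<le> j' - n" "j' - n \<le> p" using ij by linarith+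
    with lex_index_inj[of i "j - n" p i' "j' - n"] eq j ij have "i = i'" "j - n = j' - n" by simp_all
    with j show ?thesis by linarith
  qed
qed

text \<open>Arrows of \<open>\<Sigma>\<close> are compared at the points of a block \<open>k \<le> m\<close>, \<open>k = m + j\<close>, or at the pairs
  \<open>lex_index n i j\<close>. The evaluation rules below compute all structure arrows at such points.\<close>

lemma Sigma_category: "category \<Sigma>"
proof unfold_locales
  fix f g A B C assume "f \<in> hom \<Sigma> A B" "g \<in> hom \<Sigma> B C"
  then show "g \<cdot>\<^sub>\<Sigma> f \<in> hom \<Sigma> A C"
    by (auto simp: hom_iff Sigma_prime_def intro: permutes_compose)
qed (auto simp: hom_iff Sigma_prime_def o_assoc perm_id_def)

interpretation Sig: category \<Sigma>
  by (rule Sigma_category)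

lemma Sigma_prod_fst [simp]: "fst (f \<boxtimes>\<^sub>\<Sigma> g) = fst f * fst g"
  by (simp add: Sigma_unfold)

lemma Sigma_prod_eval [simp]:
  "fst g = n \<Longrightarrow> 1 \<le> i \<Longrightarrow> i \<le> fst f \<Longrightarrow> 1 \<le> j \<Longrightarrow> j \<le> n
    \<Longrightarrow> snd (f \<boxtimes>\<^sub>\<Sigma> g) (lex_index n i j) = lex_index n (snd f i) (snd g j)"
  by (auto simp: Sigma_unfold)

lemma Sigma_DistL_fst [simp]: "fst (\<delta>\<^sub>\<Sigma> m n p) = m * (n + p)"
  by (simp add: Sigma_unfold)

lemma Sigma_DistL_eval [simp]:
  "1 \<le> i \<Longrightarrow> i \<le> m \<Longrightarrow> 1 \<le> j \<Longrightarrow> j \<le> n \<Longrightarrow> snd (\<delta>\<^sub>\<Sigma> m n p) (lex_index (n + p) i j) = lex_index n i j"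
  "1 \<le> i \<Longrightarrow> i \<le> m \<Longrightarrow> 1 \<le> j \<Longrightarrow> j \<le> p
    \<Longrightarrow> snd (\<delta>\<^sub>\<Sigma> m n p) (lex_index (n + p) i (n + j)) = m * n + lex_index p i j"
  by (auto simp: Sigma_unfold)

lemma Sigma_braid_fst [simp]: "fst (\<zeta>\<^sub>\<Sigma> m n) = m * n"
  by (simp add: Sigma_unfold)

lemma Sigma_braid_eval [simp]:
  "1 \<le> i \<Longrightarrow> i \<le> m \<Longrightarrow> 1 \<le> j \<Longrightarrow> j \<le> n \<Longrightarrow> snd (\<zeta>\<^sub>\<Sigma> m n) (lex_index n i j) = lex_index m j i"
  by (auto simp: Sigma_unfold)

lemma Sigma_Arr [simp]:
  "perm_id n \<in> Arr \<Sigma>"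
  "f \<in> Arr \<Sigma> \<Longrightarrow> g \<in> Arr \<Sigma> \<Longrightarrow> fst f = fst g \<Longrightarrow> g \<cdot>\<^sub>\<Sigma> f \<in> Arr \<Sigma>"
  "f \<in> Arr \<Sigma> \<Longrightarrow> g \<in> Arr \<Sigma> \<Longrightarrow> block_sum f g \<in> Arr \<Sigma>"
  "block_swap m n \<in> Arr \<Sigma>"
  "f \<in> Arr \<Sigma> \<Longrightarrow> g \<in> Arr \<Sigma> \<Longrightarrow> f \<boxtimes>\<^sub>\<Sigma> g \<in> Arr \<Sigma>"
  "\<delta>\<^sub>\<Sigma> m n p \<in> Arr \<Sigma>"
  "\<zeta>\<^sub>\<Sigma> m n \<in> Arr \<Sigma>"
proof -
  show "f \<in> Arr \<Sigma> \<Longrightarrow> g \<in> Arr \<Sigma> \<Longrightarrow> fst f = fst g \<Longrightarrow> g \<cdot>\<^sub>\<Sigma> f \<in> Arr \<Sigma>"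
    by (rule Sig.comp_simps) simp_all
  show "f \<in> Arr \<Sigma> \<Longrightarrow> g \<in> Arr \<Sigma> \<Longrightarrow> f \<boxtimes>\<^sub>\<Sigma> g \<in> Arr \<Sigma>"
    using prod_permutes[of "snd f" "fst f" "snd g" "fst g"] by (simp add: Sigma_Arr_iff Sigma_unfold)
  show "\<delta>\<^sub>\<Sigma> m n p \<in> Arr \<Sigma>"
    using DistL_permutes[of _ m n p] by (simp add: Sigma_Arr_iff Sigma_unfold)
  show "\<zeta>\<^sub>\<Sigma> m n \<in> Arr \<Sigma>"
    using transpose_permutes[of _ m n] by (simp add: Sigma_Arr_iff Sigma_unfold)
qed (use block_sum_permutes block_swap_permutes in \<open>simp_all add: Sigma_Arr_iff\<close>)

lemma Sigma_inverse_arrows: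
  assumes "f \<in> Arr \<Sigma>"
  shows "inverse_arrows \<Sigma> f (fst f, inv (snd f))"
  using assms permutes_inv_o[of "snd f"] permutes_inv[of "snd f"]
  by (simp add: inverse_arrows_def hom_iff Sigma_Arr_iff) (simp add: Sigma_prime_def perm_id_def)

lemma Sigma_iso: "f \<in> Arr \<Sigma> \<Longrightarrow> is_iso \<Sigma> f"
  using Sigma_inverse_arrows unfolding is_iso_def by blast

lemma Sigma_mono: "f \<in> Arr \<Sigma> \<Longrightarrow> is_mono \<Sigma> f"
  by (rule Sig.iso_is_mono[OF Sigma_iso])

lemma Sigma_inv_ident [simp]: "inv_arr \<Sigma> (perm_id n) = perm_id n"
  by (rule Sig.inv_arr_eq) (use Sig.ident_comp(1)[of "perm_id n" n] in \<open>simp add: inverse_arrows_def hom_iff\<close>)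

lemma Sigma_ident_comp [simp]:
  "f \<in> Arr \<Sigma> \<Longrightarrow> fst f = n \<Longrightarrow> perm_id n \<cdot>\<^sub>\<Sigma> f = f"
  "f \<in> Arr \<Sigma> \<Longrightarrow> fst f = n \<Longrightarrow> f \<cdot>\<^sub>\<Sigma> perm_id n = f"
  using Sig.ident_comp[of f n] by simp_all

lemma Sigma_size_zero: "f \<in> Arr \<Sigma> \<Longrightarrow> g \<in> Arr \<Sigma> \<Longrightarrow> fst f = 0 \<Longrightarrow> fst g = 0 \<Longrightarrow> f = g"
  by (rule Sigma_eqI[of _ _ 0]) auto

lemma block_sum_ident [simp]: "block_sum (perm_id m) (perm_id n) = perm_id (m + n)"
  by (auto simp: block_sum_def perm_id_def Let_def)

lemma block_sum_ident_zero [simp]: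
  assumes "f \<in> Arr \<Sigma>"
  shows "block_sum (perm_id 0) f = f" "block_sum f (perm_id 0) = f"
proof -
  have "snd (block_sum (perm_id 0) f) k = snd f k" if "1 \<le> k" "k \<le> fst f" for k
    using block_sum_eval(2)[of "perm_id 0" 0 k f] that by simp
  then show "block_sum (perm_id 0) f = f"
    using assms by (intro Sigma_eqI[of _ _ "fst f"]) auto
  show "block_sum f (perm_id 0) = f"
    using assms by (intro Sigma_eqI[of _ _ "fst f"]) auto
qed

lemma prod_ident [simp]: "perm_id m \<boxtimes>\<^sub>\<Sigma> perm_id n = perm_id (m * n)"
proof (rule Sigma_eqI[of _ _ "m * n"])
  fix k assume "1 \<le> k" "k \<le> m * n"
  then obtain i j where "1 \<le> i" "i \<le> m" "1 \<le> j" "j \<le> n" "k = lex_index n i j"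
    by (rule pair_cases)
  then show "snd (perm_id m \<boxtimes>\<^sub>\<Sigma> perm_id n) k = snd (perm_id (m * n)) k" by simp
qed auto

lemma block_sum_comp:
  assumes "f \<in> Arr \<Sigma>" "f' \<in> Arr \<Sigma>" "g \<in> Arr \<Sigma>" "g' \<in> Arr \<Sigma>" "fst f' = fst f" "fst g' = fst g"
  shows "block_sum (f' \<cdot>\<^sub>\<Sigma> f) (g' \<cdot>\<^sub>\<Sigma> g) = block_sum f' g' \<cdot>\<^sub>\<Sigma> block_sum f g"
proof (rule Sigma_eqI[of _ _ "fst f + fst g"])
  fix k assume "1 \<le> k" "k \<le> fst f + fst g"
  then show "snd (block_sum (f' \<cdot>\<^sub>\<Sigma> f) (g' \<cdot>\<^sub>\<Sigma> g)) k = snd (block_sum f' g' \<cdot>\<^sub>\<Sigma> block_sum f g) k"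
  proof (cases rule: block_cases[OF \<open>1 \<le> k\<close> \<open>k \<le> fst f + fst g\<close>])
    case 1
    then show ?thesis using assms \<open>1 \<le> k\<close> by simp
  next
    case (2 j)
    then show ?thesis using assms by simp
  qed
qed (use assms in auto)

lemma block_sum_assoc: "block_sum (block_sum f g) h = block_sum f (block_sum g h)"
  by (rule prod_eqI) (auto simp: block_sum_def Let_def fun_eq_iff)

lemma block_swap_nat:
  assumes "f \<in> Arr \<Sigma>" "g \<in> Arr \<Sigma>" "fst f = m" "fst g = n"
  shows "block_swap m n \<cdot>\<^sub>\<Sigma> block_sum f g = block_sum g f \<cdot>\<^sub>\<Sigma> block_swap m n"
proof (rule Sigma_eqI[of _ _ "m + n"])
  fix k assume k: "1 \<le> k" "k \<le> m + n"
  then show "snd (block_swap m n \<cdot>\<^sub>\<Sigma> block_sum f g) k = snd (block_sum g f \<cdot>\<^sub>\<Sigma> block_swap m n) k"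
  proof (cases rule: block_cases[OF k])
    case 1
    then show ?thesis using assms k snd_range[of f k] by simp
  next
    case (2 j)
    then show ?thesis using assms snd_range[of g j] by simp
  qed
qed (use assms in auto)

lemma block_swap_hexagon:
  "block_sum (perm_id n) (block_swap m p) \<cdot>\<^sub>\<Sigma> block_sum (block_swap m n) (perm_id p) = block_swap m (n + p)"
  (is "?l = ?r")
proof (rule Sigma_eqI[of _ _ "m + n + p"])
  fix k assume k: "1 \<le> k" "k \<le> m + n + p"
  then consider "k \<le> m" | j where "k = m + j" "1 \<le> j" "j \<le> n" | j where "k = m + n + j" "1 \<le> j" "j \<le> p"
    by (metis block_cases)
  then show "snd ?l k = snd ?r k"
  proof cases
    case 1
    then show ?thesis using k by simp
  next
    case (2 j)
    then show ?thesis by simp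
  next
    case (3 j)
    have "snd ?l k = snd (block_sum (perm_id n) (block_swap m p)) (n + (m + j))"
      using 3 block_sum_eval(2)[of "block_swap m n" "m + n" j "perm_id p"]
      by (simp add: add.left_commute add.commute)
    also have "\<dots> = n + j" using 3 block_sum_eval(2)[of "perm_id n" n "m + j" "block_swap m p"] by simp
    also have "\<dots> = snd ?r k" using 3 block_swap_eval(2)[of "n + j" "n + p" m] by (simp add: add.assoc)
    finally show ?thesis .
  qed
qed auto

lemma block_swap_symmetry: "block_swap n m \<cdot>\<^sub>\<Sigma> block_swap m n = perm_id (m + n)"
proof (rule Sigma_eqI[of _ _ "m + n"])
  fix k assume k: "1 \<le> k" "k \<le> m + n"
  then show "snd (block_swap n m \<cdot>\<^sub>\<Sigma> block_swap m n) k = snd (perm_id (m + n)) k"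
    by (cases rule: block_cases[OF k]) simp_all
qed auto

text \<open>The inverse of \<open>block_swap_hexagon\<close>, since block swaps are mutually inverse.\<close>

lemma block_swap_hexagon_inv:
  "block_sum (block_swap m p) (perm_id n) \<cdot>\<^sub>\<Sigma> block_sum (perm_id m) (block_swap n p) = block_swap (m + n) p"
  (is "?l = ?r")
proof -
  let ?s = "block_swap p (m + n)"
  have "?l \<cdot>\<^sub>\<Sigma> ?s = block_sum (block_swap m p) (perm_id n) \<cdot>\<^sub>\<Sigma>
      (block_sum (perm_id m) (block_swap n p) \<cdot>\<^sub>\<Sigma> (block_sum (perm_id m) (block_swap p n)
        \<cdot>\<^sub>\<Sigma> block_sum (block_swap p m) (perm_id n)))"
    by (simp add: block_swap_hexagon)
  also have "\<dots> = perm_id (p + (m + n))"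
    by (simp add: Sig.comp_reduce[OF block_sum_comp[symmetric]] block_sum_comp[symmetric] block_swap_symmetry add.assoc)
  also have "\<dots> = ?r \<cdot>\<^sub>\<Sigma> ?s" by (simp add: block_swap_symmetry)
  finally show ?thesis
    by - (rule Sig.iso_cancel_right[OF Sigma_iso[of ?s]], auto)
qed

lemma block_swap_zero [simp]: "block_swap 0 n = perm_id n" "block_swap n 0 = perm_id n"
  by (auto simp: block_swap_def perm_id_def fun_eq_iff)

lemma Sigma_add_symmetric: "symmetric_monoidal_category \<Sigma> (AddM \<Sigma>) (AddBraid \<Sigma>)"
  by unfold_locales
    (auto simp: hom_iff Sigma_iso block_sum_comp block_sum_assoc block_swap_nat block_swap_symmetry add.assoc
      block_swap_hexagon block_swap_hexagon_inv)

interpretation Sig_add: symmetric_monoidal_category \<Sigma> "AddM \<Sigma>" "AddBraid \<Sigma>"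
  by (rule Sigma_add_symmetric)

lemma Sigma_eq_pairsI:
  assumes "f \<in> Arr \<Sigma>" "g \<in> Arr \<Sigma>" "fst f = m * n" "fst g = m * n"
    "\<And>i j. 1 \<le> i \<Longrightarrow> i \<le> m \<Longrightarrow> 1 \<le> j \<Longrightarrow> j \<le> n \<Longrightarrow> snd f (lex_index n i j) = snd g (lex_index n i j)"
  shows "f = g"
proof (rule Sigma_eqI[OF assms(1-4)])
  fix k assume "1 \<le> k" "k \<le> m * n"
  then obtain i j where "1 \<le> i" "i \<le> m" "1 \<le> j" "j \<le> n" "k = lex_index n i j"
    by (rule pair_cases)
  then show "snd f k = snd g k" using assms(5) by simp
qed

lemma prod_comp:
  assumes [simp]: "f \<in> Arr \<Sigma>" "f' \<in> Arr \<Sigma>" "g \<in> Arr \<Sigma>" "g' \<in> Arr \<Sigma>" "fst f' = fst f" "fst g' = fst g"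
  shows "(f' \<cdot>\<^sub>\<Sigma> f) \<boxtimes>\<^sub>\<Sigma> (g' \<cdot>\<^sub>\<Sigma> g) = (f' \<boxtimes>\<^sub>\<Sigma> g') \<cdot>\<^sub>\<Sigma> (f \<boxtimes>\<^sub>\<Sigma> g)"
  (is "?l = ?r")
proof (rule Sigma_eq_pairsI[of _ _ "fst f" "fst g"])
  fix i j assume "1 \<le> i" "i \<le> fst f" "1 \<le> j" "j \<le> fst g"
  then show "snd ?l (lex_index (fst g) i j) = snd ?r (lex_index (fst g) i j)"
    by simp
qed simp_all

lemma prod_assoc:
  assumes [simp]: "f \<in> Arr \<Sigma>" "g \<in> Arr \<Sigma>" "h \<in> Arr \<Sigma>"
  shows "(f \<boxtimes>\<^sub>\<Sigma> g) \<boxtimes>\<^sub>\<Sigma> h = f \<boxtimes>\<^sub>\<Sigma> (g \<boxtimes>\<^sub>\<Sigma> h)"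
proof (rule Sigma_eq_pairsI[of _ _ "fst f * fst g" "fst h"])
  fix a l assume a: "1 \<le> a" "a \<le> fst f * fst g" and l: "1 \<le> l" "l \<le> fst h"
  from a obtain i j where "1 \<le> i" "i \<le> fst f" "1 \<le> j" "j \<le> fst g" "a = lex_index (fst g) i j"
    by (rule pair_cases)
  with l show "snd ((f \<boxtimes>\<^sub>\<Sigma> g) \<boxtimes>\<^sub>\<Sigma> h) (lex_index (fst h) a l)
      = snd (f \<boxtimes>\<^sub>\<Sigma> (g \<boxtimes>\<^sub>\<Sigma> h)) (lex_index (fst h) a l)"
    using Sigma_prod_eval[of "g \<boxtimes>\<^sub>\<Sigma> h" "fst g * fst h" i f "lex_index (fst h) j l"]
      Sigma_prod_eval[of h "fst h" a "f \<boxtimes>\<^sub>\<Sigma> g" l] by (simp add: lex_index_assoc)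
qed (simp_all add: mult.assoc)

lemma prod_unit [simp]:
  assumes [simp]: "f \<in> Arr \<Sigma>"
  shows "perm_id (Suc 0) \<boxtimes>\<^sub>\<Sigma> f = f" "f \<boxtimes>\<^sub>\<Sigma> perm_id (Suc 0) = f"
proof -
  show "perm_id (Suc 0) \<boxtimes>\<^sub>\<Sigma> f = f"
  proof (rule Sigma_eqI[of _ _ "fst f"])
    fix k assume "1 \<le> k" "k \<le> fst f"
    then show "snd (perm_id (Suc 0) \<boxtimes>\<^sub>\<Sigma> f) k = snd f k"
      using Sigma_prod_eval[of f "fst f" "Suc 0" "perm_id (Suc 0)" k] by (simp add: lex_index_unit)
  qed simp_all
  show "f \<boxtimes>\<^sub>\<Sigma> perm_id (Suc 0) = f"
  proof (rule Sigma_eqI[of _ _ "fst f"])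
    fix k assume "1 \<le> k" "k \<le> fst f"
    then show "snd (f \<boxtimes>\<^sub>\<Sigma> perm_id (Suc 0)) k = snd f k"
      using Sigma_prod_eval[of "perm_id (Suc 0)" "Suc 0" k f "Suc 0"] by (simp add: lex_index_unit)
  qed simp_all
qed

lemma prod_braid_nat:
  assumes [simp]: "f \<in> Arr \<Sigma>" "g \<in> Arr \<Sigma>" "fst f = m" "fst g = n"
  shows "\<zeta>\<^sub>\<Sigma> m n \<cdot>\<^sub>\<Sigma> (f \<boxtimes>\<^sub>\<Sigma> g) = (g \<boxtimes>\<^sub>\<Sigma> f) \<cdot>\<^sub>\<Sigma> \<zeta>\<^sub>\<Sigma> m n"
proof (rule Sigma_eq_pairsI[of _ _ m n])
  fix i j assume "1 \<le> i" "i \<le> m" "1 \<le> j" "j \<le> n"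
  with snd_range[of f i] snd_range[of g j]
  show "snd (\<zeta>\<^sub>\<Sigma> m n \<cdot>\<^sub>\<Sigma> (f \<boxtimes>\<^sub>\<Sigma> g)) (lex_index n i j)
      = snd ((g \<boxtimes>\<^sub>\<Sigma> f) \<cdot>\<^sub>\<Sigma> \<zeta>\<^sub>\<Sigma> m n) (lex_index n i j)"
    by simp
qed (simp_all add: mult.commute)

lemma prod_hexagon:
  "(perm_id n \<boxtimes>\<^sub>\<Sigma> \<zeta>\<^sub>\<Sigma> m p) \<cdot>\<^sub>\<Sigma> (\<zeta>\<^sub>\<Sigma> m n \<boxtimes>\<^sub>\<Sigma> perm_id p) = \<zeta>\<^sub>\<Sigma> m (n * p)" (is "?l = ?r")
proof (rule Sigma_eq_pairsI[of _ _ m "n * p"])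
  fix i a assume i: "1 \<le> i" "i \<le> m" and a: "1 \<le> a" "a \<le> n * p"
  from a obtain j l where j: "1 \<le> j" "j \<le> n" "1 \<le> l" "l \<le> p" "a = lex_index p j l"
    by (rule pair_cases)
  have "snd ?l (lex_index (n * p) i a) = snd ?l (lex_index p (lex_index n i j) l)"
    using j by (simp add: lex_index_assoc)
  also have "\<dots> = snd (perm_id n \<boxtimes>\<^sub>\<Sigma> \<zeta>\<^sub>\<Sigma> m p) (lex_index (m * p) j (lex_index p i l))"
    using i j by (simp add: lex_index_assoc[symmetric])
  also have "\<dots> = lex_index m a i"
    using i j by (simp add: lex_index_assoc mult.commute[of p m])
  also have "\<dots> = snd ?r (lex_index (n * p) i a)"
    using i a by simp
  finally show "snd ?l (lex_index (n * p) i a) = snd ?r (lex_index (n * p) i a)" .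
qed (simp_all add: mult.assoc mult.left_commute)

lemma prod_symmetry: "\<zeta>\<^sub>\<Sigma> n m \<cdot>\<^sub>\<Sigma> \<zeta>\<^sub>\<Sigma> m n = perm_id (m * n)"
proof (rule Sigma_eq_pairsI[of _ _ m n])
  fix i j assume "1 \<le> i" "i \<le> m" "1 \<le> j" "j \<le> n"
  then show "snd (\<zeta>\<^sub>\<Sigma> n m \<cdot>\<^sub>\<Sigma> \<zeta>\<^sub>\<Sigma> m n) (lex_index n i j) = snd (perm_id (m * n)) (lex_index n i j)"
    by simp
qed (simp_all add: mult.commute)

lemma prod_hexagon_inv:
  "(\<zeta>\<^sub>\<Sigma> m p \<boxtimes>\<^sub>\<Sigma> perm_id n) \<cdot>\<^sub>\<Sigma> (perm_id m \<boxtimes>\<^sub>\<Sigma> \<zeta>\<^sub>\<Sigma> n p) = \<zeta>\<^sub>\<Sigma> (m * n) p"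
  (is "?l = ?r")
proof -
  let ?s = "\<zeta>\<^sub>\<Sigma> p (m * n)"
  have "?l \<cdot>\<^sub>\<Sigma> ?s = (\<zeta>\<^sub>\<Sigma> m p \<boxtimes>\<^sub>\<Sigma> perm_id n) \<cdot>\<^sub>\<Sigma>
      ((perm_id m \<boxtimes>\<^sub>\<Sigma> \<zeta>\<^sub>\<Sigma> n p) \<cdot>\<^sub>\<Sigma> ((perm_id m \<boxtimes>\<^sub>\<Sigma> \<zeta>\<^sub>\<Sigma> p n)
        \<cdot>\<^sub>\<Sigma> (\<zeta>\<^sub>\<Sigma> p m \<boxtimes>\<^sub>\<Sigma> perm_id n)))"
    by (simp add: prod_hexagon mult.assoc mult.left_commute mult.commute)
  also have "\<dots> = perm_id (p * (m * n))"
    by (simp add: Sig.comp_reduce[OF prod_comp[symmetric]] prod_comp[symmetric] prod_symmetry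
        mult.assoc mult.left_commute mult.commute)
  also have "\<dots> = ?r \<cdot>\<^sub>\<Sigma> ?s" by (simp add: prod_symmetry)
  finally show ?thesis
    by - (rule Sig.iso_cancel_right[OF Sigma_iso[of ?s]], auto)
qed

lemma Sigma_mul_braided: "braided_monoidal_category \<Sigma> (MulM \<Sigma>) (MulBraid \<Sigma>)"
  by unfold_locales
    (auto simp: hom_iff Sigma_iso prod_comp prod_assoc prod_braid_nat mult.assoc mult.commute[of "fst _"]
      prod_hexagon prod_hexagon_inv)

interpretation Sig_mul: braided_monoidal_category \<Sigma> "MulM \<Sigma>" "MulBraid \<Sigma>"
  by (rule Sigma_mul_braided)

text \<open>Arrows out of the sources of \<open>\<delta>\<^sup>l\<close> and \<open>\<delta>\<^sup>r\<close> are compared block by block, because the structure arrows have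
  one formula on each block.\<close>

lemma Sigma_eq_DistLI:
  assumes "f \<in> Arr \<Sigma>" "g \<in> Arr \<Sigma>" "fst f = m * (n + p)" "fst g = m * (n + p)"
    "\<And>i j. 1 \<le> i \<Longrightarrow> i \<le> m \<Longrightarrow> 1 \<le> j \<Longrightarrow> j \<le> n \<Longrightarrow> snd f (lex_index (n + p) i j) = snd g (lex_index (n + p) i j)"
    "\<And>i j. 1 \<le> i \<Longrightarrow> i \<le> m \<Longrightarrow> 1 \<le> j \<Longrightarrow> j \<le> p
      \<Longrightarrow> snd f (lex_index (n + p) i (n + j)) = snd g (lex_index (n + p) i (n + j))"
  shows "f = g"
proof (rule Sigma_eq_pairsI[OF assms(1-4)])
  fix i j assume i: "1 \<le> i" "i \<le> m" and j: "1 \<le> j" "j \<le> n + p"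
  show "snd f (lex_index (n + p) i j) = snd g (lex_index (n + p) i j)"
    by (cases rule: block_cases[OF j]) (use assms(5,6) i j in auto)
qed

lemma Sigma_eq_DistRI:
  assumes "f \<in> Arr \<Sigma>" "g \<in> Arr \<Sigma>" "fst f = (m + n) * p" "fst g = (m + n) * p"
    "\<And>i j. 1 \<le> i \<Longrightarrow> i \<le> m \<Longrightarrow> 1 \<le> j \<Longrightarrow> j \<le> p \<Longrightarrow> snd f (lex_index p i j) = snd g (lex_index p i j)"
    "\<And>i j. 1 \<le> i \<Longrightarrow> i \<le> n \<Longrightarrow> 1 \<le> j \<Longrightarrow> j \<le> p
      \<Longrightarrow> snd f (m * p + lex_index p i j) = snd g (m * p + lex_index p i j)"
  shows "f = g"
proof (rule Sigma_eq_pairsI[OF assms(1-4)])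
  fix i j assume i: "1 \<le> i" "i \<le> m + n" and j: "1 \<le> j" "j \<le> p"
  show "snd f (lex_index p i j) = snd g (lex_index p i j)"
    by (cases rule: block_cases[OF i]) (use assms(5,6) i j in \<open>auto simp: lex_index_add\<close>)
qed

lemma Sigma_DistL_nat:
  assumes [simp]: "f \<in> Arr \<Sigma>" "g \<in> Arr \<Sigma>" "h \<in> Arr \<Sigma>" "fst f = m" "fst g = n" "fst h = p"
  shows "\<delta>\<^sub>\<Sigma> m n p \<cdot>\<^sub>\<Sigma> (f \<boxtimes>\<^sub>\<Sigma> block_sum g h) = block_sum (f \<boxtimes>\<^sub>\<Sigma> g) (f \<boxtimes>\<^sub>\<Sigma> h) \<cdot>\<^sub>\<Sigma> \<delta>\<^sub>\<Sigma> m n p"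
  (is "?l = ?r")
proof (rule Sigma_eq_DistLI[of _ _ m n p])
  fix i j assume "1 \<le> i" "i \<le> m" "1 \<le> j" "j \<le> n"
  with snd_range[of f i] snd_range[of g j]
  show "snd ?l (lex_index (n + p) i j) = snd ?r (lex_index (n + p) i j)" by simp
next
  fix i j assume "1 \<le> i" "i \<le> m" "1 \<le> j" "j \<le> p"
  with snd_range[of f i] snd_range[of h j]
  show "snd ?l (lex_index (n + p) i (n + j)) = snd ?r (lex_index (n + p) i (n + j))" by simp
qed (simp_all add: add_mult_distrib2)

lemma Sigma_DistR_nat:
  assumes [simp]: "f \<in> Arr \<Sigma>" "g \<in> Arr \<Sigma>" "h \<in> Arr \<Sigma>"
  shows "block_sum f g \<boxtimes>\<^sub>\<Sigma> h = block_sum (f \<boxtimes>\<^sub>\<Sigma> h) (g \<boxtimes>\<^sub>\<Sigma> h)" (is "?l = ?r")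
proof (rule Sigma_eq_DistRI[of _ _ "fst f" "fst g" "fst h"])
  fix i j assume "1 \<le> i" "i \<le> fst f" "1 \<le> j" "j \<le> fst h"
  then show "snd ?l (lex_index (fst h) i j) = snd ?r (lex_index (fst h) i j)" by simp
next
  fix i j assume "1 \<le> i" "i \<le> fst g" "1 \<le> j" "j \<le> fst h"
  with snd_range[of g i]
  show "snd ?l (fst f * fst h + lex_index (fst h) i j) = snd ?r (fst f * fst h + lex_index (fst h) i j)"
    by (simp add: lex_index_add[symmetric] del: block_sum_eval(2)) (simp add: lex_index_add)
qed (simp_all add: add_mult_distrib)

lemma Sigma_DistL_braid:
  "\<delta>\<^sub>\<Sigma> m p n \<cdot>\<^sub>\<Sigma> (perm_id m \<boxtimes>\<^sub>\<Sigma> block_swap n p) = block_swap (m * n) (m * p) \<cdot>\<^sub>\<Sigma> \<delta>\<^sub>\<Sigma> m n p"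
  (is "?l = ?r")
proof (rule Sigma_eq_DistLI[of _ _ m n p])
  fix i j assume "1 \<le> i" "i \<le> m" "1 \<le> j" "j \<le> n"
  then show "snd ?l (lex_index (n + p) i j) = snd ?r (lex_index (n + p) i j)" 
    using Sigma_DistL_eval(2)[of i m j n p] by (simp add: add.commute[of p n])
next
  fix i j assume "1 \<le> i" "i \<le> m" "1 \<le> j" "j \<le> p"
  then show "snd ?l (lex_index (n + p) i (n + j)) = snd ?r (lex_index (n + p) i (n + j))"
    using Sigma_prod_eval[of "block_swap n p" "n + p" i "perm_id m" "n + j"] Sigma_DistL_eval(1)[of i m j p n]
    by (simp add: add.commute[of p n])
qed (simp_all add: add_mult_distrib2 add.commute)

lemma Sigma_DistR_braid: "block_swap m n \<boxtimes>\<^sub>\<Sigma> perm_id p = block_swap (m * p) (n * p)" (is "?l = ?r")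
proof (rule Sigma_eq_DistRI[of _ _ m n p])
  fix i j assume "1 \<le> i" "i \<le> m" "1 \<le> j" "j \<le> p"
  then show "snd ?l (lex_index p i j) = snd ?r (lex_index p i j)" by (simp add: lex_index_add)
next
  fix i j assume "1 \<le> i" "i \<le> n" "1 \<le> j" "j \<le> p"
  then show "snd ?l (m * p + lex_index p i j) = snd ?r (m * p + lex_index p i j)"
    using Sigma_prod_eval[of "perm_id p" p "m + i" "block_swap m n" j] by (simp add: lex_index_add)
qed (simp_all add: add_mult_distrib)

lemma Sigma_DistL_sum_assoc:
  "block_sum (\<delta>\<^sub>\<Sigma> m n p) (perm_id (m * q)) \<cdot>\<^sub>\<Sigma> \<delta>\<^sub>\<Sigma> m (n + p) q
    = block_sum (perm_id (m * n)) (\<delta>\<^sub>\<Sigma> m p q) \<cdot>\<^sub>\<Sigma> \<delta>\<^sub>\<Sigma> m n (p + q)"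
  (is "?l = ?r")
proof (rule Sigma_eq_pairsI[of _ _ m "n + p + q"])
  fix i k assume i: "1 \<le> i" "i \<le> m" and k: "1 \<le> k" "k \<le> n + p + q"
  then consider "k \<le> n" | j where "k = n + j" "1 \<le> j" "j \<le> p" | j where "k = n + p + j" "1 \<le> j" "j \<le> q"
    by (metis block_cases)
  then show "snd ?l (lex_index (n + p + q) i k) = snd ?r (lex_index (n + p + q) i k)"
  proof cases
    case 1
    then show ?thesis
      using i k Sigma_DistL_eval(1)[of i m k "n + p" q] Sigma_DistL_eval(1)[of i m k n "p + q"]
        lex_index_le[of i m k "n + p"]
      by (simp add: add.assoc add_mult_distrib2)
  next
    case (2 j)
    then show ?thesis
      using i Sigma_DistL_eval(1)[of i m k "n + p" q] Sigma_DistL_eval(2)[of i m j "p + q" n]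
        lex_index_le[of i m k "n + p"] lex_index_le[of i m j "p + q"]
      by (simp add: add.assoc add_mult_distrib2)
  next
    case (3 j)
    then show ?thesis
      using i lex_index_le[of i m "p + j" "p + q"] Sigma_DistL_eval(2)[of i m j q "n + p"] Sigma_DistL_eval(2)[of i m "p + j" "p + q" n]
        block_sum_eval(2)[of "\<delta>\<^sub>\<Sigma> m n p" "m * (n + p)" "lex_index q i j" "perm_id (m * q)"]
      by (simp add: add.assoc add_mult_distrib2)
  qed
qed (simp_all add: add_mult_distrib2 add.assoc)

lemma Sigma_DistL_prod_assoc:
  "\<delta>\<^sub>\<Sigma> m (n * p) (n * q) \<cdot>\<^sub>\<Sigma> (perm_id m \<boxtimes>\<^sub>\<Sigma> \<delta>\<^sub>\<Sigma> n p q) = \<delta>\<^sub>\<Sigma> (m * n) p q" (is "?l = ?r")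
proof (rule Sigma_eq_DistLI[of _ _ "m * n" p q])
  fix a k assume a: "1 \<le> a" "a \<le> m * n" and k: "1 \<le> k" "k \<le> p"
  from a obtain i j where "1 \<le> i" "i \<le> m" "1 \<le> j" "j \<le> n" "a = lex_index n i j"
    by (rule pair_cases)
  then have "snd (perm_id m \<boxtimes>\<^sub>\<Sigma> \<delta>\<^sub>\<Sigma> n p q) (lex_index (p + q) a k) = lex_index (n * p + n * q) i (lex_index p j k)"
      "snd (\<delta>\<^sub>\<Sigma> m (n * p) (n * q)) (lex_index (n * p + n * q) i (lex_index p j k)) = lex_index p a k"
    using k Sigma_prod_eval[of "\<delta>\<^sub>\<Sigma> n p q" "n * (p + q)" i "perm_id m" "lex_index (p + q) j k"]
    by (simp add: lex_index_assoc flip: add_mult_distrib2, simp add: lex_index_assoc)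
  then show "snd ?l (lex_index (p + q) a k) = snd ?r (lex_index (p + q) a k)"
    using k a by simp
next
  fix a k assume a: "1 \<le> a" "a \<le> m * n" and k: "1 \<le> k" "k \<le> q"
  from a obtain i j where "1 \<le> i" "i \<le> m" "1 \<le> j" "j \<le> n" "a = lex_index n i j"
    by (rule pair_cases)
  then have "snd (perm_id m \<boxtimes>\<^sub>\<Sigma> \<delta>\<^sub>\<Sigma> n p q) (lex_index (p + q) a (p + k))
        = lex_index (n * p + n * q) i (n * p + lex_index q j k)"
      "snd (\<delta>\<^sub>\<Sigma> m (n * p) (n * q)) (lex_index (n * p + n * q) i (n * p + lex_index q j k)) = m * n * p + lex_index q a k"
    using k Sigma_prod_eval[of "\<delta>\<^sub>\<Sigma> n p q" "n * (p + q)" i "perm_id m" "lex_index (p + q) j (p + k)"]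
    by (simp add: lex_index_assoc flip: add_mult_distrib2, simp add: lex_index_assoc mult.assoc)
  then show "snd ?l (lex_index (p + q) a (p + k)) = snd ?r (lex_index (p + q) a (p + k))"
    using k a by simp
qed (simp_all add: add_mult_distrib2 mult.assoc)

lemma Sigma_DistLR_prod_assoc: "\<delta>\<^sub>\<Sigma> m n p \<boxtimes>\<^sub>\<Sigma> perm_id q = \<delta>\<^sub>\<Sigma> m (n * q) (p * q)" (is "?l = ?r")
proof (rule Sigma_eq_pairsI[of _ _ "m * (n + p)" q])
  fix a k assume a: "1 \<le> a" "a \<le> m * (n + p)" and k: "1 \<le> k" "k \<le> q"
  from a obtain i b where i: "1 \<le> i" "i \<le> m" and b: "1 \<le> b" "b \<le> n + p" "a = lex_index (n + p) i b"
    by (rule pair_cases)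
  have "snd ?r (lex_index q a k) = snd ?r (lex_index (n * q + p * q) i (lex_index q b k))"
    using b by (simp add: lex_index_assoc add_mult_distrib)
  also have "\<dots> = lex_index q (snd (\<delta>\<^sub>\<Sigma> m n p) a) k"
  proof (cases rule: block_cases[OF b(1,2)])
    case 1
    then show ?thesis using i b k by (simp add: lex_index_assoc)
  next
    case (2 j)
    then show ?thesis using i b k by (simp add: lex_index_assoc lex_index_add mult.assoc)
  qed
  also have "\<dots> = snd ?l (lex_index q a k)"
    using a k by simp
  finally show "snd ?l (lex_index q a k) = snd ?r (lex_index q a k)" ..
qed (simp_all add: add_mult_distrib2 add_mult_distrib mult.assoc)

lemma Sigma_mid_exchange: "\<mu>\<^bsub>\<Sigma>\<^esub> m n p q = block_sum (perm_id m) (block_sum (block_swap n p) (perm_id q))"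
  by (simp add: mid_exchange_def add.assoc add.left_commute)

lemma Sigma_DistLR_exchange:
  "\<mu>\<^bsub>\<Sigma>\<^esub> (m * p) (m * q) (n * p) (n * q) \<cdot>\<^sub>\<Sigma> block_sum (\<delta>\<^sub>\<Sigma> m p q) (\<delta>\<^sub>\<Sigma> n p q) = \<delta>\<^sub>\<Sigma> (m + n) p q"
  (is "?l = ?r")
proof (rule Sigma_eq_DistRI[of _ _ m n "p + q"])
  let ?u = "block_sum (block_swap (m * q) (n * p)) (perm_id (n * q))"
  fix i j assume i: "1 \<le> i" "i \<le> m" and j: "1 \<le> j" "j \<le> p + q"
  show "snd ?l (lex_index (p + q) i j) = snd ?r (lex_index (p + q) i j)"
  proof (cases rule: block_cases[OF j])
    case 1
    then show ?thesis using i j by (simp add: Sigma_mid_exchange)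
  next
    case (2 k)
    then show ?thesis using i
      block_sum_eval(2)[of "perm_id (m * p)" "m * p" "lex_index q i k" ?u]
      by (simp add: Sigma_mid_exchange add_mult_distrib trans_le_add1)
  qed
next
  let ?u = "block_sum (block_swap (m * q) (n * p)) (perm_id (n * q))"
  fix i j assume i: "1 \<le> i" "i \<le> n" and j: "1 \<le> j" "j \<le> p + q"
  have *: "snd (block_sum (\<delta>\<^sub>\<Sigma> m p q) (\<delta>\<^sub>\<Sigma> n p q)) (m * (p + q) + lex_index (p + q) i j)
    = m * (p + q) + snd (\<delta>\<^sub>\<Sigma> n p q) (lex_index (p + q) i j)"
    using i j by simp
  show "snd ?l (m * (p + q) + lex_index (p + q) i j) = snd ?r (m * (p + q) + lex_index (p + q) i j)"
  proof (cases rule: block_cases[OF j])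
    case 1
    then show ?thesis using i j * Sigma_DistL_eval(1)[of "m + i" "m + n" j p q]
      block_sum_eval(2)[of "perm_id (m * p)" "m * p" "m * q + lex_index p i j" ?u]
      by (simp add: Sigma_mid_exchange add_mult_distrib add_mult_distrib2 lex_index_add add.assoc trans_le_add1 trans_le_add2)
  next
    case (2 k)
    then show ?thesis using i j * Sigma_DistL_eval(2)[of "m + i" "m + n" k q p]
      block_sum_eval(2)[of "perm_id (m * p)" "m * p" "m * q + (n * p + lex_index q i k)" ?u]
      block_sum_eval(2)[of "block_swap (m * q) (n * p)" "m * q + n * p" "lex_index q i k" "perm_id (n * q)"]
      by (simp add: Sigma_mid_exchange add_mult_distrib add_mult_distrib2 lex_index_add add.assoc add.left_commute trans_le_add1 trans_le_add2)
  qed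
qed (simp_all add: add_mult_distrib2 add_mult_distrib Sigma_mid_exchange)

lemma Sigma_DistL_ident [simp]:
  "\<delta>\<^sub>\<Sigma> m 0 n = perm_id (m * n)" "\<delta>\<^sub>\<Sigma> m n 0 = perm_id (m * n)" "\<delta>\<^sub>\<Sigma> (Suc 0) m n = perm_id (m + n)"
proof -
  have "snd (\<delta>\<^sub>\<Sigma> m 0 n) (lex_index n i j) = lex_index n i j" if "1 \<le> i" "i \<le> m" "1 \<le> j" "j \<le> n" for i j
    using Sigma_DistL_eval(2)[OF that, of 0] by simp
  then show "\<delta>\<^sub>\<Sigma> m 0 n = perm_id (m * n)"
    by (intro Sigma_eq_pairsI[of _ _ m n]) simp_all
  have "snd (\<delta>\<^sub>\<Sigma> m n 0) (lex_index n i j) = lex_index n i j" if "1 \<le> i" "i \<le> m" "1 \<le> j" "j \<le> n" for i j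
    using Sigma_DistL_eval(1)[OF that, of 0] by simp
  then show "\<delta>\<^sub>\<Sigma> m n 0 = perm_id (m * n)"
    by (intro Sigma_eq_pairsI[of _ _ m n]) simp_all
  show "\<delta>\<^sub>\<Sigma> (Suc 0) m n = perm_id (m + n)"
  proof (rule Sigma_eqI[of _ _ "m + n"])
    fix k assume k: "1 \<le> k" "k \<le> m + n"
    then show "snd (\<delta>\<^sub>\<Sigma> (Suc 0) m n) k = snd (perm_id (m + n)) k"
      using Sigma_DistL_eval(1)[of "Suc 0" "Suc 0" _ m n] Sigma_DistL_eval(2)[of "Suc 0" "Suc 0" _ n m]
      by (cases rule: block_cases[OF k]) (auto simp: lex_index_unit)
  qed simp_all
qed

lemma Sigma_DistL_MulBraid:
  "\<delta>\<^sub>\<Sigma> p m n \<cdot>\<^sub>\<Sigma> \<zeta>\<^sub>\<Sigma> (m + n) p = block_sum (\<zeta>\<^sub>\<Sigma> m p) (\<zeta>\<^sub>\<Sigma> n p)" (is "?l = ?r")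
proof (rule Sigma_eq_DistRI[of _ _ m n p])
  fix i j assume "1 \<le> i" "i \<le> m" "1 \<le> j" "j \<le> p"
  then show "snd ?l (lex_index p i j) = snd ?r (lex_index p i j)" by simp
next
  fix i j assume "1 \<le> i" "i \<le> n" "1 \<le> j" "j \<le> p"
  then show "snd ?l (m * p + lex_index p i j) = snd ?r (m * p + lex_index p i j)"
    using Sigma_braid_eval[of "m + i" "m + n" j p] by (simp add: lex_index_add mult.commute)
qed (simp_all add: add_mult_distrib add_mult_distrib2 mult.commute)

lemma Sigma_DistR_MulBraid:
  "\<zeta>\<^sub>\<Sigma> m (n + p) = block_sum (\<zeta>\<^sub>\<Sigma> m n) (\<zeta>\<^sub>\<Sigma> m p) \<cdot>\<^sub>\<Sigma> \<delta>\<^sub>\<Sigma> m n p" (is "?l = ?r")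
proof (rule Sigma_eq_DistLI[of _ _ m n p])
  fix i j assume "1 \<le> i" "i \<le> m" "1 \<le> j" "j \<le> n"
  then show "snd ?l (lex_index (n + p) i j) = snd ?r (lex_index (n + p) i j)" by simp
next
  fix i j assume "1 \<le> i" "i \<le> m" "1 \<le> j" "j \<le> p"
  then show "snd ?l (lex_index (n + p) i (n + j)) = snd ?r (lex_index (n + p) i (n + j))"
    by (simp add: lex_index_add mult.commute)
qed (simp_all add: add_mult_distrib2)

lemma Sigma_zero_simps [simp]:
  "f \<in> Arr \<Sigma> \<Longrightarrow> perm_id 0 \<boxtimes>\<^sub>\<Sigma> f = perm_id 0" "f \<in> Arr \<Sigma> \<Longrightarrow> f \<boxtimes>\<^sub>\<Sigma> perm_id 0 = perm_id 0"
  "\<delta>\<^sub>\<Sigma> 0 m n = perm_id 0"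
  by (rule Sigma_size_zero; simp)+

lemma Sigma_bimonoidal: "bimonoidal_category \<Sigma>"
  by unfold_locales
    (simp_all add: hom_iff Sigma_iso Sigma_mono Sigma_DistL_nat Sigma_DistR_nat Sigma_DistL_braid Sigma_DistR_braid
      Sigma_DistL_sum_assoc Sigma_DistL_prod_assoc Sigma_DistLR_prod_assoc Sigma_DistLR_exchange
      add_mult_distrib add_mult_distrib2 mult.assoc, simp_all add: add.assoc)

lemma Sigma_braided_bimonoidal: "braided_bimonoidal_category \<Sigma>"
proof (rule braided_bimonoidal_category.intro[OF Sigma_bimonoidal Sigma_mul_braided], unfold_locales)
  fix m n p
  show "\<delta>\<^sub>\<Sigma> p m n \<cdot>\<^sub>\<Sigma> \<zeta>\<^sub>\<Sigma> (m \<oplus>\<^bsub>\<Sigma>\<^esub> n) p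
    = (\<zeta>\<^sub>\<Sigma> m p \<boxplus>\<^bsub>\<Sigma>\<^esub> \<zeta>\<^sub>\<Sigma> n p) \<cdot>\<^sub>\<Sigma> \<delta>\<^sup>r\<^bsub>\<Sigma>\<^esub> m n p"
    using Sigma_DistL_MulBraid[of p m n] by (simp add: add_mult_distrib)
  show "\<delta>\<^sup>r\<^bsub>\<Sigma>\<^esub> n p m \<cdot>\<^sub>\<Sigma> \<zeta>\<^sub>\<Sigma> m (n \<oplus>\<^bsub>\<Sigma>\<^esub> p)
    = (\<zeta>\<^sub>\<Sigma> m n \<boxplus>\<^bsub>\<Sigma>\<^esub> \<zeta>\<^sub>\<Sigma> m p) \<cdot>\<^sub>\<Sigma> \<delta>\<^sub>\<Sigma> m n p"
    using Sigma_DistR_MulBraid[of m n p, symmetric] by (simp add: mult.commute)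
  show "\<lambda>\<^sup>\<bullet>\<^bsub>\<Sigma>\<^esub> m \<cdot>\<^sub>\<Sigma> \<zeta>\<^sub>\<Sigma> m \<zero>\<^bsub>\<Sigma>\<^esub> = \<rho>\<^sup>\<bullet>\<^bsub>\<Sigma>\<^esub> m" "\<rho>\<^sup>\<bullet>\<^bsub>\<Sigma>\<^esub> m \<cdot>\<^sub>\<Sigma> \<zeta>\<^sub>\<Sigma> \<zero>\<^bsub>\<Sigma>\<^esub> m = \<lambda>\<^sup>\<bullet>\<^bsub>\<Sigma>\<^esub> m"
    by (rule Sigma_size_zero; simp)+
qed

text \<open>In a groupoid every arrow is a monomorphism, in particular every arrow of \<open>dist_closure\<close>.\<close>

theorem Sigma_flat: "flat_braided_bimonoidal_category \<Sigma>"
proof -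
  interpret braided_bimonoidal_category \<Sigma> by (rule Sigma_braided_bimonoidal)
  have arr: "f \<in> Arr \<Sigma>" if "f \<in> dist_closure \<Sigma>" for f
    using that by (induction rule: dist_closure.induct) simp_all
  show ?thesis
    by unfold_locales (rule Sigma_mono[OF arr])
qed

section \<open>The symmetric monoidal functor of powers\<close>

context monoidal_category
begin

lemma pentagon_inv:
  assumes [simp]: "A \<in> Obj \<C>" "B \<in> Obj \<C>" "C \<in> Obj \<C>" "D \<in> Obj \<C>"
  shows "assoc_inv A (B \<diamondop> C) D \<cdot> ((\<i> A \<ast> assoc_inv B C D) \<cdot> assoc M A B (C \<diamondop> D))
    = (assoc M A B C \<ast> \<i> D) \<cdot> assoc_inv (A \<diamondop> B) C D" (is "?l = ?r")
proof (rule iso_cancel_right[OF assoc_iso[of "A \<diamondop> B" C D]])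
  show "?l \<cdot> assoc M (A \<diamondop> B) C D = ?r \<cdot> assoc M (A \<diamondop> B) C D"
    by (simp add: pentagon)
qed auto

lemma pentagon_assoc_inv:
  assumes [simp]: "A \<in> Obj \<C>" "B \<in> Obj \<C>" "C \<in> Obj \<C>" "D \<in> Obj \<C>"
  shows "assoc M (A \<diamondop> B) C D \<cdot> ((assoc_inv A B C \<ast> \<i> D) \<cdot> assoc_inv A (B \<diamondop> C) D)
    = assoc_inv A B (C \<diamondop> D) \<cdot> (\<i> A \<ast> assoc M B C D)" (is "?a \<cdot> ?x = ?r")
proof (rule iso_cancel_left[OF assoc_iso[of A B "C \<diamondop> D"]])
  have "assoc M A B (C \<diamondop> D) \<cdot> (?a \<cdot> ?x) = (assoc M A B (C \<diamondop> D) \<cdot> ?a) \<cdot> ?x"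
    by simp
  also have "\<dots> = \<i> A \<ast> assoc M B C D"
    by (subst pentagon) simp_all
  finally show "assoc M A B (C \<diamondop> D) \<cdot> (?a \<cdot> ?x) = assoc M A B (C \<diamondop> D) \<cdot> ?r"
    by simp
qed auto

end

context symmetric_monoidal_category
begin

lemma twist_tensor:
  assumes [simp]: "U \<in> Obj \<C>" "A \<in> Obj \<C>" "B \<in> Obj \<C>"
  shows "twist U (A \<diamondop> B) \<cdot> ((assoc_inv A B U \<ast> \<i> U) \<cdot> assoc_inv A (B \<diamondop> U) U)
    = ((assoc_inv A B U \<ast> \<i> U) \<cdot> assoc_inv A (B \<diamondop> U) U) \<cdot> (\<i> A \<ast> twist U B)"
proof (rule iso_cancel_left[OF assoc_iso[of "A \<diamondop> B" U U]])
  let ?g = "(assoc_inv A B U \<ast> \<i> U) \<cdot> assoc_inv A (B \<diamondop> U) U"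
  have "assoc M (A \<diamondop> B) U U \<cdot> (twist U (A \<diamondop> B) \<cdot> ?g)
      = (\<i> A \<ast> \<i> B \<ast> \<zeta> U U) \<cdot> (assoc_inv A B (U \<diamondop> U) \<cdot> (\<i> A \<ast> assoc M B U U))"
    by (simp add: twist_def pentagon_assoc_inv)
  also have "\<dots> = assoc_inv A B (U \<diamondop> U) \<cdot> (\<i> A \<ast> ((\<i> B \<ast> \<zeta> U U) \<cdot> assoc M B U U))"
    by (simp add: comp_reduce[OF assoc_inv_nat[of "\<i> A" "\<i> B" "\<zeta> U U", symmetric, simplified]])
  also have "\<dots> = (assoc M (A \<diamondop> B) U U \<cdot> ?g) \<cdot> (\<i> A \<ast> twist U B)"
    by (subst pentagon_assoc_inv) (simp_all add: twist_def)
  finally show "assoc M (A \<diamondop> B) U U \<cdot> (twist U (A \<diamondop> B) \<cdot> ?g) = assoc M (A \<diamondop> B) U U \<cdot> (?g \<cdot> (\<i> A \<ast> twist U B))"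
    by simp
qed auto

end

context object_powers
begin

text \<open>The reassociation \<open>pw m \<diamondop> pw n \<rightarrow> pw (m + n)\<close>, moving the factors of \<open>pw n\<close> across one at a time.\<close>

primrec cmb :: "nat \<Rightarrow> nat \<Rightarrow> 'b" where
  "cmb m 0 = runit M (pw m)"
| "cmb m (Suc n) = (cmb m n \<ast> \<i> U) \<cdot> assoc_inv (pw m) (pw n) U"

lemma cmb_simps [simp]:
  "cmb m n \<in> Arr \<C>" "Dom \<C> (cmb m n) = pw m \<diamondop> pw n" "Cod \<C> (cmb m n) = pw (m + n)"
  by (induction n) auto

lemma cmb_iso: "is_iso \<C> (cmb m n)"
  by (induction n) (auto intro!: is_iso_comp is_iso_tensor is_iso_inv assoc_iso is_iso_ident runit_iso)

lemma cmb_assoc: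
  "cmb (l + m) n \<cdot> (cmb l m \<ast> \<i> (pw n))
    = cmb l (m + n) \<cdot> ((\<i> (pw l) \<ast> cmb m n) \<cdot> assoc M (pw l) (pw m) (pw n))"
proof (induction n)
  case 0
  show ?case by (simp add: runit_tensor nat_simps)
next
  case (Suc n)
  have "cmb (l + m) (Suc n) \<cdot> (cmb l m \<ast> \<i> (pw (Suc n)))
      = ((cmb (l + m) n \<cdot> (cmb l m \<ast> \<i> (pw n))) \<ast> \<i> U) \<cdot> assoc_inv (pw l \<diamondop> pw m) (pw n) U"
    using assoc_inv_nat[of "cmb l m" "\<i> (pw n)" "\<i> U", OF _ _ _ refl refl refl] by simp
  also have "\<dots> = ((cmb l (m + n) \<cdot> (\<i> (pw l) \<ast> cmb m n)) \<ast> \<i> U) \<cdot>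
      ((assoc M (pw l) (pw m) (pw n) \<ast> \<i> U) \<cdot> assoc_inv (pw l \<diamondop> pw m) (pw n) U)"
    by (simp add: Suc.IH add.assoc)
  also have "\<dots> = ((cmb l (m + n) \<cdot> (\<i> (pw l) \<ast> cmb m n)) \<ast> \<i> U) \<cdot>
      (assoc_inv (pw l) (pw m \<diamondop> pw n) U \<cdot>
        ((\<i> (pw l) \<ast> assoc_inv (pw m) (pw n) U) \<cdot> assoc M (pw l) (pw m) (pw n \<diamondop> U)))"
    by (simp add: pentagon_inv)
  also have "\<dots> = cmb l (m + Suc n) \<cdot> ((\<i> (pw l) \<ast> cmb m (Suc n)) \<cdot> assoc M (pw l) (pw m) (pw (Suc n)))"
    using assoc_inv_nat[of "\<i> (pw l)" "cmb m n" "\<i> U", THEN comp_reduce,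
        of "pw l" "pw (m + n)" U "(\<i> (pw l) \<ast> assoc_inv (pw m) (pw n) U) \<cdot> assoc M (pw l) (pw m) (pw n \<diamondop> U)"]
    by (simp add: add.assoc)
  finally show ?case .
qed

lemma cmb_lunit: "cmb 0 n = lunit M (pw n)"
proof (induction n)
  case (Suc n)
  have "lunit M (pw n \<diamondop> U) = (lunit M (pw n \<diamondop> U) \<cdot> assoc M \<u> (pw n) U) \<cdot> assoc_inv \<u> (pw n) U"
    by simp
  then show ?case by (simp add: Suc.IH lunit_tensor)
qed (simp add: lunit_unit)

lemma cmb_act_left:
  assumes "\<sigma> permutes {1..m}"
  shows "act (m + n) \<sigma> \<cdot> cmb m n = cmb m n \<cdot> (act m \<sigma> \<ast> \<i> (pw n))"
proof (induction n)
  case (Suc n)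
  have "\<sigma> permutes {1..m + n}"
    using assms by (rule permutes_subset) auto
  then have "act (m + Suc n) \<sigma> = act (m + n) \<sigma> \<ast> \<i> U"
    using act_Suc by simp
  then have "act (m + Suc n) \<sigma> \<cdot> cmb m (Suc n) = ((act (m + n) \<sigma> \<cdot> cmb m n) \<ast> \<i> U) \<cdot> assoc_inv (pw m) (pw n) U"
    by (simp del: act.simps)
  also have "\<dots> = cmb m (Suc n) \<cdot> (act m \<sigma> \<ast> \<i> (pw (Suc n)))"
    using assoc_inv_nat[of "act m \<sigma>" "\<i> (pw n)" "\<i> U", OF _ _ _ refl refl refl] by (simp add: Suc.IH)
  finally show "act (m + Suc n) \<sigma> \<cdot> cmb m (Suc n) = cmb m (Suc n) \<cdot> (act m \<sigma> \<ast> \<i> (pw (Suc n)))" .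
qed (simp add: nat_simps)

text \<open>For the last two factors this is \<open>twist_tensor\<close>, hence the pentagon; a generator further to the left
  commutes with the last reassociation by naturality.\<close>

lemma cmb_gen: "1 \<le> i \<Longrightarrow> i < n \<Longrightarrow> gen (m + n) (m + i) \<cdot> cmb m n = cmb m n \<cdot> (\<i> (pw m) \<ast> gen n i)"
proof (induction n)
  case (Suc n)
  show ?case
  proof (cases "i = n")
    case True
    with Suc.prems obtain p where n: "n = Suc p" by (cases n) auto
    let ?g = "(assoc_inv (pw m) (pw p) U \<ast> \<i> U) \<cdot> assoc_inv (pw m) (pw p \<diamondop> U) U"
    have cmb: "cmb m (Suc n) = (cmb m p \<ast> \<i> U \<ast> \<i> U) \<cdot> ?g"
      by (simp add: n)
    have "gen (m + Suc n) (m + i) \<cdot> cmb m (Suc n) = (tw (m + p) \<cdot> (cmb m p \<ast> \<i> U \<ast> \<i> U)) \<cdot> ?g"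
      using True by (simp add: n)
    also have "\<dots> = (cmb m p \<ast> \<i> U \<ast> \<i> U) \<cdot> (twist U (pw m \<diamondop> pw p) \<cdot> ?g)"
      using twist_nat[of U "cmb m p"] by simp
    also have "\<dots> = (cmb m p \<ast> \<i> U \<ast> \<i> U) \<cdot> (?g \<cdot> (\<i> (pw m) \<ast> tw p))"
      by (simp only: twist_tensor pw_Obj U_Obj)
    also have "\<dots> = cmb m (Suc n) \<cdot> (\<i> (pw m) \<ast> gen (Suc n) i)"
      using True by (simp add: n)
    finally show ?thesis .
  next
    case False
    with Suc have "i < n" and IH: "gen (m + n) (m + i) \<cdot> cmb m n = cmb m n \<cdot> (\<i> (pw m) \<ast> gen n i)" by auto
    then have "gen (m + Suc n) (m + i) \<cdot> cmb m (Suc n)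
        = ((gen (m + n) (m + i) \<cdot> cmb m n) \<ast> \<i> U) \<cdot> assoc_inv (pw m) (pw n) U"
      by (simp add: gen_below)
    also have "\<dots> = cmb m (Suc n) \<cdot> (\<i> (pw m) \<ast> gen (Suc n) i)"
      using assoc_inv_nat[of "\<i> (pw m)" "gen n i" "\<i> U", OF _ _ _ refl refl refl] \<open>i < n\<close> by (simp add: IH gen_below)
    finally show ?thesis .
  qed
qed simp

lemma shift_adj: "1 \<le> i \<Longrightarrow> shift m (adj i \<circ> \<tau>) = adj (m + i) \<circ> shift m \<tau>"
  by (auto simp: shift_def transpose_def fun_eq_iff)

lemma cmb_act_right:
  assumes "\<tau> permutes {1..n}"
  shows "act (m + n) (shift m \<tau>) \<cdot> cmb m n = cmb m n \<cdot> (\<i> (pw m) \<ast> act n \<tau>)"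
  using assms
proof (induction rule: permutes_adj_induct)
  case id
  have "shift m id = id" by (auto simp: shift_def)
  then have "act (m + n) (shift m id) \<cdot> cmb m n = cmb m n \<cdot> (\<i> (pw m) \<ast> act n id)" by simp
  then show ?case by (simp add: id_def)
next
  case (adj i \<tau>)
  have IH: "act (m + n) (shift m \<tau>) \<cdot> cmb m n = cmb m n \<cdot> (\<i> (pw m) \<ast> act n \<tau>)"
    by (rule adj.IH)
  have i: "1 \<le> m + i" "m + i < m + n" using adj.hyps by auto
  have "act (m + n) (shift m (adj i \<circ> \<tau>)) \<cdot> cmb m n
      = gen (m + n) (m + i) \<cdot> (act (m + n) (shift m \<tau>) \<cdot> cmb m n)"
    using act_adj[OF shift_permutes[OF adj.hyps(3)] i] shift_adj[OF adj.hyps(1)] by simp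
  also have "\<dots> = cmb m n \<cdot> ((\<i> (pw m) \<ast> gen n i) \<cdot> (\<i> (pw m) \<ast> act n \<tau>))"
    unfolding IH using comp_reduce[OF cmb_gen[OF adj.hyps(1,2)]] by simp
  also have "\<dots> = cmb m n \<cdot> (\<i> (pw m) \<ast> act n (adj i \<circ> \<tau>))"
    using act_adj[OF adj.hyps(3,1,2)] by simp
  finally show "act (m + n) (shift m (adj i \<circ> \<tau>)) \<cdot> cmb m n = cmb m n \<cdot> (\<i> (pw m) \<ast> act n (adj i \<circ> \<tau>))" .
qed

definition pact :: "perm_arr \<Rightarrow> 'b" where
  "pact f = act (fst f) (snd f)"

lemma pact_simps [simp]: "pact f \<in> Arr \<C>" "Dom \<C> (pact f) = pw (fst f)" "Cod \<C> (pact f) = pw (fst f)"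
  "pact (perm_id n) = \<i> (pw n)"
  by (simp_all add: pact_def)

lemma pact_comp:
  assumes "f \<in> Arr \<Sigma>" "g \<in> Arr \<Sigma>" "fst g = fst f"
  shows "pact (g \<cdot>\<^sub>\<Sigma> f) = pact g \<cdot> pact f"
  using assms act_comp[of "snd g" "fst f" "snd f"] unfolding pact_def Sigma_Arr_iff
  by (simp add: Sigma_prime_def)

lemma pact_sum:
  assumes f: "f \<in> Arr \<Sigma>" and g: "g \<in> Arr \<Sigma>" and m: "fst f = m" and n: "fst g = n"
  shows "pact (block_sum f g) \<cdot> cmb m n = cmb m n \<cdot> (pact f \<ast> pact g)"
proof -
  have perm: "snd f permutes {1..m}" "snd g permutes {1..n}"
    using assms by (simp_all add: Sigma_Arr_iff)
  have "pact (block_sum f g) = act (m + n) (shift m (snd g)) \<cdot> act (m + n) (snd f)"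
    unfolding pact_def using f g m n block_sum_shift[of f g] shift_permutes[OF perm(2), of m]
      permutes_subset[OF perm(1), of "{1..m + n}"] act_comp[of "shift m (snd g)" "m + n" "snd f"]
    by (simp add: Sigma_Arr_iff)
  then have "pact (block_sum f g) \<cdot> cmb m n = act (m + n) (shift m (snd g)) \<cdot> (act (m + n) (snd f) \<cdot> cmb m n)"
    by simp
  also have "\<dots> = (act (m + n) (shift m (snd g)) \<cdot> cmb m n) \<cdot> (act m (snd f) \<ast> \<i> (pw n))"
    by (simp add: cmb_act_left[OF perm(1)])
  also have "\<dots> = cmb m n \<cdot> (pact f \<ast> pact g)"
    by (simp add: cmb_act_right[OF perm(2)] pact_def m n)
  finally show ?thesis .
qed

lemma pact_sum_comp:
  assumes "f \<in> Arr \<Sigma>" "g \<in> Arr \<Sigma>" "fst f = m" "fst g = n" "x \<in> Arr \<C>" "Cod \<C> x = pw m \<diamondop> pw n"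
  shows "pact (block_sum f g) \<cdot> (cmb m n \<cdot> x) = cmb m n \<cdot> ((pact f \<ast> pact g) \<cdot> x)"
  using comp_reduce[OF pact_sum[OF assms(1-4)], of x] assms by simp

text \<open>That the block swap acts as the braiding is, by the hexagon, closed under sums in the second
  argument, and by symmetry under exchanging the arguments; so only \<open>(1, 1)\<close> needs a calculation.\<close>

definition swap_braids :: "nat \<Rightarrow> nat \<Rightarrow> bool" where
  "swap_braids m n \<longleftrightarrow> pact (block_swap m n) \<cdot> cmb m n = cmb n m \<cdot> \<zeta> (pw m) (pw n)"

lemma swap_braids_zero: "swap_braids m 0"
  by (simp add: swap_braids_def cmb_lunit braid_runit)

lemma swap_braids_sym:
  assumes "swap_braids m n"
  shows "swap_braids n m"
proof -
  have "pact (block_swap n m) \<cdot> cmb n m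
      = pact (block_swap n m) \<cdot> ((cmb n m \<cdot> \<zeta> (pw m) (pw n)) \<cdot> \<zeta> (pw n) (pw m))"
    by simp
  also have "\<dots> = pact (block_swap n m) \<cdot> ((pact (block_swap m n) \<cdot> cmb m n) \<cdot> \<zeta> (pw n) (pw m))"
    by (simp only: assms[unfolded swap_braids_def])
  also have "\<dots> = (pact (block_swap n m) \<cdot> pact (block_swap m n)) \<cdot> (cmb m n \<cdot> \<zeta> (pw n) (pw m))"
    by (simp add: add.commute)
  also have "pact (block_swap n m) \<cdot> pact (block_swap m n) = \<i> (pw (m + n))"
    using pact_comp[of "block_swap m n" "block_swap n m"] by (simp add: block_swap_symmetry)
  finally show ?thesis by (simp add: swap_braids_def)
qed

lemma swap_braids_add:
  assumes mn: "swap_braids m n" and mp: "swap_braids m p"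
  shows "swap_braids m (n + p)"
proof -
  let ?t = "(\<i> (pw m) \<ast> cmb n p) \<cdot> assoc M (pw m) (pw n) (pw p)"
  have t_iso: "is_iso \<C> ?t"
    by (intro is_iso_comp is_iso_tensor is_iso_ident assoc_iso cmb_iso) auto
  have swap: "pact (block_swap m (n + p))
      = pact (block_sum (perm_id n) (block_swap m p)) \<cdot> pact (block_sum (block_swap m n) (perm_id p))"
    using pact_comp[of "block_sum (block_swap m n) (perm_id p)" "block_sum (perm_id n) (block_swap m p)"]
    by (simp add: block_swap_hexagon add.assoc add.left_commute)
  have "pact (block_swap m (n + p)) \<cdot> (cmb m (n + p) \<cdot> ?t)
      = pact (block_sum (perm_id n) (block_swap m p)) \<cdot>
        (pact (block_sum (block_swap m n) (perm_id p)) \<cdot> (cmb (m + n) p \<cdot> (cmb m n \<ast> \<i> (pw p))))"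
    using cmb_assoc[of m n p] by (simp add: swap add.assoc add.left_commute)
  also have "\<dots> = pact (block_sum (perm_id n) (block_swap m p)) \<cdot>
        (cmb (n + m) p \<cdot> ((pact (block_swap m n) \<cdot> cmb m n) \<ast> \<i> (pw p)))"
    using pact_sum_comp[of "block_swap m n" "perm_id p" "m + n" p "cmb m n \<ast> \<i> (pw p)"]
    by (simp add: add.commute)
  also have "\<dots> = pact (block_sum (perm_id n) (block_swap m p)) \<cdot>
        ((cmb (n + m) p \<cdot> (cmb n m \<ast> \<i> (pw p))) \<cdot> (\<zeta> (pw m) (pw n) \<ast> \<i> (pw p)))"
    using mn by (simp add: swap_braids_def)
  also have "\<dots> = pact (block_sum (perm_id n) (block_swap m p)) \<cdot>
        (cmb n (m + p) \<cdot> ((\<i> (pw n) \<ast> cmb m p) \<cdot> (assoc M (pw n) (pw m) (pw p) \<cdot> (\<zeta> (pw m) (pw n) \<ast> \<i> (pw p)))))"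
    unfolding cmb_assoc by (simp add: add.assoc)
  also have "\<dots> = cmb n (p + m) \<cdot> ((\<i> (pw n) \<ast> (pact (block_swap m p) \<cdot> cmb m p)) \<cdot>
        (assoc M (pw n) (pw m) (pw p) \<cdot> (\<zeta> (pw m) (pw n) \<ast> \<i> (pw p))))"
    using pact_sum_comp[of "perm_id n" "block_swap m p" n "m + p"
        "(\<i> (pw n) \<ast> cmb m p) \<cdot> (assoc M (pw n) (pw m) (pw p) \<cdot> (\<zeta> (pw m) (pw n) \<ast> \<i> (pw p)))"]
    by (simp add: add.commute)
  also have "\<dots> = cmb n (p + m) \<cdot> ((\<i> (pw n) \<ast> cmb p m) \<cdot> ((\<i> (pw n) \<ast> \<zeta> (pw m) (pw p)) \<cdot>
        (assoc M (pw n) (pw m) (pw p) \<cdot> (\<zeta> (pw m) (pw n) \<ast> \<i> (pw p)))))"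
    using mp by (simp add: swap_braids_def)
  also have "\<dots> = cmb n (p + m) \<cdot> ((\<i> (pw n) \<ast> cmb p m) \<cdot> (assoc M (pw n) (pw p) (pw m) \<cdot>
        (\<zeta> (pw m) (pw n \<diamondop> pw p) \<cdot> assoc M (pw m) (pw n) (pw p))))"
    using hexagon[of "pw m" "pw n" "pw p"] by simp
  also have "\<dots> = (cmb n (p + m) \<cdot> ((\<i> (pw n) \<ast> cmb p m) \<cdot> assoc M (pw n) (pw p) (pw m))) \<cdot>
        (\<zeta> (pw m) (pw n \<diamondop> pw p) \<cdot> assoc M (pw m) (pw n) (pw p))"
    by simp
  also have "\<dots> = (cmb (n + p) m \<cdot> \<zeta> (pw m) (pw (n + p))) \<cdot> ?t"
    unfolding cmb_assoc[symmetric] by (simp add: comp_reduce[OF braid_nat])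
  finally have "(pact (block_swap m (n + p)) \<cdot> cmb m (n + p)) \<cdot> ?t
      = (cmb (n + p) m \<cdot> \<zeta> (pw m) (pw (n + p))) \<cdot> ?t"
    by simp
  then show ?thesis
    unfolding swap_braids_def by - (rule iso_cancel_right[OF t_iso], auto simp: add.commute)
qed

lemma swap_braids_one: "swap_braids 1 1"
proof -
  have swap: "snd (block_swap 1 1) = adj 1"
    by (auto simp: block_swap_def transpose_def fun_eq_iff)
  have "pact (block_swap 1 1) = twist U \<u>"
    using act_gen[of 1 2] swap by (simp add: pact_def numeral_2_eq_2 del: act.simps)
  moreover have cmb11: "cmb 1 1 = \<i> (\<u> \<diamondop> U) \<ast> lunit M U"
  proof -
    have "cmb 1 1 = (runit M (\<u> \<diamondop> U) \<ast> \<i> U) \<cdot> assoc_inv (\<u> \<diamondop> U) \<u> U" by simp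
    also have "\<dots> = ((\<i> (\<u> \<diamondop> U) \<ast> lunit M U) \<cdot> assoc M (\<u> \<diamondop> U) \<u> U) \<cdot> assoc_inv (\<u> \<diamondop> U) \<u> U"
      by (subst triangle) simp_all
    finally show ?thesis by simp
  qed
  have tw: "(lunit M U \<ast> \<i> U) \<cdot> twist U \<u> = \<zeta> U U \<cdot> (lunit M U \<ast> \<i> U)"
  proof -
    have "(lunit M U \<ast> \<i> U) \<cdot> twist U \<u> = (lunit M (U \<diamondop> U) \<cdot> assoc M \<u> U U) \<cdot> twist U \<u>"
      by (subst lunit_tensor) simp_all
    also have "\<dots> = \<zeta> U U \<cdot> (lunit M (U \<diamondop> U) \<cdot> assoc M \<u> U U)"
      by (simp add: twist_def nat_simps)
    finally show ?thesis by (simp add: lunit_tensor)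
  qed
  have "twist U \<u> \<cdot> cmb 1 1 = cmb 1 1 \<cdot> \<zeta> (\<u> \<diamondop> U) (\<u> \<diamondop> U)"
  proof (rule iso_cancel_left)
    show "is_iso \<C> (lunit M U \<ast> \<i> U)"
      by (intro is_iso_tensor lunit_iso is_iso_ident) auto
    have "(lunit M U \<ast> \<i> U) \<cdot> (twist U \<u> \<cdot> cmb 1 1) = \<zeta> U U \<cdot> (lunit M U \<ast> lunit M U)"
      unfolding cmb11 by (simp add: comp_reduce[OF tw])
    also have "\<dots> = (lunit M U \<ast> \<i> U) \<cdot> (cmb 1 1 \<cdot> \<zeta> (\<u> \<diamondop> U) (\<u> \<diamondop> U))"
      unfolding cmb11 by (simp add: braid_nat)
    finally show "(lunit M U \<ast> \<i> U) \<cdot> (twist U \<u> \<cdot> cmb 1 1)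
      = (lunit M U \<ast> \<i> U) \<cdot> (cmb 1 1 \<cdot> \<zeta> (\<u> \<diamondop> U) (\<u> \<diamondop> U))" .
  qed auto
  ultimately show ?thesis by (simp add: swap_braids_def)
qed

lemma pact_swap: "pact (block_swap m n) \<cdot> cmb m n = cmb n m \<cdot> \<zeta> (pw m) (pw n)"
proof -
  have one: "swap_braids 1 n" for n
    by (induction n) (use swap_braids_zero swap_braids_add[OF _ swap_braids_one] in auto)
  have "swap_braids m n"
    by (induction n) (use swap_braids_zero swap_braids_add[OF _ swap_braids_sym[OF one]] in auto)
  then show ?thesis by (simp add: swap_braids_def)
qed

text \<open>The record \<open>F\<close> is arbitrary apart from its two functor fields, so that it may carry a multiplicative
  structure as well.\<close>

theorem powers_functor:
  fixes F :: "(nat, perm_arr, 'a, 'b, 'z) ftor_scheme"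
  assumes F: "FObj F = pw" "\<And>f. f \<in> Arr \<Sigma> \<Longrightarrow> FArr F f = pact f"
  shows "braided_monoidal_functor \<Sigma> (AddM \<Sigma>) (AddBraid \<Sigma>) \<C> M \<zeta> F cmb (\<i> \<u>)"
proof -
  interpret S: symmetric_monoidal_category \<Sigma> "AddM \<Sigma>" "AddBraid \<Sigma>"
    by (rule Sigma_add_symmetric)
  interpret K: cat_functor \<Sigma> \<C> F
    by unfold_locales (auto simp: F hom_iff pact_comp)
  interpret K: monoidal_functor \<Sigma> "AddM \<Sigma>" \<C> M F cmb "\<i> \<u>"
  proof unfold_locales
    fix l m n
    show "FArr F (assoc (AddM \<Sigma>) l m n) \<cdot> cmb (l \<oplus>\<^bsub>\<Sigma>\<^esub> m) n \<cdot> (cmb l m \<ast> \<i> (FObj F n))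
      = cmb l (m \<oplus>\<^bsub>\<Sigma>\<^esub> n) \<cdot> (\<i> (FObj F l) \<ast> cmb m n) \<cdot> assoc M (FObj F l) (FObj F m) (FObj F n)"
      by (simp add: F add.assoc cmb_assoc)
  qed (auto simp: F hom_iff pact_sum cmb_lunit)
  show ?thesis
    by unfold_locales (auto simp: F pact_swap)
qed

end

section \<open>The multiplicative structure of the functor of powers\<close>

context symmetric_monoidal_category
begin

text \<open>The same composite as \<open>mid_exchange\<close> (see \<open>mid_exchange_eq\<close>), in a category with only one tensor product.\<close>

definition exchange :: "'a \<Rightarrow> 'a \<Rightarrow> 'a \<Rightarrow> 'a \<Rightarrow> 'b" where
  "exchange A B C D = assoc_inv A C (B \<diamondop> D) \<cdot>
     ((\<i> A \<ast> (assoc M C B D \<cdot> ((\<zeta> B C \<ast> \<i> D) \<cdot> assoc_inv B C D))) \<cdot> assoc M A B (C \<diamondop> D))"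

lemma exchange_simps [simp]:
  assumes [simp]: "A \<in> Obj \<C>" "B \<in> Obj \<C>" "C \<in> Obj \<C>" "D \<in> Obj \<C>"
  shows "exchange A B C D \<in> Arr \<C>" "Dom \<C> (exchange A B C D) = (A \<diamondop> B) \<diamondop> (C \<diamondop> D)"
    "Cod \<C> (exchange A B C D) = (A \<diamondop> C) \<diamondop> (B \<diamondop> D)"
  by (simp_all add: exchange_def)

lemma exchange_nat:
  assumes [simp]: "f \<in> Arr \<C>" "g \<in> Arr \<C>" "h \<in> Arr \<C>" "k \<in> Arr \<C>"
    "Cod \<C> f = A" "Cod \<C> g = B" "Cod \<C> h = C" "Cod \<C> k = D"
  shows "exchange A B C D \<cdot> ((f \<ast> g) \<ast> (h \<ast> k))
    = ((f \<ast> h) \<ast> (g \<ast> k)) \<cdot> exchange (Dom \<C> f) (Dom \<C> g) (Dom \<C> h) (Dom \<C> k)"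
proof -
  have obj [simp]: "A \<in> Obj \<C>" "B \<in> Obj \<C>" "C \<in> Obj \<C>" "D \<in> Obj \<C>"
    using assms cod_Obj by blast+
  let ?x = "\<lambda>A B C D. assoc M C B D \<cdot> ((\<zeta> B C \<ast> \<i> D) \<cdot> assoc_inv B C D)"
  have x: "?x A B C D \<cdot> (g \<ast> (h \<ast> k)) = (h \<ast> (g \<ast> k)) \<cdot> ?x A (Dom \<C> g) (Dom \<C> h) (Dom \<C> k)"
  proof -
    have "?x A B C D \<cdot> (g \<ast> (h \<ast> k)) = assoc M C B D \<cdot> (((\<zeta> B C \<cdot> (g \<ast> h)) \<ast> k) \<cdot> assoc_inv (Dom \<C> g) (Dom \<C> h) (Dom \<C> k))"
      by (simp add: nat_simps)
    also have "\<dots> = assoc M C B D \<cdot> (((h \<ast> g) \<ast> k) \<cdot> ((\<zeta> (Dom \<C> g) (Dom \<C> h) \<ast> \<i> (Dom \<C> k)) \<cdot> assoc_inv (Dom \<C> g) (Dom \<C> h) (Dom \<C> k)))"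
      by (simp add: braid_nat)
    also have "\<dots> = (h \<ast> (g \<ast> k)) \<cdot> ?x A (Dom \<C> g) (Dom \<C> h) (Dom \<C> k)"
      by (simp add: nat_simps del: tensor_merge_comp)
    finally show ?thesis .
  qed
  have "exchange A B C D \<cdot> ((f \<ast> g) \<ast> (h \<ast> k))
      = assoc_inv A C (B \<diamondop> D) \<cdot> ((f \<ast> (?x A B C D \<cdot> (g \<ast> (h \<ast> k)))) \<cdot> assoc M (Dom \<C> f) (Dom \<C> g) (Dom \<C> h \<diamondop> Dom \<C> k))"
    by (simp add: exchange_def nat_simps)
  also have "\<dots> = assoc_inv A C (B \<diamondop> D) \<cdot> ((f \<ast> (h \<ast> (g \<ast> k))) \<cdot> ((\<i> (Dom \<C> f) \<ast> ?x A (Dom \<C> g) (Dom \<C> h) (Dom \<C> k))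
      \<cdot> assoc M (Dom \<C> f) (Dom \<C> g) (Dom \<C> h \<diamondop> Dom \<C> k)))"
    unfolding x by simp
  also have "\<dots> = ((f \<ast> h) \<ast> (g \<ast> k)) \<cdot> exchange (Dom \<C> f) (Dom \<C> g) (Dom \<C> h) (Dom \<C> k)"
    by (simp add: exchange_def comp_reduce[OF assoc_inv_nat] del: tensor_merge_comp)
  finally show ?thesis .
qed

end

context object_powers
begin

lemma cmb_four:
  "cmb (a + b) (c + d) \<cdot> (cmb a b \<ast> cmb c d)
    = cmb a (b + c + d) \<cdot> ((\<i> (pw a) \<ast> (cmb (b + c) d \<cdot> ((cmb b c \<ast> \<i> (pw d)) \<cdot> assoc_inv (pw b) (pw c) (pw d))))
        \<cdot> assoc M (pw a) (pw b) (pw c \<diamondop> pw d))"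
proof -
  have "cmb (b + c) d \<cdot> ((cmb b c \<ast> \<i> (pw d)) \<cdot> assoc_inv (pw b) (pw c) (pw d))
      = (cmb (b + c) d \<cdot> (cmb b c \<ast> \<i> (pw d))) \<cdot> assoc_inv (pw b) (pw c) (pw d)"
    by simp
  also have "\<dots> = cmb b (c + d) \<cdot> (\<i> (pw b) \<ast> cmb c d)"
    unfolding cmb_assoc by (simp add: add.assoc)
  finally have right: "cmb (b + c) d \<cdot> ((cmb b c \<ast> \<i> (pw d)) \<cdot> assoc_inv (pw b) (pw c) (pw d))
      = cmb b (c + d) \<cdot> (\<i> (pw b) \<ast> cmb c d)" .
  have "cmb (a + b) (c + d) \<cdot> (cmb a b \<ast> cmb c d)
      = (cmb (a + b) (c + d) \<cdot> (cmb a b \<ast> \<i> (pw (c + d)))) \<cdot> (\<i> (pw a \<diamondop> pw b) \<ast> cmb c d)"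
    by simp
  also have "\<dots> = cmb a (b + (c + d)) \<cdot> ((\<i> (pw a) \<ast> cmb b (c + d)) \<cdot>
      (assoc M (pw a) (pw b) (pw (c + d)) \<cdot> (\<i> (pw a) \<ast> \<i> (pw b) \<ast> cmb c d)))"
    unfolding cmb_assoc by (simp add: add.assoc)
  also have "\<dots> = cmb a (b + (c + d)) \<cdot> ((\<i> (pw a) \<ast> (cmb b (c + d) \<cdot> (\<i> (pw b) \<ast> cmb c d))) \<cdot>
      assoc M (pw a) (pw b) (pw c \<diamondop> pw d))"
    by (simp add: nat_simps del: tensor_ident_simp)
  finally show ?thesis
    unfolding right by (simp add: add.assoc)
qed

text \<open>In the form \<open>cmb_four\<close> of both sides the two middle summands are adjacent, so that the claim reduces to \<open>pact_swap\<close>.\<close>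

lemma pact_exchange:
  "pact (block_sum (perm_id a) (block_sum (block_swap b c) (perm_id d))) \<cdot> (cmb (a + b) (c + d) \<cdot> (cmb a b \<ast> cmb c d))
    = cmb (a + c) (b + d) \<cdot> ((cmb a c \<ast> cmb b d) \<cdot> exchange (pw a) (pw b) (pw c) (pw d))"
proof -
  let ?s = "block_sum (block_swap b c) (perm_id d)"
  have "pact (block_sum (perm_id a) ?s) \<cdot> (cmb (a + b) (c + d) \<cdot> (cmb a b \<ast> cmb c d))
    = cmb a (b + c + d) \<cdot> ((\<i> (pw a) \<ast> (pact ?s \<cdot> (cmb (b + c) d \<cdot> ((cmb b c \<ast> \<i> (pw d)) \<cdot> assoc_inv (pw b) (pw c) (pw d)))))
        \<cdot> assoc M (pw a) (pw b) (pw c \<diamondop> pw d))"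
    unfolding cmb_four by (subst pact_sum_comp) simp_all
  also have "pact ?s \<cdot> (cmb (b + c) d \<cdot> ((cmb b c \<ast> \<i> (pw d)) \<cdot> assoc_inv (pw b) (pw c) (pw d)))
      = cmb (c + b) d \<cdot> (((pact (block_swap b c) \<cdot> cmb b c) \<ast> \<i> (pw d)) \<cdot> assoc_inv (pw b) (pw c) (pw d))"
    by (subst pact_sum_comp) (simp_all add: add.commute)
  also have "\<dots> = cmb (c + b) d \<cdot> ((cmb c b \<ast> \<i> (pw d)) \<cdot> ((\<zeta> (pw b) (pw c) \<ast> \<i> (pw d)) \<cdot> assoc_inv (pw b) (pw c) (pw d)))"
    unfolding pact_swap by simp
  also have "cmb a (b + c + d) \<cdot> ((\<i> (pw a) \<ast> \<dots>) \<cdot> assoc M (pw a) (pw b) (pw c \<diamondop> pw d))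
      = (cmb a (c + b + d) \<cdot> ((\<i> (pw a) \<ast> (cmb (c + b) d \<cdot> ((cmb c b \<ast> \<i> (pw d)) \<cdot> assoc_inv (pw c) (pw b) (pw d))))
        \<cdot> assoc M (pw a) (pw c) (pw b \<diamondop> pw d))) \<cdot> exchange (pw a) (pw b) (pw c) (pw d)"
    by (simp add: exchange_def add.commute[of b c])
  finally show ?thesis
    unfolding cmb_four[symmetric] by simp
qed

lemma cmb_one: "cmb n 1 = \<i> (pw n) \<ast> lunit M U"
proof -
  have "cmb n 1 = (runit M (pw n) \<ast> \<i> U) \<cdot> assoc_inv (pw n) \<u> U" by simp
  also have "\<dots> = ((\<i> (pw n) \<ast> lunit M U) \<cdot> assoc M (pw n) \<u> U) \<cdot> assoc_inv (pw n) \<u> U"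
    by (subst triangle) simp_all
  finally show ?thesis by simp
qed

lemma pact_iso: "f \<in> Arr \<Sigma> \<Longrightarrow> is_iso \<C> (pact f)"
proof -
  assume f: "f \<in> Arr \<Sigma>"
  from Sigma_inverse_arrows[OF f] obtain g where g: "g \<in> Arr \<Sigma>" "fst g = fst f"
      "g \<cdot>\<^sub>\<Sigma> f = perm_id (fst f)" "f \<cdot>\<^sub>\<Sigma> g = perm_id (fst f)"
    by (auto simp: inverse_arrows_def hom_iff)
  show "is_iso \<C> (pact f)"
    using pact_comp[OF f g(1)] pact_comp[OF g(1) f] g by (intro is_isoI[of _ "pact g"]) auto
qed

end

context bimonoidal_category
begin

lemma null_simps [simp]:
  assumes "A \<in> Obj \<C>"
  shows "\<lambda>\<^sup>\<bullet> A \<in> Arr \<C>" "Dom \<C> (\<lambda>\<^sup>\<bullet> A) = \<zero> \<otimes> A" "Cod \<C> (\<lambda>\<^sup>\<bullet> A) = \<zero>"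
    "\<rho>\<^sup>\<bullet> A \<in> Arr \<C>" "Dom \<C> (\<rho>\<^sup>\<bullet> A) = A \<otimes> \<zero>" "Cod \<C> (\<rho>\<^sup>\<bullet> A) = \<zero>"
  using LNull_in_hom[OF assms] RNull_in_hom[OF assms] by (auto simp: hom_iff)

lemma dist_simps [simp]:
  assumes "A \<in> Obj \<C>" "B \<in> Obj \<C>" "C \<in> Obj \<C>"
  shows "\<delta>\<^sup>l A B C \<in> Arr \<C>" "Dom \<C> (\<delta>\<^sup>l A B C) = A \<otimes> (B \<oplus> C)" "Cod \<C> (\<delta>\<^sup>l A B C) = A \<otimes> B \<oplus> A \<otimes> C"
    "\<delta>\<^sup>r A B C \<in> Arr \<C>" "Dom \<C> (\<delta>\<^sup>r A B C) = (A \<oplus> B) \<otimes> C" "Cod \<C> (\<delta>\<^sup>r A B C) = A \<otimes> C \<oplus> B \<otimes> C"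
  using DistL_in_hom[OF assms] DistR_in_hom[OF assms] by (auto simp: hom_iff)

lemma LNull_nat: "f \<in> Arr \<C> \<Longrightarrow> Cod \<C> f = A \<Longrightarrow> \<lambda>\<^sup>\<bullet> A \<cdot> (\<i> \<zero> \<boxtimes> f) = \<lambda>\<^sup>\<bullet> (Dom \<C> f)"
  using LNull_natural[of f "Dom \<C> f" A] by (auto simp: hom_iff)

lemma DistL_nat:
  "f \<in> Arr \<C> \<Longrightarrow> g \<in> Arr \<C> \<Longrightarrow> h \<in> Arr \<C> \<Longrightarrow> Cod \<C> f = A \<Longrightarrow> Cod \<C> g = B \<Longrightarrow> Cod \<C> h = C
    \<Longrightarrow> \<delta>\<^sup>l A B C \<cdot> (f \<boxtimes> (g \<boxplus> h)) = (f \<boxtimes> g \<boxplus> f \<boxtimes> h) \<cdot> \<delta>\<^sup>l (Dom \<C> f) (Dom \<C> g) (Dom \<C> h)"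
  using DistL_natural[of f "Dom \<C> f" A g "Dom \<C> g" B h "Dom \<C> h" C] by (auto simp: hom_iff)

lemma DistR_nat:
  "f \<in> Arr \<C> \<Longrightarrow> g \<in> Arr \<C> \<Longrightarrow> h \<in> Arr \<C> \<Longrightarrow> Cod \<C> f = A \<Longrightarrow> Cod \<C> g = B \<Longrightarrow> Cod \<C> h = C
    \<Longrightarrow> \<delta>\<^sup>r A B C \<cdot> ((f \<boxplus> g) \<boxtimes> h) = (f \<boxtimes> h \<boxplus> g \<boxtimes> h) \<cdot> \<delta>\<^sup>r (Dom \<C> f) (Dom \<C> g) (Dom \<C> h)"
  using DistR_natural[of f "Dom \<C> f" A g "Dom \<C> g" B h "Dom \<C> h" C] by (auto simp: hom_iff)

lemma mid_exchange_eq: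
  "A \<in> Obj \<C> \<Longrightarrow> B \<in> Obj \<C> \<Longrightarrow> C \<in> Obj \<C> \<Longrightarrow> D \<in> Obj \<C> \<Longrightarrow> \<mu> A B C D = add.exchange A B C D"
  by (simp add: mid_exchange_def add.exchange_def)

end

lemma Sigma_braid_zero [simp]: "\<zeta>\<^sub>\<Sigma> n 0 = perm_id 0"
  by (rule Sigma_size_zero) simp_all

lemma Sigma_braid_one [simp]: "\<zeta>\<^sub>\<Sigma> n (Suc 0) = perm_id n"
proof (rule Sigma_eqI[of _ _ n])
  fix k assume "1 \<le> k" "k \<le> n"
  then show "snd (\<zeta>\<^sub>\<Sigma> n (Suc 0)) k = snd (perm_id n) k"
    using Sigma_braid_eval[of k n "Suc 0" "Suc 0"] by (simp add: lex_index_unit)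
qed simp_all

sublocale braided_bimonoidal_category \<subseteq> pow: object_powers \<C> "AddM \<C>" "AddBraid \<C>" "\<one>"
  by unfold_locales simp

context braided_bimonoidal_category
begin

abbreviation K where "K \<equiv> pow.pw"
abbreviation cmb where "cmb \<equiv> pow.cmb"
abbreviation pact where "pact \<equiv> pow.pact"

text \<open>The map \<open>K m \<otimes> K n \<rightarrow> K (m * n)\<close>. Recursion on the first factor needs no permutation of the summands, as
  \<open>\<delta>\<^sup>r\<close> is an identity in \<open>\<Sigma>\<close>.\<close>

primrec mlt :: "nat \<Rightarrow> nat \<Rightarrow> 'm" where
  "mlt 0 n = \<lambda>\<^sup>\<bullet> (K n)"
| "mlt (Suc m) n = cmb (m * n) n \<cdot> ((mlt m n \<boxplus> \<lambda>\<^sup>\<otimes> (K n)) \<cdot> \<delta>\<^sup>r (K m) \<one> (K n))"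

lemma mlt_simps [simp]:
  "mlt m n \<in> Arr \<C>" "Dom \<C> (mlt m n) = K m \<otimes> K n" "Cod \<C> (mlt m n) = K (m * n)"
  by (induction m) (auto simp: add.commute)

text \<open>The induction step is the compatibility of \<open>\<delta>\<^sup>r\<close> with the additive associator.\<close>

lemma mlt_add_left:
  "mlt (l + m) n \<cdot> (cmb l m \<boxtimes> \<i> (K n))
    = cmb (l * n) (m * n) \<cdot> ((mlt l n \<boxplus> mlt m n) \<cdot> \<delta>\<^sup>r (K l) (K m) (K n))"
proof (induction m)
  case 0
  have "cmb (l * n) 0 \<cdot> ((mlt l n \<boxplus> \<lambda>\<^sup>\<bullet> (K n)) \<cdot> \<delta>\<^sup>r (K l) \<zero> (K n))
      = (\<rho>\<^sup>\<oplus> (K (l * n)) \<cdot> (mlt l n \<boxplus> \<i> \<zero>)) \<cdot> ((\<i> (K l \<otimes> K n) \<boxplus> \<lambda>\<^sup>\<bullet> (K n)) \<cdot> \<delta>\<^sup>r (K l) \<zero> (K n))"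
    by simp
  also have "\<dots> = mlt l n \<cdot> (\<rho>\<^sup>\<oplus> (K l \<otimes> K n) \<cdot> ((\<i> (K l \<otimes> K n) \<boxplus> \<lambda>\<^sup>\<bullet> (K n)) \<cdot> \<delta>\<^sup>r (K l) \<zero> (K n)))"
    by (subst add.runit_nat) simp_all
  also have "\<dots> = mlt l n \<cdot> (\<rho>\<^sup>\<oplus> (K l) \<boxtimes> \<i> (K n))"
    using DistR_zero_right[of "K l" "K n"] by simp
  finally show ?case by simp
next
  case (Suc m)
  let ?ai = "add.assoc_inv (K l) (K m) \<one>"
  have sum_assoc: "(\<delta>\<^sup>r (K l) (K m) (K n) \<boxplus> \<i> (\<one> \<otimes> K n)) \<cdot> (\<delta>\<^sup>r (K l \<oplus> K m) \<one> (K n) \<cdot> (?ai \<boxtimes> \<i> (K n)))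
      = add.assoc_inv (K l \<otimes> K n) (K m \<otimes> K n) (\<one> \<otimes> K n)
        \<cdot> ((\<i> (K l \<otimes> K n) \<boxplus> \<delta>\<^sup>r (K m) \<one> (K n)) \<cdot> \<delta>\<^sup>r (K l) (K m \<oplus> \<one>) (K n))" (is "?l = ?r")
  proof (rule add.iso_cancel_left[OF add.assoc_iso[of "K l \<otimes> K n" "K m \<otimes> K n" "\<one> \<otimes> K n"]])
    have "\<alpha>\<^sup>\<oplus> (K l \<otimes> K n) (K m \<otimes> K n) (\<one> \<otimes> K n) \<cdot> ?l
      = (\<alpha>\<^sup>\<oplus> (K l \<otimes> K n) (K m \<otimes> K n) (\<one> \<otimes> K n) \<cdot>
        (\<delta>\<^sup>r (K l) (K m) (K n) \<boxplus> \<i> (\<one> \<otimes> K n)) \<cdot> \<delta>\<^sup>r (K l \<oplus> K m) \<one> (K n)) \<cdot> (?ai \<boxtimes> \<i> (K n))"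
      by simp
    also have "\<dots> = (\<i> (K l \<otimes> K n) \<boxplus> \<delta>\<^sup>r (K m) \<one> (K n)) \<cdot> \<delta>\<^sup>r (K l) (K m \<oplus> \<one>) (K n)"
      by (subst DistR_sum_assoc) simp_all
    finally show "\<alpha>\<^sup>\<oplus> (K l \<otimes> K n) (K m \<otimes> K n) (\<one> \<otimes> K n) \<cdot> ?l
      = \<alpha>\<^sup>\<oplus> (K l \<otimes> K n) (K m \<otimes> K n) (\<one> \<otimes> K n) \<cdot> ?r"
      by simp
  qed auto
  let ?x = "(\<i> (K l \<otimes> K n) \<boxplus> \<delta>\<^sup>r (K m) \<one> (K n)) \<cdot> \<delta>\<^sup>r (K l) (K m \<oplus> \<one>) (K n)"
  let ?L = "\<lambda>\<^sup>\<otimes> (K n)"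
  have "mlt (l + Suc m) n \<cdot> (cmb l (Suc m) \<boxtimes> \<i> (K n))
      = cmb ((l + m) * n) n \<cdot> ((mlt (l + m) n \<boxplus> ?L) \<cdot> ((\<delta>\<^sup>r (K (l + m)) \<one> (K n) \<cdot> ((cmb l m \<boxplus> \<i> \<one>) \<boxtimes> \<i> (K n))) \<cdot> (?ai \<boxtimes> \<i> (K n))))"
    by (simp add: add.commute)
  also have "\<dots> = cmb ((l + m) * n) n \<cdot> (((mlt (l + m) n \<cdot> (cmb l m \<boxtimes> \<i> (K n))) \<boxplus> ?L) \<cdot> (\<delta>\<^sup>r (K l \<oplus> K m) \<one> (K n) \<cdot> (?ai \<boxtimes> \<i> (K n))))"
    by (subst DistR_nat) simp_all
  also have "\<dots> = cmb ((l + m) * n) n \<cdot> ((cmb (l * n) (m * n) \<boxplus> \<i> (K n)) \<cdot> (((mlt l n \<boxplus> mlt m n) \<boxplus> ?L) \<cdot>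
      ((\<delta>\<^sup>r (K l) (K m) (K n) \<boxplus> \<i> (\<one> \<otimes> K n)) \<cdot> (\<delta>\<^sup>r (K l \<oplus> K m) \<one> (K n) \<cdot> (?ai \<boxtimes> \<i> (K n))))))"
    unfolding Suc.IH by (simp add: add_mult_distrib)
  also have "\<dots> = (cmb (l * n + m * n) n \<cdot> (cmb (l * n) (m * n) \<boxplus> \<i> (K n))) \<cdot> (((mlt l n \<boxplus> mlt m n) \<boxplus> ?L) \<cdot>
      (add.assoc_inv (K l \<otimes> K n) (K m \<otimes> K n) (\<one> \<otimes> K n) \<cdot> ?x))"
    unfolding sum_assoc by (simp add: add_mult_distrib)
  also have "\<dots> = cmb (l * n) (m * n + n) \<cdot> ((\<i> (K (l * n)) \<boxplus> cmb (m * n) n) \<cdot>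
      ((mlt l n \<boxplus> (mlt m n \<boxplus> ?L)) \<cdot> ?x))"
    unfolding pow.cmb_assoc by (simp add: add.comp_reduce[OF add.assoc_nat] add.assoc)
  also have "\<dots> = cmb (l * n) (Suc m * n) \<cdot> ((mlt l n \<boxplus> mlt (Suc m) n) \<cdot> \<delta>\<^sup>r (K l) (K (Suc m)) (K n))"
    by (simp add: add.commute[of n])
  finally show ?case .
qed

lemma mlt_one_left: "mlt 1 n = \<lambda>\<^sup>\<otimes> (K n) \<cdot> (\<lambda>\<^sup>\<oplus> \<one> \<boxtimes> \<i> (K n))"
proof -
  have "mlt 1 n = \<lambda>\<^sup>\<oplus> (K n) \<cdot> ((\<i> \<zero> \<boxplus> \<lambda>\<^sup>\<otimes> (K n)) \<cdot> ((\<lambda>\<^sup>\<bullet> (K n) \<boxplus> \<i> (\<one> \<otimes> K n)) \<cdot> \<delta>\<^sup>r \<zero> \<one> (K n)))"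
    by (simp add: pow.cmb_lunit)
  also have "\<dots> = \<lambda>\<^sup>\<otimes> (K n) \<cdot> (\<lambda>\<^sup>\<oplus> (\<one> \<otimes> K n) \<cdot> (\<lambda>\<^sup>\<bullet> (K n) \<boxplus> \<i> (\<one> \<otimes> K n)) \<cdot> \<delta>\<^sup>r \<zero> \<one> (K n))"
    by (simp add: add.comp_reduce[OF add.lunit_nat] del: add.tensor_merge_comp)
  finally show ?thesis
    using DistR_zero_left[of "K n" "\<one>"] by simp
qed

lemma mlt_zero_right: "mlt n 0 = \<rho>\<^sup>\<bullet> (K n)"
proof (induction n)
  case 0
  show ?case by (simp add: Null_zero)
next
  case (Suc n)
  have "mlt (Suc n) 0 = \<lambda>\<^sup>\<oplus> \<zero> \<cdot> (\<rho>\<^sup>\<bullet> (K n) \<boxplus> \<rho>\<^sup>\<bullet> \<one>) \<cdot> \<delta>\<^sup>r (K n) \<one> \<zero>"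
    by (simp add: Suc.IH add.lunit_unit prod_lunit_zero)
  then show ?case
    by (simp add: RNull_sum del: add.assoc_comp)
qed

lemma mlt_one_right: "mlt n 1 = \<rho>\<^sup>\<otimes> (K n) \<cdot> (\<i> (K n) \<boxtimes> \<lambda>\<^sup>\<oplus> \<one>)"
proof (induction n)
  case 0
  show ?case using LNull_nat[of "\<lambda>\<^sup>\<oplus> \<one>" \<one>] by (simp add: prod_runit_zero)
next
  case (Suc n)
  let ?l = "\<lambda>\<^sup>\<oplus> \<one>"
  have "mlt (Suc n) 1 = (\<i> (K n) \<boxplus> ?l) \<cdot> ((mlt n 1 \<boxplus> \<lambda>\<^sup>\<otimes> (K 1)) \<cdot> \<delta>\<^sup>r (K n) \<one> (K 1))"
    using pow.cmb_one[of n] by simp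
  also have "\<dots> = ((\<rho>\<^sup>\<otimes> (K n) \<cdot> (\<i> (K n) \<boxtimes> ?l)) \<boxplus> (?l \<cdot> \<lambda>\<^sup>\<otimes> (\<zero> \<oplus> \<one>))) \<cdot> \<delta>\<^sup>r (K n) \<one> (\<zero> \<oplus> \<one>)"
    unfolding Suc.IH by simp
  also have "?l \<cdot> \<lambda>\<^sup>\<otimes> (\<zero> \<oplus> \<one>) = \<rho>\<^sup>\<otimes> \<one> \<cdot> (\<i> \<one> \<boxtimes> ?l)"
    using mul.lunit_nat[of ?l \<one>] by (simp add: mul.lunit_unit)
  also have "((\<rho>\<^sup>\<otimes> (K n) \<cdot> (\<i> (K n) \<boxtimes> ?l)) \<boxplus> (\<rho>\<^sup>\<otimes> \<one> \<cdot> (\<i> \<one> \<boxtimes> ?l))) \<cdot> \<delta>\<^sup>r (K n) \<one> (\<zero> \<oplus> \<one>)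
      = (\<rho>\<^sup>\<otimes> (K n) \<boxplus> \<rho>\<^sup>\<otimes> \<one>) \<cdot> ((\<i> (K n) \<boxtimes> ?l \<boxplus> \<i> \<one> \<boxtimes> ?l) \<cdot> \<delta>\<^sup>r (K n) \<one> (\<zero> \<oplus> \<one>))"
    by simp
  also have "\<dots> = (\<rho>\<^sup>\<otimes> (K n) \<boxplus> \<rho>\<^sup>\<otimes> \<one>) \<cdot> (\<delta>\<^sup>r (K n) \<one> \<one> \<cdot> ((\<i> (K n) \<boxplus> \<i> \<one>) \<boxtimes> ?l))"
    by (subst DistR_nat) simp_all
  also have "\<dots> = ((\<rho>\<^sup>\<otimes> (K n) \<boxplus> \<rho>\<^sup>\<otimes> \<one>) \<cdot> \<delta>\<^sup>r (K n) \<one> \<one>) \<cdot> (\<i> (K (Suc n)) \<boxtimes> ?l)"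
    by simp
  also have "\<dots> = \<rho>\<^sup>\<otimes> (K (Suc n)) \<cdot> (\<i> (K (Suc n)) \<boxtimes> ?l)"
    by (subst DistR_one) simp_all
  finally show ?case .
qed

text \<open>Peeling one summand off \<open>K (Suc m)\<close> uses \<open>\<delta>\<^sup>r\<close>, so the induction step exchanges \<open>\<delta>\<^sup>r\<close> with \<open>\<delta>\<^sup>l\<close>. This costs an
  exchange of the two middle summands in \<open>\<C>\<close> and in \<open>\<Sigma>\<close>, and \<open>pact_exchange\<close> matches the two.\<close>

lemma mlt_add_right:
  "pact (\<delta>\<^sub>\<Sigma> m n p) \<cdot> (mlt m (n + p) \<cdot> (\<i> (K m) \<boxtimes> cmb n p))
    = cmb (m * n) (m * p) \<cdot> ((mlt m n \<boxplus> mlt m p) \<cdot> \<delta>\<^sup>l (K m) (K n) (K p))"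
proof (induction m)
  case 0
  have "\<lambda>\<^sup>\<bullet> (K (n + p)) \<cdot> (\<i> \<zero> \<boxtimes> cmb n p) = \<lambda>\<^sup>\<oplus> \<zero> \<cdot> (\<lambda>\<^sup>\<bullet> (K n) \<boxplus> \<lambda>\<^sup>\<bullet> (K p)) \<cdot> \<delta>\<^sup>l \<zero> (K n) (K p)"
    by (simp add: LNull_nat LNull_sum del: add.assoc_comp)
  then show ?case by (simp add: add.lunit_unit)
next
  case (Suc m)
  let ?L = "\<lambda>\<^sup>\<otimes>"
  let ?N = "K n" and ?P = "K p" and ?m = "K m"
  have sig: "\<delta>\<^sub>\<Sigma> (Suc m) n p = block_sum (perm_id (m * n)) (block_sum (block_swap (m * p) n) (perm_id p))
      \<cdot>\<^sub>\<Sigma> block_sum (\<delta>\<^sub>\<Sigma> m n p) (perm_id (n + p))"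
    using Sigma_DistLR_exchange[of m n p 1] by (simp add: Sigma_mid_exchange)
  let ?s = "block_sum (perm_id (m * n)) (block_sum (block_swap (m * p) n) (perm_id p))"
  have pact: "pact (\<delta>\<^sub>\<Sigma> (Suc m) n p) = pact ?s \<cdot> pact (block_sum (\<delta>\<^sub>\<Sigma> m n p) (perm_id (n + p)))"
    unfolding sig by (rule pow.pact_comp) (simp_all add: add_mult_distrib2)
  have one: "?L (K (n + p)) \<cdot> (\<i> \<one> \<boxtimes> cmb n p) = cmb n p \<cdot> ((?L ?N \<boxplus> ?L ?P) \<cdot> \<delta>\<^sup>l \<one> ?N ?P)"
    using mul.lunit_nat[of "cmb n p"] DistL_one[of ?N ?P] by simp
  have "mlt (Suc m) (n + p) \<cdot> (\<i> (K (Suc m)) \<boxtimes> cmb n p)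
      = cmb (m * (n + p)) (n + p) \<cdot> ((mlt m (n + p) \<boxplus> ?L (K (n + p))) \<cdot> (\<delta>\<^sup>r ?m \<one> (K (n + p)) \<cdot> ((\<i> ?m \<boxplus> \<i> \<one>) \<boxtimes> cmb n p)))"
    by (simp add: add.commute)
  also have "\<dots> = cmb (m * (n + p)) (n + p) \<cdot> (((mlt m (n + p) \<cdot> (\<i> ?m \<boxtimes> cmb n p)) \<boxplus> (?L (K (n + p)) \<cdot> (\<i> \<one> \<boxtimes> cmb n p)))
      \<cdot> \<delta>\<^sup>r ?m \<one> (?N \<oplus> ?P))"
    by (subst DistR_nat) simp_all
  finally have 1: "mlt (Suc m) (n + p) \<cdot> (\<i> (K (Suc m)) \<boxtimes> cmb n p) = \<dots>" .
  have "pact (block_sum (\<delta>\<^sub>\<Sigma> m n p) (perm_id (n + p))) \<cdot> (mlt (Suc m) (n + p) \<cdot> (\<i> (K (Suc m)) \<boxtimes> cmb n p))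
     = cmb (m * n + m * p) (n + p) \<cdot> (((pact (\<delta>\<^sub>\<Sigma> m n p) \<cdot> (mlt m (n + p) \<cdot> (\<i> ?m \<boxtimes> cmb n p))) \<boxplus>
        (?L (K (n + p)) \<cdot> (\<i> \<one> \<boxtimes> cmb n p))) \<cdot> \<delta>\<^sup>r ?m \<one> (?N \<oplus> ?P))"
    unfolding 1 by (subst pow.pact_sum_comp) (simp_all add: add_mult_distrib2)
  also have "\<dots> = cmb (m * n + m * p) (n + p) \<cdot> ((cmb (m * n) (m * p) \<boxplus> cmb n p) \<cdot>
      (((mlt m n \<boxplus> mlt m p) \<boxplus> (?L ?N \<boxplus> ?L ?P)) \<cdot> ((\<delta>\<^sup>l ?m ?N ?P \<boxplus> \<delta>\<^sup>l \<one> ?N ?P) \<cdot> \<delta>\<^sup>r ?m \<one> (?N \<oplus> ?P))))"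
    unfolding Suc.IH one by simp
  finally have 2: "pact (block_sum (\<delta>\<^sub>\<Sigma> m n p) (perm_id (n + p))) \<cdot> (mlt (Suc m) (n + p) \<cdot> (\<i> (K (Suc m)) \<boxtimes> cmb n p)) = \<dots>" .
  let ?x = "((mlt m n \<boxplus> mlt m p) \<boxplus> (?L ?N \<boxplus> ?L ?P)) \<cdot> ((\<delta>\<^sup>l ?m ?N ?P \<boxplus> \<delta>\<^sup>l \<one> ?N ?P) \<cdot> \<delta>\<^sup>r ?m \<one> (?N \<oplus> ?P))"
  have "pact (\<delta>\<^sub>\<Sigma> (Suc m) n p) \<cdot> (mlt (Suc m) (n + p) \<cdot> (\<i> (K (Suc m)) \<boxtimes> cmb n p))
      = pact ?s \<cdot> (pact (block_sum (\<delta>\<^sub>\<Sigma> m n p) (perm_id (n + p))) \<cdot> (mlt (Suc m) (n + p) \<cdot> (\<i> (K (Suc m)) \<boxtimes> cmb n p)))"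
    unfolding pact by (rule add.assoc_comp) (simp_all add: add_mult_distrib2 ac_simps del: mlt.simps)
  also have "\<dots> = (pact ?s \<cdot> (cmb (m * n + m * p) (n + p) \<cdot> (cmb (m * n) (m * p) \<boxplus> cmb n p))) \<cdot> ?x"
    unfolding 2 by (simp add: add.assoc add.left_commute)
  also have "\<dots> = cmb (m * n + n) (m * p + p) \<cdot> ((cmb (m * n) n \<boxplus> cmb (m * p) p) \<cdot>
      ((add.exchange (K (m * n)) (K (m * p)) ?N ?P \<cdot> ((mlt m n \<boxplus> mlt m p) \<boxplus> (?L ?N \<boxplus> ?L ?P)))
        \<cdot> ((\<delta>\<^sup>l ?m ?N ?P \<boxplus> \<delta>\<^sup>l \<one> ?N ?P) \<cdot> \<delta>\<^sup>r ?m \<one> (?N \<oplus> ?P))))"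
    unfolding pow.pact_exchange by simp
  also have "\<dots> = cmb (m * n + n) (m * p + p) \<cdot> ((cmb (m * n) n \<boxplus> cmb (m * p) p) \<cdot>
      (((mlt m n \<boxplus> ?L ?N) \<boxplus> (mlt m p \<boxplus> ?L ?P)) \<cdot>
        (add.exchange (?m \<otimes> ?N) (?m \<otimes> ?P) (\<one> \<otimes> ?N) (\<one> \<otimes> ?P)
        \<cdot> ((\<delta>\<^sup>l ?m ?N ?P \<boxplus> \<delta>\<^sup>l \<one> ?N ?P) \<cdot> \<delta>\<^sup>r ?m \<one> (?N \<oplus> ?P)))))"
    by (subst add.exchange_nat) simp_all
  also have "add.exchange (?m \<otimes> ?N) (?m \<otimes> ?P) (\<one> \<otimes> ?N) (\<one> \<otimes> ?P)
        \<cdot> ((\<delta>\<^sup>l ?m ?N ?P \<boxplus> \<delta>\<^sup>l \<one> ?N ?P) \<cdot> \<delta>\<^sup>r ?m \<one> (?N \<oplus> ?P))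
      = (\<delta>\<^sup>r ?m \<one> ?N \<boxplus> \<delta>\<^sup>r ?m \<one> ?P) \<cdot> \<delta>\<^sup>l (?m \<oplus> \<one>) ?N ?P"
    using DistLR_exchange[of ?m \<one> ?N ?P] by (simp add: mid_exchange_eq)
  also have "cmb (m * n + n) (m * p + p) \<cdot> ((cmb (m * n) n \<boxplus> cmb (m * p) p) \<cdot>
      (((mlt m n \<boxplus> ?L ?N) \<boxplus> (mlt m p \<boxplus> ?L ?P)) \<cdot> ((\<delta>\<^sup>r ?m \<one> ?N \<boxplus> \<delta>\<^sup>r ?m \<one> ?P) \<cdot> \<delta>\<^sup>l (?m \<oplus> \<one>) ?N ?P)))
    = cmb (Suc m * n) (Suc m * p) \<cdot> ((mlt (Suc m) n \<boxplus> mlt (Suc m) p) \<cdot> \<delta>\<^sup>l (K (Suc m)) ?N ?P)"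
    by (simp add: add.commute)
  finally show ?case .
qed

lemma mlt_nat_right:
  assumes [simp]: "g \<in> Arr \<Sigma>" "fst g = n"
  shows "pact (perm_id m \<boxtimes>\<^sub>\<Sigma> g) \<cdot> mlt m n = mlt m n \<cdot> (\<i> (K m) \<boxtimes> pact g)"
proof (induction m)
  case 0
  show ?case using LNull_nat[of "pact g" "K n"] by simp
next
  case (Suc m)
  have prod: "perm_id (Suc m) \<boxtimes>\<^sub>\<Sigma> g = block_sum (perm_id m \<boxtimes>\<^sub>\<Sigma> g) g"
    using Sigma_DistR_nat[of "perm_id m" "perm_id 1" g] by simp
  have "pact (perm_id (Suc m) \<boxtimes>\<^sub>\<Sigma> g) \<cdot> mlt (Suc m) n
      = cmb (m * n) n \<cdot> (((pact (perm_id m \<boxtimes>\<^sub>\<Sigma> g) \<cdot> mlt m n) \<boxplus> (pact g \<cdot> \<lambda>\<^sup>\<otimes> (K n))) \<cdot> \<delta>\<^sup>r (K m) \<one> (K n))"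
    unfolding prod by (simp add: pow.pact_sum_comp)
  also have "pact g \<cdot> \<lambda>\<^sup>\<otimes> (K n) = \<lambda>\<^sup>\<otimes> (K n) \<cdot> (\<i> \<one> \<boxtimes> pact g)"
    using mul.lunit_nat[of "pact g" "K n"] by simp
  also have "cmb (m * n) n \<cdot> (((pact (perm_id m \<boxtimes>\<^sub>\<Sigma> g) \<cdot> mlt m n) \<boxplus> (\<lambda>\<^sup>\<otimes> (K n) \<cdot> (\<i> \<one> \<boxtimes> pact g))) \<cdot> \<delta>\<^sup>r (K m) \<one> (K n))
      = cmb (m * n) n \<cdot> ((mlt m n \<boxplus> \<lambda>\<^sup>\<otimes> (K n)) \<cdot> ((\<i> (K m) \<boxtimes> pact g \<boxplus> \<i> \<one> \<boxtimes> pact g) \<cdot> \<delta>\<^sup>r (K m) \<one> (K n)))"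
    unfolding Suc.IH by simp
  also have "\<dots> = cmb (m * n) n \<cdot> ((mlt m n \<boxplus> \<lambda>\<^sup>\<otimes> (K n)) \<cdot> (\<delta>\<^sup>r (K m) \<one> (K n) \<cdot> ((\<i> (K m) \<boxplus> \<i> \<one>) \<boxtimes> pact g)))"
    by (subst DistR_nat) simp_all
  also have "\<dots> = mlt (Suc m) n \<cdot> (\<i> (K (Suc m)) \<boxtimes> pact g)"
    by simp
  finally show ?case .
qed

text \<open>The instance \<open>p = 1\<close> of \<open>mlt_add_right\<close>, after cancelling the unitor between \<open>K 1 = \<zero> \<oplus> \<one>\<close> and \<open>\<one>\<close>.\<close>

lemma mlt_Suc_right:
  "pact (\<delta>\<^sub>\<Sigma> n m (Suc 0)) \<cdot> mlt n (Suc m)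
    = cmb (n * m) n \<cdot> ((mlt n m \<boxplus> \<rho>\<^sup>\<otimes> (K n)) \<cdot> \<delta>\<^sup>l (K n) (K m) \<one>)"
proof (rule add.iso_cancel_right)
  let ?l = "\<lambda>\<^sup>\<oplus> \<one>"
  let ?t = "\<i> (K n) \<boxtimes> (\<i> (K m) \<boxplus> ?l)"
  show "is_iso \<C> ?t"
    by (intro add.is_iso_tensor mul.is_iso_tensor add.is_iso_ident add.lunit_iso) auto
  have "(pact (\<delta>\<^sub>\<Sigma> n m (Suc 0)) \<cdot> mlt n (Suc m)) \<cdot> ?t
      = cmb (n * m) n \<cdot> ((mlt n m \<boxplus> mlt n 1) \<cdot> \<delta>\<^sup>l (K n) (K m) (K 1))"
    using mlt_add_right[of n m 1] pow.cmb_one[of m] by simp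
  also have "\<dots> = cmb (n * m) n \<cdot> ((mlt n m \<boxplus> \<rho>\<^sup>\<otimes> (K n)) \<cdot> ((\<i> (K n) \<boxtimes> \<i> (K m) \<boxplus> \<i> (K n) \<boxtimes> ?l) \<cdot> \<delta>\<^sup>l (K n) (K m) (\<zero> \<oplus> \<one>)))"
    unfolding mlt_one_right by simp
  also have "\<dots> = cmb (n * m) n \<cdot> ((mlt n m \<boxplus> \<rho>\<^sup>\<otimes> (K n)) \<cdot> (\<delta>\<^sup>l (K n) (K m) \<one> \<cdot> ?t))"
    by (subst DistL_nat) simp_all
  finally show "(pact (\<delta>\<^sub>\<Sigma> n m (Suc 0)) \<cdot> mlt n (Suc m)) \<cdot> ?t
      = (cmb (n * m) n \<cdot> ((mlt n m \<boxplus> \<rho>\<^sup>\<otimes> (K n)) \<cdot> \<delta>\<^sup>l (K n) (K m) \<one>)) \<cdot> ?t"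
    by simp
qed (auto simp: add.commute)

text \<open>Induction on \<open>m\<close>: the braiding turns the recursion of \<open>mlt m n\<close> along \<open>\<delta>\<^sup>r\<close> into that of \<open>mlt n m\<close> along \<open>\<delta>\<^sup>l\<close>.\<close>

lemma mlt_braid:
  "pact (\<zeta>\<^sub>\<Sigma> n m) \<cdot> mlt n m = mlt m n \<cdot> \<zeta>\<^sup>\<otimes> (K n) (K m)"
proof (induction m)
  case 0
  show ?case using LNull_MulBraid[of "K n"] by (simp add: mlt_zero_right)
next
  case (Suc m)
  have sig: "pact (\<zeta>\<^sub>\<Sigma> n (Suc m)) = pact (block_sum (\<zeta>\<^sub>\<Sigma> n m) (perm_id n)) \<cdot> pact (\<delta>\<^sub>\<Sigma> n m (Suc 0))"
    using Sigma_DistR_MulBraid[of n m 1]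
      pow.pact_comp[of "\<delta>\<^sub>\<Sigma> n m (Suc 0)" "block_sum (\<zeta>\<^sub>\<Sigma> n m) (perm_id n)"]
    by (simp add: add.commute)
  have "pact (\<zeta>\<^sub>\<Sigma> n (Suc m)) \<cdot> mlt n (Suc m)
      = pact (block_sum (\<zeta>\<^sub>\<Sigma> n m) (perm_id n)) \<cdot> (pact (\<delta>\<^sub>\<Sigma> n m (Suc 0)) \<cdot> mlt n (Suc m))"
    unfolding sig by (simp add: add.commute)
  also have "\<dots> = cmb (m * n) n \<cdot> (((pact (\<zeta>\<^sub>\<Sigma> n m) \<cdot> mlt n m) \<boxplus> \<rho>\<^sup>\<otimes> (K n)) \<cdot> \<delta>\<^sup>l (K n) (K m) \<one>)"
    unfolding mlt_Suc_right by (subst pow.pact_sum_comp) (simp_all add: mult.commute)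
  also have "\<dots> = cmb (m * n) n \<cdot> (((mlt m n \<cdot> \<zeta>\<^sup>\<otimes> (K n) (K m)) \<boxplus> (\<lambda>\<^sup>\<otimes> (K n) \<cdot> \<zeta>\<^sup>\<otimes> (K n) \<one>)) \<cdot> \<delta>\<^sup>l (K n) (K m) \<one>)"
    unfolding Suc.IH using mul.braid_runit[of "K n"] by simp
  also have "\<dots> = cmb (m * n) n \<cdot> ((mlt m n \<boxplus> \<lambda>\<^sup>\<otimes> (K n)) \<cdot> ((\<zeta>\<^sup>\<otimes> (K n) (K m) \<boxplus> \<zeta>\<^sup>\<otimes> (K n) \<one>) \<cdot> \<delta>\<^sup>l (K n) (K m) \<one>))"
    by simp
  also have "\<dots> = mlt (Suc m) n \<cdot> \<zeta>\<^sup>\<otimes> (K n) (K (Suc m))"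
    by (subst DistR_MulBraid[symmetric]) simp_all
  finally show ?case .
qed

text \<open>Conjugating \<open>mlt_nat_right\<close> by the braiding would require \<open>\<zeta>\<^sup>\<otimes>\<close> to be a symmetry. Instead the claim is
  composed with the invertible arrow \<open>pact (\<zeta>\<^sub>\<Sigma> m n)\<close>, which moves through both sides by \<open>mlt_braid\<close>.\<close>

lemma mlt_nat_left:
  assumes [simp]: "f \<in> Arr \<Sigma>" "fst f = m"
  shows "pact (f \<boxtimes>\<^sub>\<Sigma> perm_id n) \<cdot> mlt m n = mlt m n \<cdot> (pact f \<boxtimes> \<i> (K n))"
proof (rule add.iso_cancel_left)
  let ?z = "\<zeta>\<^sub>\<Sigma> m n"
  show "is_iso \<C> (pact ?z)" by (rule pow.pact_iso) simp
  have "pact ?z \<cdot> (pact (f \<boxtimes>\<^sub>\<Sigma> perm_id n) \<cdot> mlt m n) = pact (?z \<cdot>\<^sub>\<Sigma> (f \<boxtimes>\<^sub>\<Sigma> perm_id n)) \<cdot> mlt m n"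
    by (subst pow.pact_comp) simp_all
  also have "\<dots> = pact (perm_id n \<boxtimes>\<^sub>\<Sigma> f) \<cdot> (pact ?z \<cdot> mlt m n)"
    using pow.pact_comp[of ?z "perm_id n \<boxtimes>\<^sub>\<Sigma> f"] by (simp add: prod_braid_nat mult.commute)
  also have "\<dots> = (pact (perm_id n \<boxtimes>\<^sub>\<Sigma> f) \<cdot> mlt n m) \<cdot> \<zeta>\<^sup>\<otimes> (K m) (K n)"
    unfolding mlt_braid by simp
  also have "\<dots> = mlt n m \<cdot> (\<zeta>\<^sup>\<otimes> (K m) (K n) \<cdot> (pact f \<boxtimes> \<i> (K n)))"
    unfolding mlt_nat_right[OF assms] by (simp add: mul.braid_nat)
  also have "\<dots> = pact ?z \<cdot> (mlt m n \<cdot> (pact f \<boxtimes> \<i> (K n)))"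
    using add.comp_reduce[OF mlt_braid[of m n], of "pact f \<boxtimes> \<i> (K n)"] by simp
  finally show "pact ?z \<cdot> (pact (f \<boxtimes>\<^sub>\<Sigma> perm_id n) \<cdot> mlt m n) = pact ?z \<cdot> (mlt m n \<cdot> (pact f \<boxtimes> \<i> (K n)))" .
qed auto

lemma mlt_nat:
  assumes [simp]: "f \<in> Arr \<Sigma>" "g \<in> Arr \<Sigma>" "fst f = m" "fst g = n"
  shows "pact (f \<boxtimes>\<^sub>\<Sigma> g) \<cdot> mlt m n = mlt m n \<cdot> (pact f \<boxtimes> pact g)"
proof -
  have "f \<boxtimes>\<^sub>\<Sigma> g = (f \<boxtimes>\<^sub>\<Sigma> perm_id n) \<cdot>\<^sub>\<Sigma> (perm_id m \<boxtimes>\<^sub>\<Sigma> g)"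
    by (subst prod_comp[symmetric]) simp_all
  then have "pact (f \<boxtimes>\<^sub>\<Sigma> g) = pact (f \<boxtimes>\<^sub>\<Sigma> perm_id n) \<cdot> pact (perm_id m \<boxtimes>\<^sub>\<Sigma> g)"
    using pow.pact_comp[of "perm_id m \<boxtimes>\<^sub>\<Sigma> g" "f \<boxtimes>\<^sub>\<Sigma> perm_id n"] by simp
  then have "pact (f \<boxtimes>\<^sub>\<Sigma> g) \<cdot> mlt m n = pact (f \<boxtimes>\<^sub>\<Sigma> perm_id n) \<cdot> (pact (perm_id m \<boxtimes>\<^sub>\<Sigma> g) \<cdot> mlt m n)"
    by simp
  also have "\<dots> = (pact (f \<boxtimes>\<^sub>\<Sigma> perm_id n) \<cdot> mlt m n) \<cdot> (\<i> (K m) \<boxtimes> pact g)"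
    by (simp add: mlt_nat_right)
  finally show ?thesis
    by (simp add: mlt_nat_left)
qed

text \<open>Additivity in the first variable splits the left hand side; the remaining step is the compatibility of
  \<open>\<delta>\<^sup>r\<close> with the multiplicative associator.\<close>

lemma mlt_assoc:
  "mlt (l * m) n \<cdot> (mlt l m \<boxtimes> \<i> (K n))
    = mlt l (m * n) \<cdot> ((\<i> (K l) \<boxtimes> mlt m n) \<cdot> \<alpha>\<^sup>\<otimes> (K l) (K m) (K n))"
proof (induction l)
  case 0
  have "\<lambda>\<^sup>\<bullet> (K (m * n)) \<cdot> (\<i> \<zero> \<boxtimes> mlt m n) = \<lambda>\<^sup>\<bullet> (K m \<otimes> K n)"
    by (simp add: LNull_nat)
  from add.comp_reduce[OF this, of "\<alpha>\<^sup>\<otimes> \<zero> (K m) (K n)"]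
  show ?case
    using LNull_assoc[of "K m" "K n"] by simp
next
  case (Suc l)
  let ?L = "\<lambda>\<^sup>\<otimes>"
  have unit: "mlt m n \<cdot> (?L (K m) \<boxtimes> \<i> (K n)) = ?L (K (m * n)) \<cdot> ((\<i> \<one> \<boxtimes> mlt m n) \<cdot> \<alpha>\<^sup>\<otimes> \<one> (K m) (K n))"
    using mul.lunit_tensor[of "K m" "K n"] mul.lunit_nat[of "mlt m n"]
    by (simp add: add.comp_reduce[OF mul.lunit_nat])
  have "mlt (Suc l * m) n \<cdot> (mlt (Suc l) m \<boxtimes> \<i> (K n))
      = (mlt (l * m + m) n \<cdot> (cmb (l * m) m \<boxtimes> \<i> (K n))) \<cdot>
        (((mlt l m \<boxplus> ?L (K m)) \<boxtimes> \<i> (K n)) \<cdot> (\<delta>\<^sup>r (K l) \<one> (K m) \<boxtimes> \<i> (K n)))"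
    by (simp add: add.commute[of m])
  also have "\<dots> = cmb (l * m * n) (m * n) \<cdot> ((mlt (l * m) n \<boxplus> mlt m n) \<cdot>
        ((\<delta>\<^sup>r (K (l * m)) (K m) (K n) \<cdot> ((mlt l m \<boxplus> ?L (K m)) \<boxtimes> \<i> (K n))) \<cdot> (\<delta>\<^sup>r (K l) \<one> (K m) \<boxtimes> \<i> (K n))))"
    unfolding mlt_add_left by simp
  also have "\<dots> = cmb (l * m * n) (m * n) \<cdot> (((mlt (l * m) n \<cdot> (mlt l m \<boxtimes> \<i> (K n))) \<boxplus> (mlt m n \<cdot> (?L (K m) \<boxtimes> \<i> (K n)))) \<cdot>
        (\<delta>\<^sup>r (K l \<otimes> K m) (\<one> \<otimes> K m) (K n) \<cdot> (\<delta>\<^sup>r (K l) \<one> (K m) \<boxtimes> \<i> (K n))))"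
    by (subst DistR_nat) simp_all
  also have "\<dots> = cmb (l * m * n) (m * n) \<cdot>
        (((mlt l (m * n) \<boxplus> ?L (K (m * n))) \<cdot> (\<i> (K l) \<boxtimes> mlt m n \<boxplus> \<i> \<one> \<boxtimes> mlt m n)) \<cdot>
        ((\<alpha>\<^sup>\<otimes> (K l) (K m) (K n) \<boxplus> \<alpha>\<^sup>\<otimes> \<one> (K m) (K n)) \<cdot> \<delta>\<^sup>r (K l \<otimes> K m) (\<one> \<otimes> K m) (K n) \<cdot> (\<delta>\<^sup>r (K l) \<one> (K m) \<boxtimes> \<i> (K n))))"
    unfolding Suc.IH unit by (simp add: mult.assoc)
  also have "\<dots> = cmb (l * (m * n)) (m * n) \<cdot> ((mlt l (m * n) \<boxplus> ?L (K (m * n))) \<cdot>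
        (((\<i> (K l) \<boxtimes> mlt m n \<boxplus> \<i> \<one> \<boxtimes> mlt m n) \<cdot> \<delta>\<^sup>r (K l) \<one> (K m \<otimes> K n)) \<cdot> \<alpha>\<^sup>\<otimes> (K l \<oplus> \<one>) (K m) (K n)))"
    by (subst DistR_prod_assoc) (simp_all add: mult.assoc)
  also have "(\<i> (K l) \<boxtimes> mlt m n \<boxplus> \<i> \<one> \<boxtimes> mlt m n) \<cdot> \<delta>\<^sup>r (K l) \<one> (K m \<otimes> K n)
      = \<delta>\<^sup>r (K l) \<one> (K (m * n)) \<cdot> ((\<i> (K l) \<boxplus> \<i> \<one>) \<boxtimes> mlt m n)"
    by (subst DistR_nat) simp_all
  also have "cmb (l * (m * n)) (m * n) \<cdot> ((mlt l (m * n) \<boxplus> ?L (K (m * n))) \<cdot>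
        ((\<delta>\<^sup>r (K l) \<one> (K (m * n)) \<cdot> ((\<i> (K l) \<boxplus> \<i> \<one>) \<boxtimes> mlt m n)) \<cdot> \<alpha>\<^sup>\<otimes> (K l \<oplus> \<one>) (K m) (K n)))
      = mlt (Suc l) (m * n) \<cdot> ((\<i> (K (Suc l)) \<boxtimes> mlt m n) \<cdot> \<alpha>\<^sup>\<otimes> (K (Suc l)) (K m) (K n))"
    by simp
  finally show ?case .
qed

end

section \<open>The functor of powers is a robust braided bimonoidal functor\<close>

text \<open>The inverse unitor in \<open>Mul0\<close> appears because \<open>K 1\<close> is \<open>\<zero> \<oplus> \<one>\<close>. The restriction makes the record
  extensional.\<close>

definition (in braided_bimonoidal_category) power_ftor :: "(nat, perm_arr, 'o, 'm) bimon_ftor" where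
  "power_ftor = \<lparr>FObj = K, FArr = restrict pact (Arr \<Sigma>), Add2 = cmb, Add0 = \<i> \<zero>,
     Mul2 = mlt, Mul0 = inv_arr \<C> (\<lambda>\<^sup>\<oplus> \<one>)\<rparr>"

theorem power_ftor_robust:
  fixes \<D> :: "('o, 'm) braided_bimon" (structure)
  assumes "braided_bimonoidal_category \<D>"
  shows "braided_bimonoidal_category.power_ftor \<D> \<in> robust_ftors \<Sigma> \<D>"
proof -
  interpret D: braided_bimonoidal_category \<D> by (rule assms)
  interpret S: braided_bimonoidal_category \<Sigma> by (rule Sigma_braided_bimonoidal)
  let ?F = D.power_ftor
  have F [simp]: "FObj ?F = D.K" "Add2 ?F = D.cmb" "Add0 ?F = \<i> \<zero>" "Mul2 ?F = D.mlt"
      "Mul0 ?F = inv_arr \<D> (\<lambda>\<^sup>\<oplus> \<one>)" "\<And>f. f \<in> Arr \<Sigma> \<Longrightarrow> FArr ?F f = D.pact f"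
    by (simp_all add: D.power_ftor_def)
  interpret add: braided_monoidal_functor \<Sigma> "AddM \<Sigma>" "AddBraid \<Sigma>" \<D> "AddM \<D>" "AddBraid \<D>" ?F "Add2 ?F" "Add0 ?F"
    using D.pow.powers_functor[of ?F] by simp
  have inv [simp]: "inv_arr \<D> (\<lambda>\<^sup>\<oplus> \<one>) \<in> Arr \<D>" "Dom \<D> (inv_arr \<D> (\<lambda>\<^sup>\<oplus> \<one>)) = \<one>"
      "Cod \<D> (inv_arr \<D> (\<lambda>\<^sup>\<oplus> \<one>)) = D.K 1"
      "\<lambda>\<^sup>\<oplus> \<one> \<cdot> inv_arr \<D> (\<lambda>\<^sup>\<oplus> \<one>) = \<i> \<one>"
    using D.add.inv_arr_simps[OF D.add.lunit_iso[of "\<one>"]] by simp_all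
  interpret mul: braided_monoidal_functor \<Sigma> "MulM \<Sigma>" "MulBraid \<Sigma>" \<D> "MulM \<D>" "MulBraid \<D>" ?F "Mul2 ?F" "Mul0 ?F"
  proof unfold_locales
    fix f g :: perm_arr and m m' n n'
    assume "f \<in> hom \<Sigma> m m'" "g \<in> hom \<Sigma> n n'"
    then show "Mul2 ?F m' n' \<cdot> (FArr ?F f \<boxtimes> FArr ?F g) = FArr ?F (f \<boxtimes>\<^sub>\<Sigma> g) \<cdot> Mul2 ?F m n"
      by (auto simp: hom_iff D.mlt_nat)
  next
    fix l m n :: nat
    show "FArr ?F (\<alpha>\<^sup>\<otimes>\<^bsub>\<Sigma>\<^esub> l m n) \<cdot> Mul2 ?F (l \<otimes>\<^bsub>\<Sigma>\<^esub> m) n \<cdot> (Mul2 ?F l m \<boxtimes> \<i> (FObj ?F n))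
      = Mul2 ?F l (m \<otimes>\<^bsub>\<Sigma>\<^esub> n) \<cdot> (\<i> (FObj ?F l) \<boxtimes> Mul2 ?F m n)
        \<cdot> \<alpha>\<^sup>\<otimes> (FObj ?F l) (FObj ?F m) (FObj ?F n)"
      using D.mlt_assoc[of l m n] by (simp add: mult.assoc)
  next
    fix n :: nat
    show "FArr ?F (\<lambda>\<^sup>\<otimes>\<^bsub>\<Sigma>\<^esub> n) \<cdot> Mul2 ?F \<one>\<^bsub>\<Sigma>\<^esub> n \<cdot> (Mul0 ?F \<boxtimes> \<i> (FObj ?F n)) = \<lambda>\<^sup>\<otimes> (FObj ?F n)"
      using D.mlt_one_left[of n] by (simp del: D.mlt.simps)
    show "FArr ?F (\<rho>\<^sup>\<otimes>\<^bsub>\<Sigma>\<^esub> n) \<cdot> Mul2 ?F n \<one>\<^bsub>\<Sigma>\<^esub> \<cdot> (\<i> (FObj ?F n) \<boxtimes> Mul0 ?F) = \<rho>\<^sup>\<otimes> (FObj ?F n)"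
      using D.mlt_one_right[of n] by simp
  next
    fix m n :: nat
    show "FArr ?F (\<zeta>\<^sub>\<Sigma> m n) \<cdot> Mul2 ?F m n = Mul2 ?F n m \<cdot> \<zeta>\<^sup>\<otimes> (FObj ?F m) (FObj ?F n)"
      by (simp add: D.mlt_braid)
  qed (simp_all add: hom_iff)
  have "robust_braided_bimonoidal_functor \<Sigma> \<D> ?F"
  proof unfold_locales
    fix m n p :: nat
    show "FArr ?F (\<delta>\<^sub>\<Sigma> m n p) \<cdot> Mul2 ?F m (n \<oplus>\<^bsub>\<Sigma>\<^esub> p) \<cdot> (\<i> (FObj ?F m) \<boxtimes> Add2 ?F n p)
      = Add2 ?F (m \<otimes>\<^bsub>\<Sigma>\<^esub> n) (m \<otimes>\<^bsub>\<Sigma>\<^esub> p) \<cdot> (Mul2 ?F m n \<boxplus> Mul2 ?F m p)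
        \<cdot> \<delta>\<^sup>l (FObj ?F m) (FObj ?F n) (FObj ?F p)"
      using D.mlt_add_right[of m n p] by (simp add: add_mult_distrib2)
  qed (simp_all add: D.pow.cmb_iso D.add.is_iso_ident D.add.is_iso_inv D.add.lunit_iso)
  moreover have "bimon_ftor_extensional \<Sigma> ?F"
    by (simp add: bimon_ftor_extensional_def D.power_ftor_def extensional_def)
  ultimately show ?thesis
    by (simp add: robust_ftors_def)
qed


section \<open>Every robust functor is uniquely isomorphic to the functor of powers\<close>

context cat_functor
begin

lemma FObj_Obj [simp]: "A \<in> Obj \<C> \<Longrightarrow> FObj F A \<in> Obj \<D>"
  by (rule FObj_in_Obj)

lemma FArr_simps [simp]:
  assumes "f \<in> Arr \<C>"
  shows "FArr F f \<in> Arr \<D>" "Dom \<D> (FArr F f) = FObj F (Dom \<C> f)" "Cod \<D> (FArr F f) = FObj F (Cod \<C> f)"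
  using FArr_in_hom[of f "Dom \<C> f" "Cod \<C> f"] assms by (auto simp: hom_iff)

lemma FArr_comp_simp:
  "f \<in> Arr \<C> \<Longrightarrow> g \<in> Arr \<C> \<Longrightarrow> Dom \<C> g = Cod \<C> f \<Longrightarrow> FArr F (g \<cdot>\<^bsub>\<C>\<^esub> f) = FArr F g \<cdot> FArr F f"
  using FArr_comp[of f "Dom \<C> f" "Cod \<C> f" g "Cod \<C> g"] by (auto simp: hom_iff)

lemma FArr_iso:
  assumes "is_iso \<C> f"
  shows "is_iso \<D> (FArr F f)"
proof -
  from dom.is_isoE[OF assms] obtain g where g: "f \<in> Arr \<C>" "g \<in> Arr \<C>" "Dom \<C> g = Cod \<C> f" "Cod \<C> g = Dom \<C> f"
    "g \<cdot>\<^bsub>\<C>\<^esub> f = \<i>\<^bsub>\<C>\<^esub> (Dom \<C> f)" "f \<cdot>\<^bsub>\<C>\<^esub> g = \<i>\<^bsub>\<C>\<^esub> (Cod \<C> f)" .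
  then have "FArr F g \<cdot> FArr F f = \<i> (FObj F (Dom \<C> f))" "FArr F f \<cdot> FArr F g = \<i> (FObj F (Cod \<C> f))"
    by (simp_all add: FArr_ident flip: FArr_comp_simp)
  with g show ?thesis
    by (intro cod.is_isoI[of _ "FArr F g"]) simp_all
qed

end

context monoidal_functor
begin

lemma F0_simps [simp]: "F0 \<in> Arr \<D>" "Dom \<D> F0 = \<e>\<^bsub>N\<^esub>" "Cod \<D> F0 = FObj F \<e>\<^bsub>M\<^esub>"
  using F0_in_hom by (auto simp: hom_iff)

lemma F2_simps [simp]:
  assumes "A \<in> Obj \<C>" "B \<in> Obj \<C>"
  shows "F2 A B \<in> Arr \<D>" "Dom \<D> (F2 A B) = FObj F A \<odot>\<^bsub>N\<^esub> FObj F B" "Cod \<D> (F2 A B) = FObj F (A \<odot>\<^bsub>M\<^esub> B)"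
  using F2_in_hom[OF assms] by (auto simp: hom_iff)

lemma F2_nat:
  assumes "f \<in> Arr \<C>" "g \<in> Arr \<C>" "Dom \<C> f = A" "Dom \<C> g = B"
  shows "FArr F (f \<star>\<^bsub>M\<^esub> g) \<cdot> F2 A B = F2 (Cod \<C> f) (Cod \<C> g) \<cdot> (FArr F f \<star>\<^bsub>N\<^esub> FArr F g)"
  using F2_natural[of f A "Cod \<C> f" g B "Cod \<C> g"] assms by (auto simp: hom_iff)

end

text \<open>The compatibility of a functor with \<open>\<delta>\<^sup>l\<close> turns into one with \<open>\<delta>\<^sup>r\<close> by conjugating with the braidings.\<close>

lemma (in braided_bimonoidal_functor) F_DistR:
  assumes [simp]: "A \<in> Obj \<C>" "B \<in> Obj \<C>" "C \<in> Obj \<C>"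
  shows "FArr F (\<delta>\<^sup>r\<^bsub>\<C>\<^esub> A B C) \<cdot> (Mul2 F (A \<oplus>\<^bsub>\<C>\<^esub> B) C \<cdot> (Add2 F A B \<boxtimes> \<i> (FObj F C)))
    = Add2 F (A \<otimes>\<^bsub>\<C>\<^esub> C) (B \<otimes>\<^bsub>\<C>\<^esub> C) \<cdot> ((Mul2 F A C \<boxplus> Mul2 F B C) \<cdot> \<delta>\<^sup>r (FObj F A) (FObj F B) (FObj F C))"
  (is "?l = ?r")
proof (rule target.add.iso_cancel_left)
  let ?z = "\<zeta>\<^sup>\<otimes>\<^bsub>\<C>\<^esub> A C \<boxplus>\<^bsub>\<C>\<^esub> \<zeta>\<^sup>\<otimes>\<^bsub>\<C>\<^esub> B C"
  let ?A = "FObj F A" and ?B = "FObj F B" and ?C = "FObj F C"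
  show "is_iso \<D> (FArr F ?z)"
    by (intro add.FArr_iso source.add.is_iso_tensor source.mul.braid_iso) simp_all
  have "FArr F ?z \<cdot> FArr F (\<delta>\<^sup>r\<^bsub>\<C>\<^esub> A B C) = FArr F (?z \<cdot>\<^bsub>\<C>\<^esub> \<delta>\<^sup>r\<^bsub>\<C>\<^esub> A B C)"
    by (subst add.FArr_comp_simp) simp_all
  also have "\<dots> = FArr F (\<delta>\<^sup>l\<^bsub>\<C>\<^esub> C A B) \<cdot> FArr F (\<zeta>\<^sup>\<otimes>\<^bsub>\<C>\<^esub> (A \<oplus>\<^bsub>\<C>\<^esub> B) C)"
    by (subst source.DistL_MulBraid[symmetric]) (simp_all add: add.FArr_comp_simp)
  finally have z: "FArr F ?z \<cdot> FArr F (\<delta>\<^sup>r\<^bsub>\<C>\<^esub> A B C) = \<dots>" .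
  have "FArr F ?z \<cdot> ?l
      = (FArr F ?z \<cdot> FArr F (\<delta>\<^sup>r\<^bsub>\<C>\<^esub> A B C)) \<cdot> (Mul2 F (A \<oplus>\<^bsub>\<C>\<^esub> B) C \<cdot> (Add2 F A B \<boxtimes> \<i> ?C))"
    by simp
  also have "\<dots> = FArr F (\<delta>\<^sup>l\<^bsub>\<C>\<^esub> C A B) \<cdot> ((FArr F (\<zeta>\<^sup>\<otimes>\<^bsub>\<C>\<^esub> (A \<oplus>\<^bsub>\<C>\<^esub> B) C) \<cdot> Mul2 F (A \<oplus>\<^bsub>\<C>\<^esub> B) C) \<cdot> (Add2 F A B \<boxtimes> \<i> ?C))"
    unfolding z by simp
  also have "\<dots> = FArr F (\<delta>\<^sup>l\<^bsub>\<C>\<^esub> C A B) \<cdot> (Mul2 F C (A \<oplus>\<^bsub>\<C>\<^esub> B) \<cdot> (\<zeta>\<^sup>\<otimes> (FObj F (A \<oplus>\<^bsub>\<C>\<^esub> B)) ?C \<cdot> (Add2 F A B \<boxtimes> \<i> ?C)))"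
    by (subst mul.F2_braid) simp_all
  also have "\<dots> = (FArr F (\<delta>\<^sup>l\<^bsub>\<C>\<^esub> C A B) \<cdot> Mul2 F C (A \<oplus>\<^bsub>\<C>\<^esub> B) \<cdot> (\<i> ?C \<boxtimes> Add2 F A B)) \<cdot> \<zeta>\<^sup>\<otimes> (?A \<oplus> ?B) ?C"
    by (simp add: target.mul.braid_nat)
  also have "\<dots> = Add2 F (C \<otimes>\<^bsub>\<C>\<^esub> A) (C \<otimes>\<^bsub>\<C>\<^esub> B) \<cdot> ((Mul2 F C A \<boxplus> Mul2 F C B) \<cdot> (\<delta>\<^sup>l ?C ?A ?B \<cdot> \<zeta>\<^sup>\<otimes> (?A \<oplus> ?B) ?C))"
    by (subst F_DistL) simp_all
  also have "\<dots> = Add2 F (C \<otimes>\<^bsub>\<C>\<^esub> A) (C \<otimes>\<^bsub>\<C>\<^esub> B) \<cdot>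
      (((Mul2 F C A \<cdot> \<zeta>\<^sup>\<otimes> ?A ?C) \<boxplus> (Mul2 F C B \<cdot> \<zeta>\<^sup>\<otimes> ?B ?C)) \<cdot> \<delta>\<^sup>r ?A ?B ?C)"
    by (subst target.DistL_MulBraid) simp_all
  also have "\<dots> = (Add2 F (C \<otimes>\<^bsub>\<C>\<^esub> A) (C \<otimes>\<^bsub>\<C>\<^esub> B) \<cdot> (FArr F (\<zeta>\<^sup>\<otimes>\<^bsub>\<C>\<^esub> A C) \<boxplus> FArr F (\<zeta>\<^sup>\<otimes>\<^bsub>\<C>\<^esub> B C))) \<cdot>
      ((Mul2 F A C \<boxplus> Mul2 F B C) \<cdot> \<delta>\<^sup>r ?A ?B ?C)"
    by (simp flip: mul.F2_braid)
  also have "\<dots> = (FArr F ?z \<cdot> Add2 F (A \<otimes>\<^bsub>\<C>\<^esub> C) (B \<otimes>\<^bsub>\<C>\<^esub> C)) \<cdot> ((Mul2 F A C \<boxplus> Mul2 F B C) \<cdot> \<delta>\<^sup>r ?A ?B ?C)"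
    by (subst add.F2_nat) simp_all
  finally show "FArr F ?z \<cdot> ?l = FArr F ?z \<cdot> ?r"
    by simp
qed simp_all

lemma Sigma_adj_block_sum:
  assumes "1 \<le> i" "i < n"
  shows "(n, adj i) = block_sum (block_sum (perm_id (i - 1)) (block_swap 1 1)) (perm_id (n - Suc i))"
  using assms by (auto simp: block_sum_def block_swap_def perm_id_def Let_def transpose_def fun_eq_iff)

text \<open>An adjacent transposition is the sum of the swap of two points with identities, so this swap
  generates all arrows under composition and sums.\<close>

lemma Sigma_induct [consumes 1, case_names ident comp sum swap]:
  assumes f: "f \<in> Arr \<Sigma>"
    and ident: "\<And>n. P (perm_id n)"
    and comp: "\<And>f g. f \<in> Arr \<Sigma> \<Longrightarrow> g \<in> Arr \<Sigma> \<Longrightarrow> fst f = fst g \<Longrightarrow> P f \<Longrightarrow> P g \<Longrightarrow> P (g \<cdot>\<^sub>\<Sigma> f)"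
    and sum: "\<And>f g. f \<in> Arr \<Sigma> \<Longrightarrow> g \<in> Arr \<Sigma> \<Longrightarrow> P f \<Longrightarrow> P g \<Longrightarrow> P (block_sum f g)"
    and swap: "P (block_swap 1 1)"
  shows "P f"
proof -
  have adj: "P (n, adj i)" if "1 \<le> i" "i < n" for i n
    unfolding Sigma_adj_block_sum[OF that] by (intro sum ident swap) simp_all
  obtain n \<sigma> where n: "f = (n, \<sigma>)" by (cases f)
  with f have "\<sigma> permutes {1..n}" by (simp add: Sigma_Arr_iff)
  then have "P (n, \<sigma>)"
  proof (induction rule: permutes_adj_induct)
    case id
    show "P (n, id)" using ident[of n] by (simp add: perm_id_def)
  next
    case (adj i \<tau>)
    have "P ((n, adj i) \<cdot>\<^sub>\<Sigma> (n, \<tau>))"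
      using adj.hyps adj.IH adj_permutes[OF adj.hyps(1,2)] \<open>\<And>n i. 1 \<le> i \<Longrightarrow> i < n \<Longrightarrow> P (n, adj i)\<close>
      by (intro comp) (simp_all add: Sigma_Arr_iff)
    then show "P (n, adj i \<circ> \<tau>)" by (simp add: Sigma_prime_def)
  qed
  then show ?thesis by (simp add: n)
qed

locale power_comparison = robust_braided_bimonoidal_functor Sigma_prime \<D> F
  for \<D> :: "('o, 'm) braided_bimon" (structure) and F
begin

abbreviation K where "K \<equiv> target.K"
abbreviation cmb where "cmb \<equiv> target.cmb"
abbreviation pact where "pact \<equiv> target.pact"
abbreviation mlt where "mlt \<equiv> target.mlt"
abbreviation P where "P \<equiv> target.power_ftor"

text \<open>The components that compatibility with zero, one and sums forces on a transformation from the functor of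
  powers to \<open>F\<close>.\<close>

primrec cmp :: "nat \<Rightarrow> 'm" where
  "cmp 0 = Add0 F"
| "cmp (Suc n) = Add2 F n 1 \<cdot> (cmp n \<boxplus> Mul0 F)"

lemma structure_simps [simp]:
  "FObj F n \<in> Obj \<D>" "Add0 F \<in> Arr \<D>" "Dom \<D> (Add0 F) = \<zero>" "Cod \<D> (Add0 F) = FObj F 0"
  "Mul0 F \<in> Arr \<D>" "Dom \<D> (Mul0 F) = \<one>" "Cod \<D> (Mul0 F) = FObj F (Suc 0)"
  "Add2 F m n \<in> Arr \<D>" "Dom \<D> (Add2 F m n) = FObj F m \<oplus> FObj F n" "Cod \<D> (Add2 F m n) = FObj F (m + n)"
  "Mul2 F m n \<in> Arr \<D>" "Dom \<D> (Mul2 F m n) = FObj F m \<otimes> FObj F n" "Cod \<D> (Mul2 F m n) = FObj F (m * n)"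
  "FArr F (perm_id n) = \<i> (FObj F n)"
  using add.F0_simps mul.F0_simps add.F2_simps[of m n] mul.F2_simps[of m n] add.FArr_ident[of n] by simp_all

lemma FArr_Sigma_simps [simp]:
  "f \<in> Arr \<Sigma> \<Longrightarrow> FArr F f \<in> Arr \<D>" "f \<in> Arr \<Sigma> \<Longrightarrow> Dom \<D> (FArr F f) = FObj F (fst f)"
  "f \<in> Arr \<Sigma> \<Longrightarrow> Cod \<D> (FArr F f) = FObj F (fst f)"
  using add.FArr_simps[of f] by simp_all

lemma cmp_simps [simp]: "cmp n \<in> Arr \<D>" "Dom \<D> (cmp n) = K n" "Cod \<D> (cmp n) = FObj F n"
  by (induction n) simp_all

lemma cmp_iso: "is_iso \<D> (cmp n)"
proof (induction n)
  case 0
  show ?case by (simp add: Add0_iso)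
next
  case (Suc n)
  then have "is_iso \<D> (cmp n \<boxplus> Mul0 F)"
    by (intro target.add.is_iso_tensor Mul0_iso)
  then show ?case
    using Add2_iso[of n 1] by (auto intro: target.add.is_iso_comp)
qed

lemma cmp_sum: "cmp (m + n) \<cdot> cmb m n = Add2 F m n \<cdot> (cmp m \<boxplus> cmp n)"
proof (induction n)
  case 0
  have "Add2 F m 0 \<cdot> (cmp m \<boxplus> Add0 F) = (Add2 F m 0 \<cdot> (\<i> (FObj F m) \<boxplus> Add0 F)) \<cdot> (cmp m \<boxplus> \<i> \<zero>)"
    by simp
  also have "Add2 F m 0 \<cdot> (\<i> (FObj F m) \<boxplus> Add0 F) = \<rho>\<^sup>\<oplus> (FObj F m)"
    using add.F2_runit[of m] by simp
  finally show ?case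
    by (simp add: target.add.runit_nat)
next
  case (Suc n)
  have assoc: "Add2 F (m + n) 1 \<cdot> (Add2 F m n \<boxplus> \<i> (FObj F 1))
      = Add2 F m (Suc n) \<cdot> ((\<i> (FObj F m) \<boxplus> Add2 F n 1) \<cdot> \<alpha>\<^sup>\<oplus> (FObj F m) (FObj F n) (FObj F 1))"
    using add.F2_assoc[of m n 1] by simp
  have "cmp (m + Suc n) \<cdot> cmb m (Suc n)
      = Add2 F (m + n) 1 \<cdot> (((cmp (m + n) \<cdot> cmb m n) \<boxplus> Mul0 F) \<cdot> target.add.assoc_inv (K m) (K n) \<one>)"
    by simp
  also have "\<dots> = (Add2 F (m + n) 1 \<cdot> (Add2 F m n \<boxplus> \<i> (FObj F 1))) \<cdot>
      (((cmp m \<boxplus> cmp n) \<boxplus> Mul0 F) \<cdot> target.add.assoc_inv (K m) (K n) \<one>)"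
    unfolding Suc.IH by simp
  also have "\<dots> = Add2 F m (Suc n) \<cdot> (cmp m \<boxplus> cmp (Suc n))"
    unfolding assoc by (simp add: target.add.comp_reduce[OF target.add.assoc_nat])
  finally show ?case .
qed

lemma cmp_nat: "f \<in> Arr \<Sigma> \<Longrightarrow> FArr F f \<cdot> cmp (fst f) = cmp (fst f) \<cdot> pact f"
proof (induction rule: Sigma_induct)
  case (ident n)
  show ?case by simp
next
  case (comp f g)
  have "FArr F (g \<cdot>\<^sub>\<Sigma> f) \<cdot> cmp (fst f) = FArr F g \<cdot> (FArr F f \<cdot> cmp (fst f))"
    using comp.hyps by (simp add: add.FArr_comp_simp)
  also have "\<dots> = (FArr F g \<cdot> cmp (fst g)) \<cdot> pact f"
    unfolding comp.IH(1) using comp.hyps by simp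
  also have "\<dots> = cmp (fst f) \<cdot> pact (g \<cdot>\<^sub>\<Sigma> f)"
    unfolding comp.IH(2) using comp.hyps by (simp add: target.pow.pact_comp)
  finally show ?case by simp
next
  case (sum f g)
  have "(FArr F (block_sum f g) \<cdot> cmp (fst f + fst g)) \<cdot> cmb (fst f) (fst g)
      = (FArr F (block_sum f g) \<cdot> Add2 F (fst f) (fst g)) \<cdot> (cmp (fst f) \<boxplus> cmp (fst g))"
    using sum.hyps by (simp add: cmp_sum)
  also have "\<dots> = Add2 F (fst f) (fst g) \<cdot> ((FArr F f \<cdot> cmp (fst f)) \<boxplus> (FArr F g \<cdot> cmp (fst g)))"
    using add.F2_nat[of f g "fst f" "fst g"] sum.hyps by simp
  also have "\<dots> = (Add2 F (fst f) (fst g) \<cdot> (cmp (fst f) \<boxplus> cmp (fst g))) \<cdot> (pact f \<boxplus> pact g)"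
    unfolding sum.IH by simp
  also have "\<dots> = (cmp (fst f + fst g) \<cdot> pact (block_sum f g)) \<cdot> cmb (fst f) (fst g)"
    unfolding cmp_sum[symmetric] using sum.hyps by (simp add: target.pow.pact_sum)
  finally show ?case
    using sum.hyps by - (rule target.add.iso_cancel_right[OF target.pow.cmb_iso[of "fst f" "fst g"]], simp_all)
next
  case swap
  have "(FArr F (block_swap 1 1) \<cdot> cmp 2) \<cdot> cmb 1 1 = (FArr F (block_swap 1 1) \<cdot> Add2 F 1 1) \<cdot> (cmp 1 \<boxplus> cmp 1)"
    using cmp_sum[of 1 1] by (simp add: numeral_2_eq_2 del: cmp.simps target.pow.cmb.simps target.pow.pw.simps)
  also have "\<dots> = Add2 F 1 1 \<cdot> (\<zeta>\<^sup>\<oplus> (FObj F 1) (FObj F 1) \<cdot> (cmp 1 \<boxplus> cmp 1))"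
    using add.F2_braid[of 1 1] by (simp del: cmp.simps)
  also have "\<dots> = (Add2 F 1 1 \<cdot> (cmp 1 \<boxplus> cmp 1)) \<cdot> \<zeta>\<^sup>\<oplus> (K 1) (K 1)"
    by (simp add: target.add.braid_nat del: cmp.simps target.pow.pw.simps)
  also have "\<dots> = cmp 2 \<cdot> (cmb 1 1 \<cdot> \<zeta>\<^sup>\<oplus> (K 1) (K 1))"
    unfolding cmp_sum[symmetric] by (simp add: numeral_2_eq_2 del: cmp.simps target.pow.cmb.simps target.pow.pw.simps)
  also have "\<dots> = (cmp 2 \<cdot> pact (block_swap 1 1)) \<cdot> cmb 1 1"
    unfolding target.pow.pact_swap[symmetric]
    by (simp add: numeral_2_eq_2 del: cmp.simps target.pow.cmb.simps target.pow.pw.simps)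
  finally have "FArr F (block_swap 1 1) \<cdot> cmp 2 = cmp 2 \<cdot> pact (block_swap 1 1)"
    by - (rule target.add.iso_cancel_right[OF target.pow.cmb_iso[of 1 1]],
        simp_all add: numeral_2_eq_2 del: cmp.simps target.pow.cmb.simps target.pow.pw.simps)
  then show ?case by (simp add: numeral_2_eq_2 del: cmp.simps)
qed

lemma cmp_one: "cmp 1 = Mul0 F \<cdot> \<lambda>\<^sup>\<oplus> \<one>"
proof -
  have "cmp 1 = (Add2 F 0 1 \<cdot> (Add0 F \<boxplus> \<i> (FObj F 1))) \<cdot> (\<i> \<zero> \<boxplus> Mul0 F)"
    by simp
  also have "Add2 F 0 1 \<cdot> (Add0 F \<boxplus> \<i> (FObj F 1)) = \<lambda>\<^sup>\<oplus> (FObj F 1)"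
    using add.F2_lunit[of 1] by simp
  finally show ?thesis
    by (simp add: target.add.lunit_nat)
qed

text \<open>Induction on \<open>m\<close>, where both products are computed along \<open>\<delta>\<^sup>r\<close>.\<close>

lemma cmp_prod: "cmp (m * n) \<cdot> mlt m n = Mul2 F m n \<cdot> (cmp m \<boxtimes> cmp n)"
proof (induction m)
  case 0
  have "Mul2 F 0 n \<cdot> (Add0 F \<boxtimes> cmp n) = (Mul2 F 0 n \<cdot> (Add0 F \<boxtimes> \<i> (FObj F n))) \<cdot> (\<i> \<zero> \<boxtimes> cmp n)"
    by simp
  also have "Mul2 F 0 n \<cdot> (Add0 F \<boxtimes> \<i> (FObj F n)) = Add0 F \<cdot> \<lambda>\<^sup>\<bullet> (FObj F n)"
    using F_LNull[of n] by simp
  finally show ?case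
    by (simp add: target.LNull_nat)
next
  case (Suc m)
  have unit: "cmp n \<cdot> \<lambda>\<^sup>\<otimes> (K n) = Mul2 F 1 n \<cdot> (Mul0 F \<boxtimes> cmp n)"
  proof -
    have "cmp n \<cdot> \<lambda>\<^sup>\<otimes> (K n) = \<lambda>\<^sup>\<otimes> (FObj F n) \<cdot> (\<i> \<one> \<boxtimes> cmp n)"
      by (simp add: target.mul.lunit_nat)
    also have "\<lambda>\<^sup>\<otimes> (FObj F n) = Mul2 F 1 n \<cdot> (Mul0 F \<boxtimes> \<i> (FObj F n))"
      using mul.F2_lunit[of n] by simp
    finally show ?thesis by simp
  qed
  have "cmp (Suc m * n) \<cdot> mlt (Suc m) n
      = (cmp (m * n + n) \<cdot> cmb (m * n) n) \<cdot> ((mlt m n \<boxplus> \<lambda>\<^sup>\<otimes> (K n)) \<cdot> \<delta>\<^sup>r (K m) \<one> (K n))"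
    by (simp add: add.commute[of n])
  also have "\<dots> = Add2 F (m * n) n \<cdot> (((cmp (m * n) \<cdot> mlt m n) \<boxplus> (cmp n \<cdot> \<lambda>\<^sup>\<otimes> (K n))) \<cdot> \<delta>\<^sup>r (K m) \<one> (K n))"
    unfolding cmp_sum by simp
  also have "\<dots> = Add2 F (m * n) n \<cdot> ((Mul2 F m n \<boxplus> Mul2 F 1 n) \<cdot>
      ((cmp m \<boxtimes> cmp n \<boxplus> Mul0 F \<boxtimes> cmp n) \<cdot> \<delta>\<^sup>r (K m) \<one> (K n)))"
    unfolding Suc.IH unit by simp
  also have "\<dots> = Add2 F (m * n) n \<cdot> ((Mul2 F m n \<boxplus> Mul2 F 1 n) \<cdot>
      (\<delta>\<^sup>r (FObj F m) (FObj F 1) (FObj F n) \<cdot> ((cmp m \<boxplus> Mul0 F) \<boxtimes> cmp n)))"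
    by (subst target.DistR_nat) simp_all
  also have "\<dots> = (Add2 F (m * n) n \<cdot> ((Mul2 F m n \<boxplus> Mul2 F 1 n) \<cdot>
      \<delta>\<^sup>r (FObj F m) (FObj F 1) (FObj F n))) \<cdot> ((cmp m \<boxplus> Mul0 F) \<boxtimes> cmp n)"
    by simp
  also have "Add2 F (m * n) n \<cdot> ((Mul2 F m n \<boxplus> Mul2 F 1 n) \<cdot> \<delta>\<^sup>r (FObj F m) (FObj F 1) (FObj F n))
      = Mul2 F (Suc m) n \<cdot> (Add2 F m 1 \<boxtimes> \<i> (FObj F n))"
    using F_DistR[of m 1 n] by (simp add: add.commute[of n])
  finally show ?case by simp
qed

lemma power_ftor_simps [simp]:
  "FObj P = K" "Add2 P = cmb" "Add0 P = \<i> \<zero>" "Mul2 P = mlt"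
  "Mul0 P = inv_arr \<D> (\<lambda>\<^sup>\<oplus> \<one>)" "\<And>f. f \<in> Arr \<Sigma> \<Longrightarrow> FArr P f = pact f"
  by (simp_all add: target.power_ftor_def)

lemma lunit_one_inv [simp]:
  "inv_arr \<D> (\<lambda>\<^sup>\<oplus> \<one>) \<in> Arr \<D>" "Dom \<D> (inv_arr \<D> (\<lambda>\<^sup>\<oplus> \<one>)) = \<one>" "Cod \<D> (inv_arr \<D> (\<lambda>\<^sup>\<oplus> \<one>)) = \<zero> \<oplus> \<one>"
  "\<lambda>\<^sup>\<oplus> \<one> \<cdot> inv_arr \<D> (\<lambda>\<^sup>\<oplus> \<one>) = \<i> \<one>" "inv_arr \<D> (\<lambda>\<^sup>\<oplus> \<one>) \<cdot> \<lambda>\<^sup>\<oplus> \<one> = \<i> (\<zero> \<oplus> \<one>)"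
  using target.add.inv_arr_simps[OF target.add.lunit_iso[of \<one>]] by simp_all

theorem cmp_transformation: "bimonoidal_nat_trans \<Sigma> \<D> P F cmp"
proof -
  interpret P: robust_braided_bimonoidal_functor \<Sigma> \<D> P
    using power_ftor_robust[OF target.braided_bimonoidal_category_axioms] by (simp add: robust_ftors_def)
  interpret nat_trans \<Sigma> \<D> P F cmp
    by unfold_locales (auto simp: hom_iff cmp_nat)
  show ?thesis
  proof unfold_locales
    show "cmp \<e>\<^bsub>MulM \<Sigma>\<^esub> \<cdot> Mul0 P = Mul0 F"
      using cmp_one by (simp del: cmp.simps)
  qed (simp_all add: cmp_sum cmp_prod)
qed

theorem cmp_unique:
  assumes "bimonoidal_nat_trans \<Sigma> \<D> P F \<tau>"
  shows "\<tau> n = cmp n"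
proof -
  interpret bimonoidal_nat_trans \<Sigma> \<D> P F \<tau> by (rule assms)
  have [simp]: "\<tau> n \<in> Arr \<D>" "Dom \<D> (\<tau> n) = K n" "Cod \<D> (\<tau> n) = FObj F n" for n
    using add.component_in_hom[of n] by (simp_all add: hom_iff)
  have one: "\<tau> 1 = Mul0 F \<cdot> \<lambda>\<^sup>\<oplus> \<one>"
  proof -
    have "\<tau> 1 = (\<tau> 1 \<cdot> inv_arr \<D> (\<lambda>\<^sup>\<oplus> \<one>)) \<cdot> \<lambda>\<^sup>\<oplus> \<one>" by simp
    also have "\<tau> 1 \<cdot> inv_arr \<D> (\<lambda>\<^sup>\<oplus> \<one>) = Mul0 F"
      using mul.component_unit by simp
    finally show ?thesis .
  qed
  show ?thesis
  proof (induction n)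
    case 0
    show ?case using add.component_unit by simp
  next
    case (Suc n)
    show ?case
    proof (rule target.add.iso_cancel_right[OF target.pow.cmb_iso[of n 1]])
      have "\<tau> (Suc n) \<cdot> cmb n 1 = Add2 F n 1 \<cdot> (\<tau> n \<boxplus> \<tau> 1)"
        using add.component_tensor[of n 1] by simp
      also have "\<dots> = cmp (Suc n) \<cdot> cmb n 1"
        unfolding Suc.IH one cmp_one[symmetric] cmp_sum[symmetric] by simp
      finally show "\<tau> (Suc n) \<cdot> cmb n 1 = cmp (Suc n) \<cdot> cmb n 1" .
    qed simp_all
  qed
qed

end

section \<open>The hom-category of robust functors\<close>

lemma nat_trans_comp:
  fixes \<D> :: "('p, 'n, 'y) cat_scheme" (structure)
  assumes "nat_trans \<C> \<D> F G \<sigma>" "nat_trans \<C> \<D> G H \<tau>"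
  shows "nat_trans \<C> \<D> F H (\<lambda>A\<in>Obj \<C>. \<tau> A \<cdot> \<sigma> A)"
proof -
  interpret s: nat_trans \<C> \<D> F G \<sigma> by (rule assms)
  interpret t: nat_trans \<C> \<D> G H \<tau> by (rule assms)
  have s [simp]: "\<sigma> A \<in> Arr \<D>" "Dom \<D> (\<sigma> A) = FObj F A" "Cod \<D> (\<sigma> A) = FObj G A" if "A \<in> Obj \<C>" for A
    using s.component_in_hom[OF that] by (simp_all add: hom_iff)
  have t [simp]: "\<tau> A \<in> Arr \<D>" "Dom \<D> (\<tau> A) = FObj G A" "Cod \<D> (\<tau> A) = FObj H A" if "A \<in> Obj \<C>" for A
    using t.component_in_hom[OF that] by (simp_all add: hom_iff)
  show ?thesis
  proof unfold_locales
    fix f A B assume f: "f \<in> hom \<C> A B"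
    then have [simp]: "f \<in> Arr \<C>" "Dom \<C> f = A" "Cod \<C> f = B" "A \<in> Obj \<C>" "B \<in> Obj \<C>"
      using s.F.dom.dom_Obj[of f] s.F.dom.cod_Obj[of f] by (auto simp: hom_iff)
    have "(\<tau> B \<cdot> \<sigma> B) \<cdot> FArr F f = \<tau> B \<cdot> (\<sigma> B \<cdot> FArr F f)"
      by simp
    also have "\<dots> = (\<tau> B \<cdot> FArr G f) \<cdot> \<sigma> A"
      by (simp add: s.naturality[OF f])
    also have "\<dots> = FArr H f \<cdot> (\<tau> A \<cdot> \<sigma> A)"
      by (simp add: t.naturality[OF f])
    finally show "(\<lambda>A\<in>Obj \<C>. \<tau> A \<cdot> \<sigma> A) B \<cdot> FArr F f
      = FArr H f \<cdot> (\<lambda>A\<in>Obj \<C>. \<tau> A \<cdot> \<sigma> A) A"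
      by simp
  qed (simp add: hom_iff)
qed

lemma monoidal_nat_trans_comp:
  fixes \<D> :: "('p, 'n, 'y) cat_scheme" (structure)
  assumes "monoidal_nat_trans \<C> M \<D> N F F2 F0 G G2 G0 \<sigma>" "monoidal_nat_trans \<C> M \<D> N G G2 G0 H H2 H0 \<tau>"
  shows "monoidal_nat_trans \<C> M \<D> N F F2 F0 H H2 H0 (\<lambda>A\<in>Obj \<C>. \<tau> A \<cdot> \<sigma> A)"
proof -
  interpret s: monoidal_nat_trans \<C> M \<D> N F F2 F0 G G2 G0 \<sigma> by (rule assms)
  interpret t: monoidal_nat_trans \<C> M \<D> N G G2 G0 H H2 H0 \<tau> by (rule assms)
  interpret st: nat_trans \<C> \<D> F H "\<lambda>A\<in>Obj \<C>. \<tau> A \<cdot> \<sigma> A"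
    by (rule nat_trans_comp[OF s.nat_trans_axioms t.nat_trans_axioms])
  have s [simp]: "\<sigma> A \<in> Arr \<D>" "Dom \<D> (\<sigma> A) = FObj F A" "Cod \<D> (\<sigma> A) = FObj G A" if "A \<in> Obj \<C>" for A
    using s.component_in_hom[OF that] by (simp_all add: hom_iff)
  have t [simp]: "\<tau> A \<in> Arr \<D>" "Dom \<D> (\<tau> A) = FObj G A" "Cod \<D> (\<tau> A) = FObj H A" if "A \<in> Obj \<C>" for A
    using t.component_in_hom[OF that] by (simp_all add: hom_iff)
  show ?thesis
  proof unfold_locales
    show "(\<lambda>A\<in>Obj \<C>. \<tau> A \<cdot> \<sigma> A) \<e>\<^bsub>M\<^esub> \<cdot> F0 = H0"
      by (simp add: s.component_unit t.component_unit)
  next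
    fix A B assume [simp]: "A \<in> Obj \<C>" "B \<in> Obj \<C>"
    have "(\<tau> (A \<odot>\<^bsub>M\<^esub> B) \<cdot> \<sigma> (A \<odot>\<^bsub>M\<^esub> B)) \<cdot> F2 A B
        = (\<tau> (A \<odot>\<^bsub>M\<^esub> B) \<cdot> G2 A B) \<cdot> (\<sigma> A \<star>\<^bsub>N\<^esub> \<sigma> B)"
      by (simp add: s.component_tensor)
    also have "\<dots> = H2 A B \<cdot> ((\<tau> A \<cdot> \<sigma> A) \<star>\<^bsub>N\<^esub> (\<tau> B \<cdot> \<sigma> B))"
      by (simp add: t.component_tensor)
    finally show "(\<lambda>A\<in>Obj \<C>. \<tau> A \<cdot> \<sigma> A) (A \<odot>\<^bsub>M\<^esub> B) \<cdot> F2 A B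
        = H2 A B \<cdot> ((\<lambda>A\<in>Obj \<C>. \<tau> A \<cdot> \<sigma> A) A \<star>\<^bsub>N\<^esub> (\<lambda>A\<in>Obj \<C>. \<tau> A \<cdot> \<sigma> A) B)"
      by simp
  qed
qed

lemma monoidal_nat_trans_ident:
  fixes \<D> :: "('p, 'n, 'y) cat_scheme" (structure)
  assumes "monoidal_functor \<C> M \<D> N F F2 F0"
  shows "monoidal_nat_trans \<C> M \<D> N F F2 F0 F F2 F0 (\<lambda>A\<in>Obj \<C>. \<i> (FObj F A))"
proof -
  interpret monoidal_functor \<C> M \<D> N F F2 F0 by (rule assms)
  interpret nat_trans \<C> \<D> F F "\<lambda>A\<in>Obj \<C>. \<i> (FObj F A)"
    by unfold_locales (auto simp: hom_iff)
  show ?thesis by unfold_locales simp_all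
qed

lemma monoidal_nat_trans_inverse:
  fixes \<D> :: "('p, 'n, 'y) cat_scheme" (structure)
  assumes "monoidal_nat_trans \<C> M \<D> N F F2 F0 G G2 G0 \<tau>"
    and iso: "\<And>A. A \<in> Obj \<C> \<Longrightarrow> is_iso \<D> (\<tau> A)"
  shows "monoidal_nat_trans \<C> M \<D> N G G2 G0 F F2 F0 (\<lambda>A\<in>Obj \<C>. inv_arr \<D> (\<tau> A))"
proof -
  interpret t: monoidal_nat_trans \<C> M \<D> N F F2 F0 G G2 G0 \<tau> by (rule assms)
  let ?v = "\<lambda>A. inv_arr \<D> (\<tau> A)"
  have t [simp]: "\<tau> A \<in> Arr \<D>" "Dom \<D> (\<tau> A) = FObj F A" "Cod \<D> (\<tau> A) = FObj G A" if "A \<in> Obj \<C>" for A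
    using t.component_in_hom[OF that] by (simp_all add: hom_iff)
  have v [simp]: "?v A \<in> Arr \<D>" "Dom \<D> (?v A) = FObj G A" "Cod \<D> (?v A) = FObj F A"
      "?v A \<cdot> \<tau> A = \<i> (FObj F A)" "\<tau> A \<cdot> ?v A = \<i> (FObj G A)"
      "\<And>x. x \<in> Arr \<D> \<Longrightarrow> Cod \<D> x = FObj G A \<Longrightarrow> \<tau> A \<cdot> (?v A \<cdot> x) = x" if "A \<in> Obj \<C>" for A
    using t.F.cod.inv_arr_simps[OF iso[OF that]] t.F.cod.inv_arr_cancel(2)[OF iso[OF that]] that by simp_all
  interpret nat_trans \<C> \<D> G F "\<lambda>A\<in>Obj \<C>. ?v A"
  proof unfold_locales
    fix f A B assume f: "f \<in> hom \<C> A B"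
    then have [simp]: "f \<in> Arr \<C>" "Dom \<C> f = A" "Cod \<C> f = B" "A \<in> Obj \<C>" "B \<in> Obj \<C>"
      using t.F.dom.dom_Obj[of f] t.F.dom.cod_Obj[of f] by (auto simp: hom_iff)
    have "\<tau> B \<cdot> (FArr F f \<cdot> ?v A) = (\<tau> B \<cdot> FArr F f) \<cdot> ?v A"
      by simp
    also have "\<dots> = \<tau> B \<cdot> (?v B \<cdot> FArr G f)"
      unfolding t.naturality[OF f] by simp
    finally have "?v B \<cdot> FArr G f = FArr F f \<cdot> ?v A"
      by - (rule t.F.cod.iso_cancel_left[OF iso[of B]], simp_all)
    then show "(\<lambda>A\<in>Obj \<C>. ?v A) B \<cdot> FArr G f = FArr F f \<cdot> (\<lambda>A\<in>Obj \<C>. ?v A) A"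
      by simp
  qed (simp add: hom_iff)
  show ?thesis
  proof unfold_locales
    have "?v \<e>\<^bsub>M\<^esub> \<cdot> G0 = F0"
      unfolding t.component_unit[symmetric] using t.F.cod.inv_arr_cancel(1)[OF iso[of "\<e>\<^bsub>M\<^esub>"], of F0] by simp
    then show "(\<lambda>A\<in>Obj \<C>. ?v A) \<e>\<^bsub>M\<^esub> \<cdot> G0 = F0" by simp
  next
    fix A B assume [simp]: "A \<in> Obj \<C>" "B \<in> Obj \<C>"
    have "\<tau> (A \<odot>\<^bsub>M\<^esub> B) \<cdot> (F2 A B \<cdot> (?v A \<star>\<^bsub>N\<^esub> ?v B))
        = (\<tau> (A \<odot>\<^bsub>M\<^esub> B) \<cdot> F2 A B) \<cdot> (?v A \<star>\<^bsub>N\<^esub> ?v B)"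
      by simp
    also have "\<dots> = \<tau> (A \<odot>\<^bsub>M\<^esub> B) \<cdot> (?v (A \<odot>\<^bsub>M\<^esub> B) \<cdot> G2 A B)"
      by (simp add: t.component_tensor)
    finally have "?v (A \<odot>\<^bsub>M\<^esub> B) \<cdot> G2 A B = F2 A B \<cdot> (?v A \<star>\<^bsub>N\<^esub> ?v B)"
      by - (rule t.F.cod.iso_cancel_left[OF iso[of "A \<odot>\<^bsub>M\<^esub> B"]], simp_all)
    then show "(\<lambda>A\<in>Obj \<C>. ?v A) (A \<odot>\<^bsub>M\<^esub> B) \<cdot> G2 A B
        = F2 A B \<cdot> ((\<lambda>A\<in>Obj \<C>. ?v A) A \<star>\<^bsub>N\<^esub> (\<lambda>A\<in>Obj \<C>. ?v A) B)"
      by simp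
  qed
qed

lemma Bi_fbr_r_simps [simp]:
  "Obj (Bi_fbr_r \<C> \<D>) = robust_ftors \<C> \<D>" "Dom (Bi_fbr_r \<C> \<D>) = Src" "Cod (Bi_fbr_r \<C> \<D>) = Tgt"
  "Ident (Bi_fbr_r \<C> \<D>) F = \<lparr>Src = F, Tgt = F, At = (\<lambda>A\<in>Obj \<C>. \<i>\<^bsub>\<D>\<^esub> (FObj F A))\<rparr>"
  "Compose (Bi_fbr_r \<C> \<D>) s t = \<lparr>Src = Src t, Tgt = Tgt s, At = (\<lambda>A\<in>Obj \<C>. At s A \<cdot>\<^bsub>\<D>\<^esub> At t A)\<rparr>"
  by (simp_all add: Bi_fbr_r_def)

lemma Bi_fbr_r_hom:
  "t \<in> hom (Bi_fbr_r \<C> \<D>) F G \<longleftrightarrow> Src t = F \<and> Tgt t = G \<and> F \<in> robust_ftors \<C> \<D> \<and> G \<in> robust_ftors \<C> \<D> \<and>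
     bimonoidal_nat_trans \<C> \<D> F G (At t) \<and> At t \<in> extensional (Obj \<C>)"
  by (auto simp: hom_iff Bi_fbr_r_def)

theorem Bi_fbr_r_category: "category (Bi_fbr_r \<C> \<D>)"
proof
  fix f assume "f \<in> Arr (Bi_fbr_r \<C> \<D>)"
  then show "Dom (Bi_fbr_r \<C> \<D>) f \<in> Obj (Bi_fbr_r \<C> \<D>)" "Cod (Bi_fbr_r \<C> \<D>) f \<in> Obj (Bi_fbr_r \<C> \<D>)"
    by (simp_all add: Bi_fbr_r_def)
next
  fix F assume F: "F \<in> Obj (Bi_fbr_r \<C> \<D>)"
  then interpret robust_braided_bimonoidal_functor \<C> \<D> F
    by (simp add: robust_ftors_def)
  have "bimonoidal_nat_trans \<C> \<D> F F (\<lambda>A\<in>Obj \<C>. \<i>\<^bsub>\<D>\<^esub> (FObj F A))"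
    by (intro bimonoidal_nat_trans.intro monoidal_nat_trans_ident braided_bimonoidal_functor_axioms
        add.monoidal_functor_axioms mul.monoidal_functor_axioms)
  with F show "Ident (Bi_fbr_r \<C> \<D>) F \<in> hom (Bi_fbr_r \<C> \<D>) F F"
    by (simp add: Bi_fbr_r_hom)
next
  fix s t F G H
  assume s: "s \<in> hom (Bi_fbr_r \<C> \<D>) F G" and t: "t \<in> hom (Bi_fbr_r \<C> \<D>) G H"
  interpret s: bimonoidal_nat_trans \<C> \<D> F G "At s" using s by (simp add: Bi_fbr_r_hom)
  interpret t: bimonoidal_nat_trans \<C> \<D> G H "At t" using t by (simp add: Bi_fbr_r_hom)
  have "bimonoidal_nat_trans \<C> \<D> F H (\<lambda>A\<in>Obj \<C>. At t A \<cdot>\<^bsub>\<D>\<^esub> At s A)"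
    by (intro bimonoidal_nat_trans.intro s.F.braided_bimonoidal_functor_axioms t.G.braided_bimonoidal_functor_axioms
        monoidal_nat_trans_comp[OF s.add.monoidal_nat_trans_axioms t.add.monoidal_nat_trans_axioms]
        monoidal_nat_trans_comp[OF s.mul.monoidal_nat_trans_axioms t.mul.monoidal_nat_trans_axioms])
  with s t show "Compose (Bi_fbr_r \<C> \<D>) t s \<in> hom (Bi_fbr_r \<C> \<D>) F H"
    by (simp add: Bi_fbr_r_hom)
next
  fix t F G assume t: "t \<in> hom (Bi_fbr_r \<C> \<D>) F G"
  interpret t: bimonoidal_nat_trans \<C> \<D> F G "At t" using t by (simp add: Bi_fbr_r_hom)
  have At: "At t A \<in> hom \<D> (FObj F A) (FObj G A)" if "A \<in> Obj \<C>" for A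
    using t.add.component_in_hom[OF that] .
  from t have ext: "At t \<in> extensional (Obj \<C>)" by (simp add: Bi_fbr_r_hom)
  have "(\<lambda>A\<in>Obj \<C>. (\<lambda>A\<in>Obj \<C>. \<i>\<^bsub>\<D>\<^esub> (FObj G A)) A \<cdot>\<^bsub>\<D>\<^esub> At t A) = At t"
    using ext At by (intro extensionalityI[of _ "Obj \<C>"]) (auto simp: t.F.target.add.ident_left[OF At])
  with t show "Compose (Bi_fbr_r \<C> \<D>) (Ident (Bi_fbr_r \<C> \<D>) G) t = t"
    by (simp add: Bi_fbr_r_hom)
  have "(\<lambda>A\<in>Obj \<C>. At t A \<cdot>\<^bsub>\<D>\<^esub> (\<lambda>A\<in>Obj \<C>. \<i>\<^bsub>\<D>\<^esub> (FObj F A)) A) = At t"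
    using ext At by (intro extensionalityI[of _ "Obj \<C>"]) (auto simp: t.F.target.add.ident_right[OF At])
  with t show "Compose (Bi_fbr_r \<C> \<D>) t (Ident (Bi_fbr_r \<C> \<D>) F) = t"
    by (simp add: Bi_fbr_r_hom)
next
  fix s t u F G H I
  assume s: "s \<in> hom (Bi_fbr_r \<C> \<D>) F G" and t: "t \<in> hom (Bi_fbr_r \<C> \<D>) G H" and u: "u \<in> hom (Bi_fbr_r \<C> \<D>) H I"
  interpret s: bimonoidal_nat_trans \<C> \<D> F G "At s" using s by (simp add: Bi_fbr_r_hom)
  interpret t: bimonoidal_nat_trans \<C> \<D> G H "At t" using t by (simp add: Bi_fbr_r_hom)
  interpret u: bimonoidal_nat_trans \<C> \<D> H I "At u" using u by (simp add: Bi_fbr_r_hom)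
  have "(At u A \<cdot>\<^bsub>\<D>\<^esub> At t A) \<cdot>\<^bsub>\<D>\<^esub> At s A = At u A \<cdot>\<^bsub>\<D>\<^esub> (At t A \<cdot>\<^bsub>\<D>\<^esub> At s A)" if "A \<in> Obj \<C>" for A
    by (rule s.F.target.add.comp_assoc[OF s.add.component_in_hom[OF that] t.add.component_in_hom[OF that]
          u.add.component_in_hom[OF that]])
  then show "Compose (Bi_fbr_r \<C> \<D>) (Compose (Bi_fbr_r \<C> \<D>) u t) s
      = Compose (Bi_fbr_r \<C> \<D>) u (Compose (Bi_fbr_r \<C> \<D>) t s)"
    by (auto simp: fun_eq_iff)
qed

lemma terminal_category: "category terminal_cat"
  by unfold_locales (auto simp: terminal_cat_def hom_iff)

text \<open>The arrows \<open>u F\<close> identify every object with \<open>P\<close>. Naturality of the inverses of \<open>u\<close> is the uniqueness of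
  arrows out of \<open>P\<close>.\<close>

lemma (in category) equivalence_terminal:
  assumes P: "P \<in> Obj \<C>"
    and u: "\<And>F. F \<in> Obj \<C> \<Longrightarrow> u F \<in> hom \<C> P F" "\<And>F. F \<in> Obj \<C> \<Longrightarrow> is_iso \<C> (u F)"
    and unique: "\<And>F t. t \<in> hom \<C> P F \<Longrightarrow> t = u F"
  shows "\<exists>T. cat_functor \<C> terminal_cat T \<and> (\<forall>T'. cat_functor \<C> terminal_cat T' \<longrightarrow> T' = T) \<and>
    cat_equivalence \<C> terminal_cat T"
proof -
  interpret one: category terminal_cat by (rule terminal_category)
  define T :: "('o, 'm, unit, unit) ftor" where "T = \<lparr>FObj = (\<lambda>_. ()), FArr = (\<lambda>_. ())\<rparr>"
  interpret T: cat_functor \<C> terminal_cat T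
    by unfold_locales (auto simp: terminal_cat_def hom_iff)
  have T_unique: "T' = T" for T'
    by (cases T') (simp add: T_def fun_eq_iff)
  define G :: "(unit, unit, 'o, 'm) ftor" where "G = \<lparr>FObj = (\<lambda>_. P), FArr = (\<lambda>_. \<i> P)\<rparr>"
  interpret G: cat_functor terminal_cat \<C> G
    by unfold_locales (use P in \<open>auto simp: G_def hom_iff\<close>)
  interpret id: cat_functor \<C> \<C> id_ftor
    by unfold_locales (auto simp: id_ftor_def hom_iff)
  interpret GT: cat_functor \<C> \<C> "comp_ftor G T"
    by unfold_locales (use P in \<open>auto simp: G_def comp_ftor_def hom_iff\<close>)
  have u_arr: "u F \<in> Arr \<C>" "Dom \<C> (u F) = P" "Cod \<C> (u F) = F" if "F \<in> Obj \<C>" for F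
    using u(1)[OF that] by (simp_all add: hom_iff)
  note v = inv_arr_simps[OF u(2)]
  have nat: "inv_arr \<C> (u B) \<cdot> f = inv_arr \<C> (u A)" if f: "f \<in> Arr \<C>" "Dom \<C> f = A" "Cod \<C> f = B" for f A B
  proof (rule iso_cancel_right[OF u(2)])
    have obj: "A \<in> Obj \<C>" "B \<in> Obj \<C>" using f by auto
    show "A \<in> Obj \<C>" by (rule obj)
    have "f \<cdot> u A = u B"
      using f obj u_arr by (intro unique) (simp add: hom_iff)
    then show "(inv_arr \<C> (u B) \<cdot> f) \<cdot> u A = inv_arr \<C> (u A) \<cdot> u A"
      using f obj u_arr v by simp
  qed (use that v u_arr in auto)
  have "nat_iso \<C> \<C> id_ftor (comp_ftor G T) (\<lambda>F. inv_arr \<C> (u F))"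
    by unfold_locales (auto simp: id_ftor_def comp_ftor_def G_def hom_iff v u_arr nat P is_iso_inv u(2))
  moreover have "nat_iso terminal_cat terminal_cat (comp_ftor T G) id_ftor (\<lambda>_. ())"
    by unfold_locales (auto simp: terminal_cat_def hom_iff is_iso_def inverse_arrows_def)
  ultimately have "cat_equivalence \<C> terminal_cat T"
    unfolding cat_equivalence_def using T.cat_functor_axioms G.cat_functor_axioms by blast
  then show ?thesis
    using T.cat_functor_axioms T_unique by blast
qed

lemma Bi_fbr_r_iso:
  assumes t: "t \<in> hom (Bi_fbr_r \<C> \<D>) F G" and iso: "\<And>A. A \<in> Obj \<C> \<Longrightarrow> is_iso \<D> (At t A)"
  shows "is_iso (Bi_fbr_r \<C> \<D>) t"
proof -
  interpret B: category "Bi_fbr_r \<C> \<D>" by (rule Bi_fbr_r_category)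
  interpret t: bimonoidal_nat_trans \<C> \<D> F G "At t" using t by (simp add: Bi_fbr_r_hom)
  let ?v = "\<lparr>Src = G, Tgt = F, At = (\<lambda>A\<in>Obj \<C>. inv_arr \<D> (At t A))\<rparr>"
  have "bimonoidal_nat_trans \<C> \<D> G F (\<lambda>A\<in>Obj \<C>. inv_arr \<D> (At t A))"
    by (intro bimonoidal_nat_trans.intro t.F.braided_bimonoidal_functor_axioms t.G.braided_bimonoidal_functor_axioms
        monoidal_nat_trans_inverse[OF t.add.monoidal_nat_trans_axioms iso]
        monoidal_nat_trans_inverse[OF t.mul.monoidal_nat_trans_axioms iso])
  with t have v: "?v \<in> hom (Bi_fbr_r \<C> \<D>) G F"
    by (simp add: Bi_fbr_r_hom)
  have At: "Dom \<D> (At t A) = FObj F A" "Cod \<D> (At t A) = FObj G A" if "A \<in> Obj \<C>" for A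
    using t.add.component_in_hom[OF that] by (simp_all add: hom_iff)
  have "Compose (Bi_fbr_r \<C> \<D>) ?v t = Ident (Bi_fbr_r \<C> \<D>) F"
    "Compose (Bi_fbr_r \<C> \<D>) t ?v = Ident (Bi_fbr_r \<C> \<D>) G"
    using t t.F.target.add.inv_arr_simps[OF iso] At by (auto simp: Bi_fbr_r_hom fun_eq_iff)
  moreover have "t \<in> Arr (Bi_fbr_r \<C> \<D>)" "?v \<in> Arr (Bi_fbr_r \<C> \<D>)" "Src t = F" "Tgt t = G"
    using t v by (simp_all only: hom_iff Bi_fbr_r_simps)
  ultimately show ?thesis
    by (intro B.is_isoI[of t ?v]) (simp_all del: Bi_fbr_r_simps(5))
qed

theorem mainTheorem13:
  shows "flat_braided_bimonoidal_category Sigma_prime \<and>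
    (\<forall>C :: ('o, 'm) braided_bimon. flat_braided_bimonoidal_category C \<longrightarrow>
       (\<exists>T. cat_functor (Bi_fbr_r Sigma_prime C) terminal_cat T \<and>
            (\<forall>T'. cat_functor (Bi_fbr_r Sigma_prime C) terminal_cat T' \<longrightarrow> T' = T) \<and>
            cat_equivalence (Bi_fbr_r Sigma_prime C) terminal_cat T))"
proof (intro conjI allI impI)
  show "flat_braided_bimonoidal_category Sigma_prime" by (rule Sigma_flat)
next
  fix C :: "('o, 'm) braided_bimon"
  assume "flat_braided_bimonoidal_category C"
  then interpret C: flat_braided_bimonoidal_category C .
  let ?B = "Bi_fbr_r Sigma_prime C"
  let ?P = "C.power_ftor"
  interpret B: category ?B by (rule Bi_fbr_r_category)
  have P: "?P \<in> robust_ftors \<Sigma> C"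
    by (rule power_ftor_robust) unfold_locales
  define u where "u F = \<lparr>Src = ?P, Tgt = F, At = power_comparison.cmp C F\<rparr>" for F
  have cmp: "power_comparison C F" if "F \<in> robust_ftors \<Sigma> C" for F
    using that by (simp add: robust_ftors_def power_comparison_def)
  have u_hom: "u F \<in> hom ?B ?P F" if F: "F \<in> Obj ?B" for F
    using F P power_comparison.cmp_transformation[OF cmp, of F] by (simp add: Bi_fbr_r_hom u_def)
  have u_iso: "is_iso ?B (u F)" if F: "F \<in> Obj ?B" for F
    using power_comparison.cmp_iso[OF cmp, of F] F
    by (intro Bi_fbr_r_iso[OF u_hom[OF F]]) (simp add: u_def)
  have u_unique: "t = u F" if t: "t \<in> hom ?B ?P F" for F t
    using t power_comparison.cmp_unique[OF cmp, of F "At t"]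
    by (cases t) (simp add: Bi_fbr_r_hom u_def fun_eq_iff)
  show "\<exists>T. cat_functor ?B terminal_cat T \<and>
      (\<forall>T'. cat_functor ?B terminal_cat T' \<longrightarrow> T' = T) \<and> cat_equivalence ?B terminal_cat T"
    using P by (intro B.equivalence_terminal[OF _ u_hom u_iso u_unique]) simp_all
qed


end
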